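(* Let $(R,\mathfrak m)$ be a Cohen-Macaulay local ring of dimension $d\ge 1$ with infinite residue field and with a canonical module $\omega$, let $I$ be an $\mathfrak m$-primary ideal, and let $M$ be a maximal Cohen-Macaulay $R$-module. Let $x\in I\setminus I^2$ be an element such that (1) $x$ is superficial with respect to $I$ for the module $R\oplus\omega$, and (2) $xt\in\mathcal R(I)_1$ is $D^1_I(M)\oplus D^2_I(M)$-filter regular. Set $S=R/xR$, $J=I/(x)$ and $N=M/xM$. Then: (a) $\varepsilon^0_M(I,n)-\varepsilon^0_M(I,n-1)=\varepsilon^0_N(J,n)$ for $n\gg0$; (b) $\varepsilon^1_M(I,n)-\varepsilon^1_M(I,n-1)=\varepsilon^1_N(J,n)$ for $n\gg0$.
   Context: $\mathcal R(I)=\bigoplus_{n\ge0}I^n$ is the Rees algebra (with $xt$ denoting $x\in I$ placed in degree $1$). For $i\ge1$, $D^i_I(M)=\bigoplus_{n\ge0}\operatorname{Ext}^i_R(M,\omega/I^n\omega)$, a finitely generated graded $\mathcal R(I)$-module, where $at$ (with $a\in I$) acts by the maps induced by multiplication by $a$, $\omega/I^n\omega\to\omega/I^{n+1}\omega$. An element $x\in I$ is superficial with respect to $I$ for a finitely generated module $E$ if there is $c\ge0$ with $(I^{n+1}E:_E x)\cap I^cE=I^nE$ for all $n\ge c$. For a finitely generated graded $\mathcal R(I)$-module $E=\bigoplus_n E_n$, $xt$ is $E$-filter regular if multiplication by $xt$, $E_n\to E_{n+1}$, is injective for all $n\gg0$. For $i\ge0$, $\varepsilon^i_M(I,t)$ is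 the polynomial with $\varepsilon^i_M(I,n)=\ell(\operatorname{Ext}^i_R(M,\omega/I^{n+1}\omega))$ for $n\gg0$ (such a polynomial exists). The element $x$ is regular on $R$, $\omega$ and $M$; $S$ is Cohen-Macaulay of dimension $d-1$ with canonical module $\omega_S=\omega/x\omega$, and $\varepsilon^i_N(J,t)$ is defined in the same way over $S$: $\varepsilon^i_N(J,n)=\ell(\operatorname{Ext}^i_S(N,\omega_S/J^{n+1}\omega_S))$ for $n\gg0$. *)

theory Defs
  imports "HOL-Computational_Algebra.Polynomial" "HOL-Library.Extended_Nat" "HOL-Algebra.UnivPoly"
    "HOL-Algebra.Ideal_Product" "HOL-Algebra.Ring_Divisibility"
begin

section \<open>Modules\<close>

text \<open>The multiplicative fields that the record type \<open>module\<close> inherits from rings play no role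
  for modules and are left \<open>undefined\<close>.\<close>

definition self_module :: "('a, 'r) ring_scheme \<Rightarrow> ('a, 'a) module" where
  "self_module R = \<lparr>carrier = carrier R, mult = mult R, one = one R,
     zero = \<zero>\<^bsub>R\<^esub>, add = add R, smult = mult R\<rparr>"

definition free_module :: "('a, 'r) ring_scheme \<Rightarrow> nat \<Rightarrow> ('a, nat \<Rightarrow> 'a) module" where
  "free_module R n = \<lparr>carrier = {v. (\<forall>i<n. v i \<in> carrier R) \<and> (\<forall>i\<ge>n. v i = \<zero>\<^bsub>R\<^esub>)},
     mult = undefined, one = undefined,
     zero = (\<lambda>i. \<zero>\<^bsub>R\<^esub>), add = (\<lambda>v w i. v i \<oplus>\<^bsub>R\<^esub> w i), smult = (\<lambda>a v i. a \<otimes>\<^bsub>R\<^esub> v i)\<rparr>"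

definition direct_sum :: "('a, 'b, 'm) module_scheme \<Rightarrow> ('a, 'c, 'n) module_scheme
    \<Rightarrow> ('a, 'b \<times> 'c) module" where
  "direct_sum M N = \<lparr>carrier = carrier M \<times> carrier N,
     mult = undefined, one = undefined,
     zero = (\<zero>\<^bsub>M\<^esub>, \<zero>\<^bsub>N\<^esub>),
     add = (\<lambda>(u, v) (u', v'). (u \<oplus>\<^bsub>M\<^esub> u', v \<oplus>\<^bsub>N\<^esub> v')),
     smult = (\<lambda>a (u, v). (a \<odot>\<^bsub>M\<^esub> u, a \<odot>\<^bsub>N\<^esub> v))\<rparr>"

definition fact_module :: "('a, 'b, 'm) module_scheme \<Rightarrow> 'b set \<Rightarrow> ('a, 'b set) module" where
  "fact_module M K = \<lparr>carrier = a_rcosets\<^bsub>M\<^esub> K,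
     mult = undefined, one = undefined,
     zero = K, add = set_add M, smult = (\<lambda>a X. \<Union>u\<in>X. K +>\<^bsub>M\<^esub> (a \<odot>\<^bsub>M\<^esub> u))\<rparr>"

text \<open>An \<open>R\<close>-module \<open>M\<close> annihilated by an ideal \<open>A\<close>, regarded as an \<open>R/A\<close>-module. A coset
  \<open>X \<in> R/A\<close> acts as any of its representatives, i.e. the image set below is a singleton.\<close>

definition module_over_quot :: "('a, 'b, 'm) module_scheme \<Rightarrow> ('a set, 'b) module" where
  "module_over_quot M = \<lparr>carrier = carrier M,
     mult = undefined, one = undefined,
     zero = \<zero>\<^bsub>M\<^esub>, add = add M, smult = (\<lambda>X u. the_elem ((\<lambda>a. a \<odot>\<^bsub>M\<^esub> u) ` X))\<rparr>"

text \<open>\<open>M/xM\<close> as a module over \<open>R/xR\<close>.\<close>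

definition mod_elt :: "('a, 'b, 'm) module_scheme \<Rightarrow> 'a \<Rightarrow> ('a set, 'b set) module" where
  "mod_elt M x = module_over_quot (fact_module M ((\<lambda>u. x \<odot>\<^bsub>M\<^esub> u) ` carrier M))"

definition fin_gen_module :: "('a, 'r) ring_scheme \<Rightarrow> ('a, 'b, 'm) module_scheme \<Rightarrow> bool" where
  "fin_gen_module R M \<longleftrightarrow> module R M \<and>
     (\<exists>A. finite A \<and> A \<subseteq> carrier M \<and> (\<forall>H. submodule H R M \<and> A \<subseteq> H \<longrightarrow> H = carrier M))"

text \<open>The length is the supremum of the lengths of strict chains of submodules.\<close>

definition module_length :: "('a, 'r) ring_scheme \<Rightarrow> ('a, 'b, 'm) module_scheme \<Rightarrow> enat" where
  "module_length R M = Sup {enat n |n. \<exists>H :: nat \<Rightarrow> 'b set.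
     (\<forall>i\<le>n. submodule (H i) R M) \<and> (\<forall>i<n. H i \<subset> H (Suc i))}"

definition module_homs :: "('a, 'r) ring_scheme \<Rightarrow> ('a, 'b, 'm) module_scheme
    \<Rightarrow> ('a, 'c, 'n) module_scheme \<Rightarrow> ('b \<Rightarrow> 'c) set" where
  "module_homs R M N = {f \<in> carrier M \<rightarrow>\<^sub>E carrier N.
     (\<forall>u\<in>carrier M. \<forall>v\<in>carrier M. f (u \<oplus>\<^bsub>M\<^esub> v) = f u \<oplus>\<^bsub>N\<^esub> f v) \<and>
     (\<forall>a\<in>carrier R. \<forall>u\<in>carrier M. f (a \<odot>\<^bsub>M\<^esub> u) = a \<odot>\<^bsub>N\<^esub> f u)}"

definition hom_module :: "('a, 'r) ring_scheme \<Rightarrow> ('a, 'b, 'm) module_scheme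
    \<Rightarrow> ('a, 'c, 'n) module_scheme \<Rightarrow> ('a, 'b \<Rightarrow> 'c) module" where
  "hom_module R M N = \<lparr>carrier = module_homs R M N,
     mult = undefined, one = undefined,
     zero = (\<lambda>u\<in>carrier M. \<zero>\<^bsub>N\<^esub>),
     add = (\<lambda>f g. \<lambda>u\<in>carrier M. f u \<oplus>\<^bsub>N\<^esub> g u),
     smult = (\<lambda>a f. \<lambda>u\<in>carrier M. a \<odot>\<^bsub>N\<^esub> f u)\<rparr>"

text \<open>The submodule \<open>IM\<close>, in the style of the library's \<open>ideal_prod\<close>.\<close>

inductive_set ideal_smult :: "'a set \<Rightarrow> ('a, 'b, 'm) module_scheme \<Rightarrow> 'b set"
  for I and M (structure) where
  smult: "\<lbrakk>a \<in> I; u \<in> carrier M\<rbrakk> \<Longrightarrow> a \<odot>\<^bsub>M\<^esub> u \<in> ideal_smult I M"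
| sum: "\<lbrakk>u \<in> ideal_smult I M; v \<in> ideal_smult I M\<rbrakk> \<Longrightarrow> u \<oplus>\<^bsub>M\<^esub> v \<in> ideal_smult I M"

abbreviation ideal_pow :: "('a, 'r) ring_scheme \<Rightarrow> 'a set \<Rightarrow> nat \<Rightarrow> 'a set" where
  "ideal_pow R I n \<equiv> I [^]\<^bsub>ideals_set R\<^esub> n"

abbreviation pow_smult :: "('a, 'r) ring_scheme \<Rightarrow> 'a set \<Rightarrow> nat
    \<Rightarrow> ('a, 'b, 'm) module_scheme \<Rightarrow> 'b set" where
  "pow_smult R I n M \<equiv> ideal_smult (ideal_pow R I n) M"


section \<open>Ext\<close>

text \<open>Resolutions \<open>\<dots> \<rightarrow> R\<^bsup>b 2\<^esup> \<rightarrow> R\<^bsup>b 1\<^esup> \<rightarrow> R\<^bsup>b 0\<^esup> \<rightarrow> M \<rightarrow> 0\<close> with differentials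
  \<open>\<delta> i : R\<^bsup>b (i + 1)\<^esup> \<rightarrow> R\<^bsup>b i\<^esup>\<close> and augmentation \<open>\<pi>\<close>. They exist for every finitely generated
  module over a Noetherian ring, which is the only case in which \<open>Ext\<close> is used below.\<close>

definition free_resolution :: "('a, 'r) ring_scheme \<Rightarrow> ('a, 'b, 'm) module_scheme
    \<Rightarrow> (nat \<Rightarrow> nat) \<Rightarrow> (nat \<Rightarrow> (nat \<Rightarrow> 'a) \<Rightarrow> (nat \<Rightarrow> 'a)) \<Rightarrow> ((nat \<Rightarrow> 'a) \<Rightarrow> 'b) \<Rightarrow> bool" where
  "free_resolution R M b \<delta> \<pi> \<longleftrightarrow>
     \<pi> \<in> module_homs R (free_module R (b 0)) M \<and>
     (\<forall>i. \<delta> i \<in> module_homs R (free_module R (b (Suc i))) (free_module R (b i))) \<and>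
     \<pi> ` carrier (free_module R (b 0)) = carrier M \<and>
     \<delta> 0 ` carrier (free_module R (b 1)) = {v \<in> carrier (free_module R (b 0)). \<pi> v = \<zero>\<^bsub>M\<^esub>} \<and>
     (\<forall>i. \<delta> (Suc i) ` carrier (free_module R (b (Suc (Suc i)))) =
       {v \<in> carrier (free_module R (b (Suc i))). \<delta> i v = \<zero>\<^bsub>free_module R (b i)\<^esub>})"

text \<open>One resolution of \<open>M\<close> is fixed once and for all, so that \<open>Ext R i M N\<close> is functorial
  in \<open>N\<close> on the nose.\<close>

definition chosen_resolution :: "('a, 'r) ring_scheme \<Rightarrow> ('a, 'b, 'm) module_scheme
    \<Rightarrow> (nat \<Rightarrow> nat) \<times> (nat \<Rightarrow> (nat \<Rightarrow> 'a) \<Rightarrow> (nat \<Rightarrow> 'a))" where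
  "chosen_resolution R M = (SOME (b, \<delta>). \<exists>\<pi>. free_resolution R M b \<delta> \<pi>)"

definition res_module :: "('a, 'r) ring_scheme \<Rightarrow> ('a, 'b, 'm) module_scheme \<Rightarrow> nat
    \<Rightarrow> ('a, nat \<Rightarrow> 'a) module" where
  "res_module R M i = free_module R (fst (chosen_resolution R M) i)"

definition res_diff :: "('a, 'r) ring_scheme \<Rightarrow> ('a, 'b, 'm) module_scheme \<Rightarrow> nat
    \<Rightarrow> (nat \<Rightarrow> 'a) \<Rightarrow> (nat \<Rightarrow> 'a)" where
  "res_diff R M = snd (chosen_resolution R M)"

definition cochains :: "('a, 'r) ring_scheme \<Rightarrow> nat \<Rightarrow> ('a, 'b, 'm) module_scheme
    \<Rightarrow> ('a, 'c, 'n) module_scheme \<Rightarrow> ('a, (nat \<Rightarrow> 'a) \<Rightarrow> 'c) module" where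
  "cochains R i M N = hom_module R (res_module R M i) N"

definition coboundary :: "('a, 'r) ring_scheme \<Rightarrow> nat \<Rightarrow> ('a, 'b, 'm) module_scheme
    \<Rightarrow> ((nat \<Rightarrow> 'a) \<Rightarrow> 'c) \<Rightarrow> ((nat \<Rightarrow> 'a) \<Rightarrow> 'c)" where
  "coboundary R i M f = (\<lambda>v\<in>carrier (res_module R M (Suc i)). f (res_diff R M i v))"

definition cocycles :: "('a, 'r) ring_scheme \<Rightarrow> nat \<Rightarrow> ('a, 'b, 'm) module_scheme
    \<Rightarrow> ('a, 'c, 'n) module_scheme \<Rightarrow> ((nat \<Rightarrow> 'a) \<Rightarrow> 'c) set" where
  "cocycles R i M N =
     {f \<in> carrier (cochains R i M N). coboundary R i M f = \<zero>\<^bsub>cochains R (Suc i) M N\<^esub>}"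

fun coboundaries :: "('a, 'r) ring_scheme \<Rightarrow> nat \<Rightarrow> ('a, 'b, 'm) module_scheme
    \<Rightarrow> ('a, 'c, 'n) module_scheme \<Rightarrow> ((nat \<Rightarrow> 'a) \<Rightarrow> 'c) set" where
  "coboundaries R 0 M N = {\<zero>\<^bsub>cochains R 0 M N\<^esub>}"
| "coboundaries R (Suc i) M N = coboundary R i M ` carrier (cochains R i M N)"

definition Ext :: "('a, 'r) ring_scheme \<Rightarrow> nat \<Rightarrow> ('a, 'b, 'm) module_scheme
    \<Rightarrow> ('a, 'c, 'n) module_scheme \<Rightarrow> ('a, ((nat \<Rightarrow> 'a) \<Rightarrow> 'c) set) module" where
  "Ext R i M N =
     fact_module ((cochains R i M N)\<lparr>carrier := cocycles R i M N\<rparr>) (coboundaries R i M N)"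

text \<open>The map \<open>Ext R i M N \<rightarrow> Ext R i M N'\<close> induced by \<open>f : N \<rightarrow> N'\<close>.\<close>

definition Ext_map :: "('a, 'r) ring_scheme \<Rightarrow> nat \<Rightarrow> ('a, 'b, 'm) module_scheme
    \<Rightarrow> ('a, 'd, 'n) module_scheme \<Rightarrow> ('c \<Rightarrow> 'd)
    \<Rightarrow> ((nat \<Rightarrow> 'a) \<Rightarrow> 'c) set \<Rightarrow> ((nat \<Rightarrow> 'a) \<Rightarrow> 'd) set" where
  "Ext_map R i M N' f X =
     (\<Union>z\<in>X. coboundaries R i M N' +>\<^bsub>cochains R i M N'\<^esub>
       (\<lambda>v\<in>carrier (res_module R M i). f (z v)))"


section \<open>Cohen--Macaulay rings and canonical modules\<close>

locale noetherian_local_ring = noetherian_ring R + cring R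
  for R :: "('a, 'r) ring_scheme" (structure) and \<mm> :: "'a set" +
  assumes maximal: "maximalideal \<mm> R"
    and unique_maximal: "maximalideal \<nn> R \<Longrightarrow> \<nn> = \<mm>"

definition krull_dim :: "('a, 'r) ring_scheme \<Rightarrow> enat" where
  "krull_dim R = Sup {enat n |n. \<exists>P :: nat \<Rightarrow> 'a set.
     (\<forall>i\<le>n. primeideal (P i) R) \<and> (\<forall>i<n. P i \<subset> P (Suc i))}"

definition regular_sequence :: "('a, 'r) ring_scheme \<Rightarrow> ('a, 'b, 'm) module_scheme
    \<Rightarrow> 'a list \<Rightarrow> bool" where
  "regular_sequence R M xs \<longleftrightarrow> set xs \<subseteq> carrier R \<and>
     (\<forall>i<length xs. \<forall>u\<in>carrier M.
        xs ! i \<odot>\<^bsub>M\<^esub> u \<in> ideal_smult (Idl\<^bsub>R\<^esub> (set (take i xs))) M \<longrightarrow>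
        u \<in> ideal_smult (Idl\<^bsub>R\<^esub> (set (take i xs))) M) \<and>
     ideal_smult (Idl\<^bsub>R\<^esub> (set xs)) M \<noteq> carrier M"

definition depth :: "('a, 'r) ring_scheme \<Rightarrow> 'a set \<Rightarrow> ('a, 'b, 'm) module_scheme \<Rightarrow> enat" where
  "depth R \<mm> M = Sup {enat (length xs) |xs. set xs \<subseteq> \<mm> \<and> regular_sequence R M xs}"

definition cohen_macaulay_local_ring :: "('a, 'r) ring_scheme \<Rightarrow> 'a set \<Rightarrow> bool" where
  "cohen_macaulay_local_ring R \<mm> \<longleftrightarrow>
     noetherian_local_ring R \<mm> \<and> depth R \<mm> (self_module R) = krull_dim R"

definition maximal_cohen_macaulay :: "('a, 'r) ring_scheme \<Rightarrow> 'a set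
    \<Rightarrow> ('a, 'b, 'm) module_scheme \<Rightarrow> bool" where
  "maximal_cohen_macaulay R \<mm> M \<longleftrightarrow>
     fin_gen_module R M \<and> carrier M \<noteq> {\<zero>\<^bsub>M\<^esub>} \<and> depth R \<mm> M = krull_dim R"

text \<open>Injective dimension is expressed by vanishing of \<open>Ext\<close>. By Baer's criterion finitely
  generated first arguments suffice, and each of these is isomorphic to some \<open>R\<^bsup>n\<^esup>/K\<close>, whose
  elements have type \<open>(nat \<Rightarrow> 'a) set\<close>.\<close>

definition finite_injective_dim :: "('a, 'r) ring_scheme \<Rightarrow> ('a, 'b, 'm) module_scheme \<Rightarrow> bool" where
  "finite_injective_dim R C \<longleftrightarrow> (\<exists>n. \<forall>i>n. \<forall>L :: ('a, (nat \<Rightarrow> 'a) set) module.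
     fin_gen_module R L \<longrightarrow> carrier (Ext R i L C) = {\<zero>\<^bsub>Ext R i L C\<^esub>})"

text \<open>The type of \<open>C\<close> is the dimension of \<open>Ext R t k C\<close> over \<open>k = R/\<mm>\<close>, where \<open>t\<close> is
  the depth of \<open>C\<close>. Since \<open>\<mm>\<close> annihilates this module, its dimension is its length over \<open>R\<close>.\<close>

definition cm_type :: "('a, 'r) ring_scheme \<Rightarrow> 'a set \<Rightarrow> ('a, 'b, 'm) module_scheme \<Rightarrow> enat" where
  "cm_type R \<mm> C =
     module_length R (Ext R (the_enat (depth R \<mm> C)) (fact_module (self_module R) \<mm>) C)"

definition canonical_module :: "('a, 'r) ring_scheme \<Rightarrow> 'a set
    \<Rightarrow> ('a, 'b, 'm) module_scheme \<Rightarrow> bool" where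
  "canonical_module R \<mm> C \<longleftrightarrow>
     maximal_cohen_macaulay R \<mm> C \<and> finite_injective_dim R C \<and> cm_type R \<mm> C = 1"

definition primary_to :: "('a, 'r) ring_scheme \<Rightarrow> 'a set \<Rightarrow> 'a set \<Rightarrow> bool" where
  "primary_to R \<mm> I \<longleftrightarrow> ideal I R \<and> I \<noteq> carrier R \<and>
     (\<forall>a\<in>carrier R. \<forall>b\<in>carrier R. a \<otimes>\<^bsub>R\<^esub> b \<in> I \<longrightarrow> a \<in> I \<or> (\<exists>n::nat. b [^]\<^bsub>R\<^esub> n \<in> I)) \<and>
     {a \<in> carrier R. \<exists>n::nat. a [^]\<^bsub>R\<^esub> n \<in> I} = \<mm>"


section \<open>Superficial and filter regular elements\<close>

definition superficial :: "('a, 'r) ring_scheme \<Rightarrow> 'a set \<Rightarrow> ('a, 'b, 'm) module_scheme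
    \<Rightarrow> 'a \<Rightarrow> bool" where
  "superficial R I E x \<longleftrightarrow> x \<in> I \<and> (\<exists>c. \<forall>n\<ge>c.
     {u \<in> carrier E. x \<odot>\<^bsub>E\<^esub> u \<in> pow_smult R I (n + 1) E} \<inter> pow_smult R I c E = pow_smult R I n E)"

definition rees_algebra :: "('a, 'r) ring_scheme \<Rightarrow> 'a set \<Rightarrow> ('a, nat \<Rightarrow> 'a) up_ring" where
  "rees_algebra R I =
     (UP R)\<lparr>carrier := {p \<in> carrier (UP R). \<forall>n. coeff (UP R) p n \<in> ideal_pow R I n}\<rparr>"

record ('a, 'b) graded_module = "('a, 'b) module" +
  homogeneous :: "nat \<Rightarrow> 'b set"

definition graded_direct_sum :: "('a, 'b, 'm) graded_module_scheme
    \<Rightarrow> ('a, 'c, 'n) graded_module_scheme \<Rightarrow> ('a, 'b \<times> 'c) graded_module" where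
  "graded_direct_sum E F = module.extend (direct_sum E F)
     \<lparr>homogeneous = (\<lambda>n. homogeneous E n \<times> homogeneous F n)\<rparr>"

text \<open>For an element \<open>r\<close> of degree 1, such as \<open>xt\<close>.\<close>

definition filter_regular :: "('a, 'r) ring_scheme \<Rightarrow> ('a, 'b, 'm) graded_module_scheme
    \<Rightarrow> 'a \<Rightarrow> bool" where
  "filter_regular A E r \<longleftrightarrow> r \<in> carrier A \<and> (\<exists>c. \<forall>n\<ge>c. inj_on (\<lambda>u. r \<odot>\<^bsub>E\<^esub> u) (homogeneous E n))"

abbreviation pow_quot :: "('a, 'r) ring_scheme \<Rightarrow> 'a set \<Rightarrow> nat \<Rightarrow> ('a, 'b, 'm) module_scheme
    \<Rightarrow> ('a, 'b set) module" where
  "pow_quot R I n W \<equiv> fact_module W (pow_smult R I n W)"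

text \<open>For \<open>a \<in> I\<^bsup>n - k\<^esup>\<close> this is the map \<open>W/I\<^bsup>k\<^esup>W \<rightarrow> W/I\<^bsup>n\<^esup>W\<close> induced by multiplication
  by \<open>a\<close>.\<close>

definition mult_map :: "('a, 'r) ring_scheme \<Rightarrow> 'a set \<Rightarrow> ('a, 'b, 'm) module_scheme
    \<Rightarrow> nat \<Rightarrow> 'a \<Rightarrow> 'b set \<Rightarrow> 'b set" where
  "mult_map R I W n a X = (\<Union>u\<in>X. pow_smult R I n W +>\<^bsub>W\<^esub> (a \<odot>\<^bsub>W\<^esub> u))"

text \<open>The graded module \<open>D\<^bsup>i\<^esup>\<^sub>I(M)\<close> over the Rees algebra. An element of the direct sum is a
  finitely supported family; the summand \<open>a\<^sub>j t\<^bsup>j\<^esup>\<close> of a scalar \<open>p\<close> sends degree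
  \<open>n - j\<close> to degree \<open>n\<close>. The argument \<open>W\<close> stands for the canonical module.\<close>

definition D_module :: "('a, 'r) ring_scheme \<Rightarrow> ('a, 'c, 'n) module_scheme \<Rightarrow> 'a set \<Rightarrow> nat
    \<Rightarrow> ('a, 'b, 'm) module_scheme
    \<Rightarrow> (nat \<Rightarrow> 'a, nat \<Rightarrow> ((nat \<Rightarrow> 'a) \<Rightarrow> 'c set) set) graded_module" where
  "D_module R W I i M = (
     let E = (\<lambda>n. Ext R i M (pow_quot R I n W));
         S = {f. (\<forall>n. f n \<in> carrier (E n)) \<and> finite {n. f n \<noteq> \<zero>\<^bsub>E n\<^esub>}}
     in \<lparr>carrier = S, mult = undefined, one = undefined,
          zero = (\<lambda>n. \<zero>\<^bsub>E n\<^esub>),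
          add = (\<lambda>f g n. f n \<oplus>\<^bsub>E n\<^esub> g n),
          smult = (\<lambda>p f n. \<Oplus>\<^bsub>E n\<^esub>j\<in>{..n}.
            Ext_map R i M (pow_quot R I n W) (mult_map R I W n (coeff (rees_algebra R I) p j)) (f (n - j))),
          homogeneous = (\<lambda>n. {f \<in> S. \<forall>k. k \<noteq> n \<longrightarrow> f k = \<zero>\<^bsub>E k\<^esub>})\<rparr>)"


section \<open>The polynomials of Hilbert--Samuel type\<close>

definition is_eps_poly :: "('a, 'r) ring_scheme \<Rightarrow> ('a, 'c, 'n) module_scheme \<Rightarrow> 'a set \<Rightarrow> nat
    \<Rightarrow> ('a, 'b, 'm) module_scheme \<Rightarrow> rat poly \<Rightarrow> bool" where
  "is_eps_poly R W I i M p \<longleftrightarrow> (\<forall>\<^sub>F n in sequentially. \<exists>l.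
     module_length R (Ext R i M (pow_quot R I (n + 1) W)) = enat l \<and> poly p (of_nat n) = of_nat l)"

text \<open>The value 0 is a convention for the case that there is no such polynomial.\<close>

definition eps_poly :: "('a, 'r) ring_scheme \<Rightarrow> ('a, 'c, 'n) module_scheme \<Rightarrow> 'a set \<Rightarrow> nat
    \<Rightarrow> ('a, 'b, 'm) module_scheme \<Rightarrow> rat poly" where
  "eps_poly R W I i M =
     (if \<exists>p. is_eps_poly R W I i M p then THE p. is_eps_poly R W I i M p else 0)"

lemma eps_poly_eqI:
  assumes "is_eps_poly R W I i M p"
  shows "eps_poly R W I i M = p"
proof -
  have "q = p" if q: "is_eps_poly R W I i M q" for q
  proof -
    have "\<forall>\<^sub>F n in sequentially. poly (q - p) (of_nat n) = 0"
      using assms q unfolding is_eps_poly_def by eventually_elim (metis diff_self of_nat_eq_iff enat.inject poly_diff)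
    then obtain k where k: "\<And>n. n \<ge> k \<Longrightarrow> poly (q - p) (of_nat n) = 0"
      unfolding eventually_sequentially by blast
    have "of_nat ` {k..} \<subseteq> {t :: rat. poly (q - p) t = 0}"
      using k by blast
    moreover have "infinite ((of_nat :: nat \<Rightarrow> rat) ` {k..})"
      by (simp add: finite_image_iff inj_on_def infinite_Ici)
    ultimately have "\<not> finite {t :: rat. poly (q - p) t = 0}"
      by (meson finite_subset)
    then show ?thesis
      using poly_roots_finite[of "q - p"] by (metis eq_iff_diff_eq_0)
  qed
  then have "(THE p. is_eps_poly R W I i M p) = p"
    using assms by (intro the_equality)
  with assms show ?thesis unfolding eps_poly_def by metis
qed

end

theory Submission
  imports Defs
begin

text \<open>For \<open>n \<gg> 0\<close> multiplication by \<open>x\<close> embeds \<open>\<omega>/I\<^sup>n\<omega>\<close> into \<open>\<omega>/I\<^sup>n\<^sup>+\<^sup>1\<omega>\<close> with cokernel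
  \<open>\<omega>\<^sub>S/J\<^sup>n\<^sup>+\<^sup>1\<omega>\<^sub>S\<close>. Filter regularity makes the connecting maps of the long exact sequence of
  \<open>Ext\<^sub>R(M, -)\<close> vanish in degrees 0 and 1, and \<open>Ext\<^sub>R(M, -)\<close> agrees with \<open>Ext\<^sub>S(N, -)\<close> on
  \<open>S\<close>-modules because \<open>x\<close> is \<open>M\<close>-regular; so the lengths over \<open>R\<close> at \<open>n\<close> and \<open>n - 1\<close> differ by the
  length over \<open>S\<close> at \<open>n\<close>. Regularity of \<open>x\<close> on \<open>R\<close> and \<open>\<omega>\<close> follows from superficiality, positive
  depth and Krull's intersection theorem. It passes to \<open>M\<close>, since the associated primes of a maximal
  Cohen-Macaulay module are minimal primes of \<open>R\<close> and these consist of zero divisors. The existence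
  of the polynomials plays no role: by the recurrence for the lengths, a polynomial for one side
  yields one for the other, and if there is none then both sides are 0 by convention.\<close>

section \<open>Modules and homomorphisms\<close>

text \<open>Additivity of lengths in degree i needs the maps induced by x on Ext^i and on Ext^(i+1)
  to be injective. In degree 0 this is left exactness of Hom, and the summands D^1 and D^2 supply
  degrees 1 and 2; this is why the result stops at i = 1. The obstacle is that Ext is computed from
  a resolution fixed for M over R and from another, unrelated one fixed for M/xM over S. Reducing
  the first modulo x gives a resolution of M/xM, but not the chosen one, so the two have to be
  linked by comparison maps in degrees 0 and 1. Moreover the two lengths are taken over different
  rings. Hence each length of Ext is rewritten as the length of an interval of submodules, from the
  coboundaries to the cocycles inside a cochain module, and such intervals are compared along maps
  that match the scalars of one ring with scalars of the other.\<close>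

lemma (in module) submodule_zero: "submodule H R M \<Longrightarrow> \<zero>\<^bsub>M\<^esub> \<in> H"
  by (metis submodule.axioms(1) subgroup.one_closed monoid.simps(2))

lemma (in module) submodule_subset: "submodule H R M \<Longrightarrow> u \<in> H \<Longrightarrow> u \<in> carrier M"
  using submoduleE(1) by blast

lemma (in module) submodule_diff:
  "submodule H R M \<Longrightarrow> u \<in> H \<Longrightarrow> v \<in> H \<Longrightarrow> u \<ominus>\<^bsub>M\<^esub> v \<in> H"
  by (simp add: a_minus_def submoduleE)

lemma (in module) diff_add_cancel:
  "u \<in> carrier M \<Longrightarrow> v \<in> carrier M \<Longrightarrow> v \<oplus>\<^bsub>M\<^esub> (u \<ominus>\<^bsub>M\<^esub> v) = u"
  by (simp add: a_minus_def M.a_lcomm M.r_neg)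

lemma (in module) add_diff_cancel:
  "u \<in> carrier M \<Longrightarrow> v \<in> carrier M \<Longrightarrow> (v \<oplus>\<^bsub>M\<^esub> u) \<ominus>\<^bsub>M\<^esub> v = u"
  by (metis M.add.inv_closed M.add.m_assoc M.add.m_comm M.l_neg M.minus_eq M.r_zero)

lemma (in module) diff_eq_zero_iff:
  "u \<in> carrier M \<Longrightarrow> v \<in> carrier M \<Longrightarrow> u \<ominus>\<^bsub>M\<^esub> v = \<zero>\<^bsub>M\<^esub> \<longleftrightarrow> u = v"
  by (metis M.add.inv_closed M.minus_eq M.r_neg diff_add_cancel M.r_zero)

lemma (in module) smult_diff_r:
  "a \<in> carrier R \<Longrightarrow> u \<in> carrier M \<Longrightarrow> v \<in> carrier M \<Longrightarrow>
    a \<odot>\<^bsub>M\<^esub> (u \<ominus>\<^bsub>M\<^esub> v) = a \<odot>\<^bsub>M\<^esub> u \<ominus>\<^bsub>M\<^esub> a \<odot>\<^bsub>M\<^esub> v"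
  by (simp add: a_minus_def smult_r_distr smult_r_minus)

lemma (in module) smult_diff_l:
  "a \<in> carrier R \<Longrightarrow> b \<in> carrier R \<Longrightarrow> u \<in> carrier M \<Longrightarrow>
    (a \<ominus> b) \<odot>\<^bsub>M\<^esub> u = a \<odot>\<^bsub>M\<^esub> u \<ominus>\<^bsub>M\<^esub> b \<odot>\<^bsub>M\<^esub> u"
  by (simp add: a_minus_def smult_l_distr smult_l_minus)

lemma (in module) submoduleI':
  assumes "H \<subseteq> carrier M" "\<zero>\<^bsub>M\<^esub> \<in> H"
    and "\<And>a b. a \<in> H \<Longrightarrow> b \<in> H \<Longrightarrow> a \<oplus>\<^bsub>M\<^esub> b \<in> H"
    and sm: "\<And>a u. a \<in> carrier R \<Longrightarrow> u \<in> H \<Longrightarrow> a \<odot>\<^bsub>M\<^esub> u \<in> H"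
  shows "submodule H R M"
proof (rule submoduleI)
  fix u assume "u \<in> H"
  then show "\<ominus>\<^bsub>M\<^esub> u \<in> H"
    using sm[of "\<ominus> \<one>" u] assms(1) by (auto simp: smult_l_minus)
qed (use assms in auto)

lemma (in module) submodule_zero_set: "submodule {\<zero>\<^bsub>M\<^esub>} R M"
  by (rule submoduleI') auto

lemma (in module) submodule_Int:
  assumes "submodule H R M" "submodule K R M"
  shows "submodule (H \<inter> K) R M"
  using assms by (intro submoduleI') (auto dest: submodule_subset submodule_zero submoduleE)

lemma (in module) submodule_Inter:
  assumes "\<F> \<noteq> {}" "\<And>H. H \<in> \<F> \<Longrightarrow> submodule H R M"
  shows "submodule (\<Inter>\<F>) R M"
  using assms by (intro submoduleI') (auto dest: submodule_subset submodule_zero submoduleE)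

lemma mem_set_add: "w \<in> H <+>\<^bsub>M\<^esub> K \<longleftrightarrow> (\<exists>u\<in>H. \<exists>v\<in>K. w = u \<oplus>\<^bsub>M\<^esub> v)"
  unfolding set_add_def' by auto

lemma (in module) submodule_sum:
  assumes H: "submodule H R M" and K: "submodule K R M"
  shows "submodule (H <+>\<^bsub>M\<^esub> K) R M"
proof (rule submoduleI')
  show "H <+>\<^bsub>M\<^esub> K \<subseteq> carrier M"
    using submodule_subset[OF H] submodule_subset[OF K] by (auto simp: mem_set_add)
  show "\<zero>\<^bsub>M\<^esub> \<in> H <+>\<^bsub>M\<^esub> K" unfolding mem_set_add
    using submodule_zero[OF H] submodule_zero[OF K] by (metis M.l_zero M.zero_closed)
  fix a b assume "a \<in> H <+>\<^bsub>M\<^esub> K" "b \<in> H <+>\<^bsub>M\<^esub> K"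
  then obtain u v u' v' where *: "u \<in> H" "v \<in> K" "u' \<in> H" "v' \<in> K" "a = u \<oplus>\<^bsub>M\<^esub> v" "b = u' \<oplus>\<^bsub>M\<^esub> v'"
    by (auto simp: mem_set_add)
  then have "a \<oplus>\<^bsub>M\<^esub> b = (u \<oplus>\<^bsub>M\<^esub> u') \<oplus>\<^bsub>M\<^esub> (v \<oplus>\<^bsub>M\<^esub> v')"
    by (metis H K M.add.m_assoc M.add.m_closed M.add.m_lcomm submodule_subset)
  then show "a \<oplus>\<^bsub>M\<^esub> b \<in> H <+>\<^bsub>M\<^esub> K"
    using * submoduleE(5)[OF H] submoduleE(5)[OF K] unfolding mem_set_add by metis
next
  fix a w assume a: "a \<in> carrier R" and "w \<in> H <+>\<^bsub>M\<^esub> K"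
  then obtain u v where *: "u \<in> H" "v \<in> K" "w = u \<oplus>\<^bsub>M\<^esub> v" by (auto simp: mem_set_add)
  then have "a \<odot>\<^bsub>M\<^esub> w = a \<odot>\<^bsub>M\<^esub> u \<oplus>\<^bsub>M\<^esub> a \<odot>\<^bsub>M\<^esub> v"
    by (metis H K a smult_r_distr submodule_subset)
  then show "a \<odot>\<^bsub>M\<^esub> w \<in> H <+>\<^bsub>M\<^esub> K"
    using * a submoduleE(4)[OF H] submoduleE(4)[OF K] unfolding mem_set_add by metis
qed

lemma (in module) set_add_mono1:
  assumes "submodule H R M" "submodule K R M" shows "H \<subseteq> H <+>\<^bsub>M\<^esub> K"
  using assms submodule_zero[of K] submodule_subset[of H]
  by (auto simp: mem_set_add) (metis M.r_zero)

lemma (in module) set_add_mono2: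
  assumes "submodule H R M" "submodule K R M" shows "K \<subseteq> H <+>\<^bsub>M\<^esub> K"
  using assms submodule_zero[of H] submodule_subset[of K]
  by (auto simp: mem_set_add) (metis M.l_zero)

lemma (in module) set_add_least:
  assumes "submodule L R M" "H \<subseteq> L" "K \<subseteq> L" shows "H <+>\<^bsub>M\<^esub> K \<subseteq> L"
  using assms(2,3) submoduleE(5)[OF assms(1)] by (force simp: mem_set_add)

text \<open>\<open>module_homs\<close> consists of extensional functions. Dropping extensionality
  lets composites and pointwise sums be plain lambda terms; \<open>mhom_restrict\<close> leads back
  to \<open>module_homs\<close> when a cochain is wanted.\<close>

definition mhom :: "('a, 'r) ring_scheme \<Rightarrow> ('a, 'b, 'm) module_scheme
    \<Rightarrow> ('a, 'c, 'n) module_scheme \<Rightarrow> ('b \<Rightarrow> 'c) \<Rightarrow> bool" where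
  "mhom R M N f \<longleftrightarrow> (\<forall>u\<in>carrier M. f u \<in> carrier N) \<and>
     (\<forall>u\<in>carrier M. \<forall>v\<in>carrier M. f (u \<oplus>\<^bsub>M\<^esub> v) = f u \<oplus>\<^bsub>N\<^esub> f v) \<and>
     (\<forall>a\<in>carrier R. \<forall>u\<in>carrier M. f (a \<odot>\<^bsub>M\<^esub> u) = a \<odot>\<^bsub>N\<^esub> f u)"

lemma mhomI:
  assumes "\<And>u. u \<in> carrier M \<Longrightarrow> f u \<in> carrier N"
    and "\<And>u v. u \<in> carrier M \<Longrightarrow> v \<in> carrier M \<Longrightarrow> f (u \<oplus>\<^bsub>M\<^esub> v) = f u \<oplus>\<^bsub>N\<^esub> f v"
    and "\<And>a u. a \<in> carrier R \<Longrightarrow> u \<in> carrier M \<Longrightarrow> f (a \<odot>\<^bsub>M\<^esub> u) = a \<odot>\<^bsub>N\<^esub> f u"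
  shows "mhom R M N f"
  using assms unfolding mhom_def by blast

lemma mhom_closed: "mhom R M N f \<Longrightarrow> u \<in> carrier M \<Longrightarrow> f u \<in> carrier N"
  and mhom_add: "mhom R M N f \<Longrightarrow> u \<in> carrier M \<Longrightarrow> v \<in> carrier M \<Longrightarrow> f (u \<oplus>\<^bsub>M\<^esub> v) = f u \<oplus>\<^bsub>N\<^esub> f v"
  and mhom_smult: "mhom R M N f \<Longrightarrow> a \<in> carrier R \<Longrightarrow> u \<in> carrier M \<Longrightarrow> f (a \<odot>\<^bsub>M\<^esub> u) = a \<odot>\<^bsub>N\<^esub> f u"
  unfolding mhom_def by auto

lemma mhom_zero:
  assumes "module R M" "module R N" "mhom R M N f" shows "f \<zero>\<^bsub>M\<^esub> = \<zero>\<^bsub>N\<^esub>"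
proof -
  interpret M: module R M by fact
  interpret N: module R N by fact
  have "f (\<zero>\<^bsub>R\<^esub> \<odot>\<^bsub>M\<^esub> \<zero>\<^bsub>M\<^esub>) = \<zero>\<^bsub>R\<^esub> \<odot>\<^bsub>N\<^esub> f \<zero>\<^bsub>M\<^esub>" by (rule mhom_smult[OF assms(3)]) auto
  then show ?thesis using mhom_closed[OF assms(3), of "\<zero>\<^bsub>M\<^esub>"] by simp
qed

lemma mhom_minus:
  assumes "module R M" "module R N" "mhom R M N f" "u \<in> carrier M" shows "f (\<ominus>\<^bsub>M\<^esub> u) = \<ominus>\<^bsub>N\<^esub> f u"
proof -
  interpret M: module R M by fact
  interpret N: module R N by fact
  have "f ((\<ominus>\<^bsub>R\<^esub> \<one>\<^bsub>R\<^esub>) \<odot>\<^bsub>M\<^esub> u) = (\<ominus>\<^bsub>R\<^esub> \<one>\<^bsub>R\<^esub>) \<odot>\<^bsub>N\<^esub> f u"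
    by (rule mhom_smult[OF assms(3)]) (use assms in auto)
  then show ?thesis using mhom_closed[OF assms(3,4)] assms(4)
    by (simp add: M.smult_l_minus N.smult_l_minus)
qed

lemma mhom_diff:
  assumes "module R M" "module R N" "mhom R M N f" "u \<in> carrier M" "v \<in> carrier M"
  shows "f (u \<ominus>\<^bsub>M\<^esub> v) = f u \<ominus>\<^bsub>N\<^esub> f v"
proof -
  interpret M: module R M by fact
  show ?thesis using assms by (simp add: a_minus_def mhom_add mhom_minus)
qed

lemma mhom_compose:
  assumes "mhom R M N f" "mhom R N P g" shows "mhom R M P (\<lambda>u. g (f u))"
  using assms unfolding mhom_def by simp

lemma mhom_cong:
  assumes "module R M" "\<And>u. u \<in> carrier M \<Longrightarrow> f u = g u" "mhom R M N f" shows "mhom R M N g"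
proof -
  interpret module R M by fact
  show ?thesis using assms unfolding mhom_def by auto
qed

lemma mhom_restrict:
  assumes "module R M" shows "mhom R M N (restrict f (carrier M)) \<longleftrightarrow> mhom R M N f"
  using mhom_cong[OF assms, of f "restrict f (carrier M)" N] mhom_cong[OF assms, of "restrict f (carrier M)" f N] by auto

lemma mhom_add_fun:
  assumes "module R N" "mhom R M N f" "mhom R M N g"
  shows "mhom R M N (\<lambda>u. f u \<oplus>\<^bsub>N\<^esub> g u)"
proof -
  interpret N: module R N by fact
  show ?thesis using assms
    by (intro mhomI) (auto simp: mhom_closed mhom_add mhom_smult N.smult_r_distr
        N.M.a_assoc N.M.a_lcomm)
qed

lemma mhom_smult_fun:
  assumes "module R N" "mhom R M N f" "a \<in> carrier R"
  shows "mhom R M N (\<lambda>u. a \<odot>\<^bsub>N\<^esub> f u)"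
proof -
  interpret N: module R N by fact
  show ?thesis using assms(2,3)
    by (intro mhomI) (auto simp: mhom_closed mhom_add mhom_smult N.smult_r_distr
        N.smult_assoc1[symmetric] N.R.m_comm)
qed

lemma mhom_diff_fun:
  assumes "module R N" "mhom R M N f" "mhom R M N g"
  shows "mhom R M N (\<lambda>u. f u \<ominus>\<^bsub>N\<^esub> g u)"
proof -
  interpret N: module R N by fact
  have "mhom R M N (\<lambda>u. \<ominus>\<^bsub>N\<^esub> g u)" using assms(3)
    by (intro mhomI) (auto simp: mhom_closed mhom_add mhom_smult N.smult_r_minus N.M.minus_add)
  then show ?thesis using mhom_add_fun[OF assms(1,2)] by (simp add: a_minus_def)
qed

lemma mhom_const_zero:
  assumes "module R N" shows "mhom R M N (\<lambda>u. \<zero>\<^bsub>N\<^esub>)"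
proof -
  interpret N: module R N by fact
  show ?thesis by (intro mhomI) auto
qed

lemma mhom_ident: "mhom R M M (\<lambda>u. u)"
  by (intro mhomI) auto

lemma module_homs_iff:
  "f \<in> module_homs R M N \<longleftrightarrow> mhom R M N f \<and> f \<in> extensional (carrier M)"
  unfolding module_homs_def mhom_def PiE_def Pi_def by auto

text \<open>Linearity across two rings with no ring map fixed: scalars of either ring act through
  some scalar of the other. Submodules then pass along \<open>f\<close> in both directions, and the
  notion serves \<open>proj\<close>, from \<open>R\<close> to the quotient ring, as well as
  \<open>pull\<close>, from the quotient ring back to \<open>R\<close>.\<close>

definition semilin :: "('a, 'r) ring_scheme \<Rightarrow> ('s, 't) ring_scheme \<Rightarrow> ('a, 'b, 'm) module_scheme
    \<Rightarrow> ('s, 'c, 'n) module_scheme \<Rightarrow> ('b \<Rightarrow> 'c) \<Rightarrow> bool" where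
  "semilin R S P Q f \<longleftrightarrow> (\<forall>u\<in>carrier P. f u \<in> carrier Q) \<and>
     (\<forall>u\<in>carrier P. \<forall>v\<in>carrier P. f (u \<oplus>\<^bsub>P\<^esub> v) = f u \<oplus>\<^bsub>Q\<^esub> f v) \<and>
     (\<forall>a\<in>carrier R. \<exists>s\<in>carrier S. \<forall>u\<in>carrier P. f (a \<odot>\<^bsub>P\<^esub> u) = s \<odot>\<^bsub>Q\<^esub> f u) \<and>
     (\<forall>s\<in>carrier S. \<exists>a\<in>carrier R. \<forall>u\<in>carrier P. f (a \<odot>\<^bsub>P\<^esub> u) = s \<odot>\<^bsub>Q\<^esub> f u)"

lemma mhom_semilin: "mhom R P Q f \<Longrightarrow> semilin R R P Q f"
  unfolding mhom_def semilin_def by auto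

lemma semilin_zero:
  assumes "module R P" "module S Q" "semilin R S P Q f" shows "f \<zero>\<^bsub>P\<^esub> = \<zero>\<^bsub>Q\<^esub>"
proof -
  interpret P: module R P by fact
  interpret Q: module S Q by fact
  have "f (\<zero>\<^bsub>P\<^esub> \<oplus>\<^bsub>P\<^esub> \<zero>\<^bsub>P\<^esub>) = f \<zero>\<^bsub>P\<^esub> \<oplus>\<^bsub>Q\<^esub> f \<zero>\<^bsub>P\<^esub>" "f \<zero>\<^bsub>P\<^esub> \<in> carrier Q"
    using assms(3) unfolding semilin_def by blast+
  then show ?thesis by (metis P.M.zero_closed P.M.l_zero Q.M.add.r_cancel_one')
qed

lemma semilin_image:
  assumes "module R P" "module S Q" "semilin R S P Q f" "submodule H R P"
  shows "submodule (f ` H) S Q"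
proof -
  interpret P: module R P by fact
  interpret Q: module S Q by fact
  note s = P.submodule_subset[OF assms(4)] P.submoduleE(4,5)[OF assms(4)] P.submodule_zero[OF assms(4)]
  note f = assms(3)[unfolded semilin_def]
  show ?thesis
  proof (rule Q.submoduleI')
    show "f ` H \<subseteq> carrier Q" using s f by auto
    show "\<zero>\<^bsub>Q\<^esub> \<in> f ` H" using s semilin_zero[OF assms(1-3)] by (metis imageI)
  next
    fix a b assume "a \<in> f ` H" "b \<in> f ` H"
    then obtain u v where uv: "u \<in> H" "v \<in> H" "a = f u" "b = f v" by auto
    then have "f (u \<oplus>\<^bsub>P\<^esub> v) = a \<oplus>\<^bsub>Q\<^esub> b" using f s by auto
    then show "a \<oplus>\<^bsub>Q\<^esub> b \<in> f ` H" using s uv by (metis imageI)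
  next
    fix a u assume a: "a \<in> carrier S" and "u \<in> f ` H"
    then obtain v where v: "v \<in> H" "u = f v" by auto
    obtain b where "b \<in> carrier R" "\<forall>u\<in>carrier P. f (b \<odot>\<^bsub>P\<^esub> u) = a \<odot>\<^bsub>Q\<^esub> f u" using f a by blast
    then show "a \<odot>\<^bsub>Q\<^esub> u \<in> f ` H" using s v by (metis imageI)
  qed
qed

lemma semilin_vimage:
  assumes "module R P" "module S Q" "semilin R S P Q f" "submodule H S Q"
  shows "submodule {u \<in> carrier P. f u \<in> H} R P"
proof -
  interpret P: module R P by fact
  interpret Q: module S Q by fact
  note s = Q.submodule_subset[OF assms(4)] Q.submoduleE(4,5)[OF assms(4)] Q.submodule_zero[OF assms(4)]
  note f = assms(3)[unfolded semilin_def]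
  show ?thesis
  proof (rule P.submoduleI')
    fix a u assume a: "a \<in> carrier R" and u: "u \<in> {u \<in> carrier P. f u \<in> H}"
    obtain b where "b \<in> carrier S" "\<forall>u\<in>carrier P. f (a \<odot>\<^bsub>P\<^esub> u) = b \<odot>\<^bsub>Q\<^esub> f u" using f a by blast
    then show "a \<odot>\<^bsub>P\<^esub> u \<in> {u \<in> carrier P. f u \<in> H}" using s u a by auto
  qed (use s f semilin_zero[OF assms(1-3)] in auto)
qed

lemma submodule_image:
  assumes "module R M" "module R N" "mhom R M N f" "submodule H R M"
  shows "submodule (f ` H) R N"
  by (rule semilin_image[OF assms(1,2) mhom_semilin[OF assms(3)] assms(4)])

lemma submodule_vimage:
  assumes "module R M" "module R N" "mhom R M N f" "submodule H R N"
  shows "submodule {u \<in> carrier M. f u \<in> H} R M"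
  by (rule semilin_vimage[OF assms(1,2) mhom_semilin[OF assms(3)] assms(4)])

section \<open>Lengths of intervals of submodules\<close>

definition set_chain :: "'a set set \<Rightarrow> (nat \<Rightarrow> 'a set) \<Rightarrow> nat \<Rightarrow> bool" where
  "set_chain \<F> H n \<longleftrightarrow> (\<forall>i\<le>n. H i \<in> \<F>) \<and> (\<forall>i<n. H i \<subset> H (Suc i))"

definition chain_len :: "'a set set \<Rightarrow> enat" where
  "chain_len \<F> = Sup {enat n |n. \<exists>H. set_chain \<F> H n}"

lemma chain_len_ge: "set_chain \<F> H n \<Longrightarrow> enat n \<le> chain_len \<F>"
  unfolding chain_len_def by (rule Sup_upper) blast

lemma chain_len_le:
  "(\<And>H n. set_chain \<F> H n \<Longrightarrow> enat n \<le> l) \<Longrightarrow> chain_len \<F> \<le> l"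
  unfolding chain_len_def by (rule Sup_least) blast

lemma chain_len_mono:
  assumes "\<And>H. H \<in> \<F> \<Longrightarrow> g H \<in> \<G>"
    and "\<And>H K. H \<in> \<F> \<Longrightarrow> K \<in> \<F> \<Longrightarrow> H \<subset> K \<Longrightarrow> g H \<subset> g K"
  shows "chain_len \<F> \<le> chain_len \<G>"
proof (rule chain_len_le)
  fix H n assume "set_chain \<F> H n"
  then have "set_chain \<G> (\<lambda>i. g (H i)) n"
    unfolding set_chain_def by (simp add: assms)
  then show "enat n \<le> chain_len \<G>" by (rule chain_len_ge)
qed

text \<open>A set of extended naturals with finite supremum is bounded by a natural number, hence
  finite, and its supremum is its maximum. This yields longest chains here and longest regular
  sequences in \<open>depth_attained\<close>.\<close>

lemma Sup_enat_attained:
  fixes A :: "enat set"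
  assumes "A \<noteq> {}" "Sup A = enat k" shows "enat k \<in> A"
proof -
  have "finite A"
  proof (rule finite_subset)
    show "A \<subseteq> enat ` {..k}"
    proof
      fix a assume "a \<in> A"
      then have "a \<le> enat k" using Sup_upper[of a A] assms by simp
      then show "a \<in> enat ` {..k}" using enat_ile[of a k] by auto
    qed
  qed simp
  then show ?thesis using assms Max_in[of A] by (simp add: Sup_enat_def)
qed

lemma chain_len_attained:
  assumes "\<F> \<noteq> {}" "chain_len \<F> = enat k"
  obtains H where "set_chain \<F> H k"
proof -
  obtain X where X: "X \<in> \<F>" using assms by blast
  have "{enat n |n. \<exists>H. set_chain \<F> H n} \<noteq> {}"
    using X by (auto simp: set_chain_def intro!: exI[of _ 0] exI[of _ "\<lambda>_. X"])
  from Sup_enat_attained[OF this assms(2)[unfolded chain_len_def]] that show ?thesis by auto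
qed

text \<open>Intersecting a strict chain with a submodule, or adding a submodule to it, can make
  steps collapse; the steps that stay strict still form a chain.\<close>

lemma weak_chain_len:
  assumes "\<And>i. i \<le> n \<Longrightarrow> H i \<in> \<F>" "\<And>i. i < n \<Longrightarrow> H i \<subseteq> H (Suc i)"
  shows "enat (card {i. i < n \<and> H i \<noteq> H (Suc i)}) \<le> chain_len \<F>"
proof -
  \<comment> \<open>The extra clause that the thinned chain ends at \<open>H n\<close> is what
    allows the next strict step to be appended.\<close>
  have "\<exists>G. set_chain \<F> G (card {i. i < n \<and> H i \<noteq> H (Suc i)}) \<and>
      G (card {i. i < n \<and> H i \<noteq> H (Suc i)}) = H n"
    using assms
  proof (induction n)
    case 0
    then show ?case by (intro exI[of _ "\<lambda>_. H 0"]) (simp add: set_chain_def)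
  next
    case (Suc n)
    let ?s = "card {i. i < n \<and> H i \<noteq> H (Suc i)}"
    obtain G where G: "set_chain \<F> G ?s" "G ?s = H n"
      using Suc.IH Suc.prems by (meson le_SucI less_SucI)
    show ?case
    proof (cases "H n = H (Suc n)")
      case True
      then have "{i. i < Suc n \<and> H i \<noteq> H (Suc i)} = {i. i < n \<and> H i \<noteq> H (Suc i)}"
        by (auto simp: less_Suc_eq)
      then show ?thesis using G True by auto
    next
      case False
      then have "{i. i < Suc n \<and> H i \<noteq> H (Suc i)} = insert n {i. i < n \<and> H i \<noteq> H (Suc i)}"
        by (auto simp: less_Suc_eq)
      then have c: "card {i. i < Suc n \<and> H i \<noteq> H (Suc i)} = Suc ?s" by simp
      show ?thesis unfolding c
        using G False Suc.prems(1)[of "Suc n"] Suc.prems(2)[of n]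
        by (intro exI[of _ "\<lambda>i. if i \<le> ?s then G i else H (Suc n)"])
           (auto simp: set_chain_def not_less_eq_eq not_less less_Suc_eq)
    qed
  qed
  then show ?thesis using chain_len_ge by metis
qed

text \<open>The length of Z/B, read off from the submodules between \<open>B\<close> and
  \<open>Z\<close>. No quotient is formed, so several subquotients of one cochain module can be
  compared inside it.\<close>

definition mlen :: "('a, 'r) ring_scheme \<Rightarrow> ('a, 'b, 'm) module_scheme \<Rightarrow> 'b set \<Rightarrow> 'b set \<Rightarrow> enat" where
  "mlen R P B Z = chain_len {H. submodule H R P \<and> B \<subseteq> H \<and> H \<subseteq> Z}"

lemma module_length_eq_chain_len: "module_length R M = chain_len {H. submodule H R M}"
  unfolding module_length_def chain_len_def set_chain_def by simp

lemma (in module) module_length_eq_mlen: "module_length R M = mlen R M {\<zero>\<^bsub>M\<^esub>} (carrier M)"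
proof -
  have "{H. submodule H R M} = {H. submodule H R M \<and> {\<zero>\<^bsub>M\<^esub>} \<subseteq> H \<and> H \<subseteq> carrier M}"
    using submodule_zero submodule_subset by blast
  then show ?thesis unfolding mlen_def module_length_eq_chain_len by simp
qed

lemma (in module) mlen_refl: "mlen R M Z Z = 0"
proof -
  have "mlen R M Z Z \<le> enat 0" unfolding mlen_def
  proof (rule chain_len_le)
    fix H n assume c: "set_chain {H. submodule H R M \<and> Z \<subseteq> H \<and> H \<subseteq> Z} H n"
    have "n = 0"
    proof (rule ccontr)
      assume "n \<noteq> 0"
      then have "H 0 \<subset> H 1" "H 0 \<supseteq> Z" "H 1 \<subseteq> Z" using c unfolding set_chain_def by auto
      then show False by auto
    qed
    then show "enat n \<le> enat 0" by simp
  qed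
  then show ?thesis by (simp add: zero_enat_def[symmetric])
qed

text \<open>For one inequality a chain is split into its traces on \<open>W\<close> and its sums
  with \<open>W\<close>; by the modular law every strict step survives in at least one of them. For
  the other, longest chains below and above \<open>W\<close> are joined.\<close>

lemma (in module) mlen_additive:
  assumes B: "submodule B R M" and W: "submodule W R M" and Z: "submodule Z R M" and "B \<subseteq> W" "W \<subseteq> Z"
  shows "mlen R M B Z = mlen R M B W + mlen R M W Z"
proof (rule antisym)
  show "mlen R M B Z \<le> mlen R M B W + mlen R M W Z"
    unfolding mlen_def[of _ _ B Z]
  proof (rule chain_len_le)
    fix H n assume c: "set_chain {H. submodule H R M \<and> B \<subseteq> H \<and> H \<subseteq> Z} H n"
    define H1 where "H1 i = H i \<inter> W" for i
    define H2 where "H2 i = H i <+>\<^bsub>M\<^esub> W" for i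
    have sub: "submodule (H i) R M" "B \<subseteq> H i" "H i \<subseteq> Z" if "i \<le> n" for i
      using c that by (auto simp: set_chain_def)
    have step: "H i \<subset> H (Suc i)" if "i < n" for i using c that by (auto simp: set_chain_def)
    have 1: "enat (card {i. i < n \<and> H1 i \<noteq> H1 (Suc i)}) \<le> mlen R M B W"
      unfolding mlen_def
    proof (intro weak_chain_len)
      show "H1 i \<subseteq> H1 (Suc i)" if "i < n" for i using step[OF that] unfolding H1_def by auto
    qed (use sub assms in \<open>auto simp: H1_def submodule_Int\<close>)
    have "H2 i \<subseteq> Z" if "i \<le> n" for i unfolding H2_def
      using set_add_least[OF Z] sub[OF that] assms by auto
    moreover have "H2 i \<subseteq> H2 (Suc i)" if "i < n" for i
      using step[OF that] unfolding H2_def set_add_def' by blast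
    ultimately have 2: "enat (card {i. i < n \<and> H2 i \<noteq> H2 (Suc i)}) \<le> mlen R M W Z"
      unfolding mlen_def using sub set_add_mono2[OF _ W]
      by (intro weak_chain_len) (auto simp: H2_def submodule_sum W)
    have "i \<in> {i. i < n \<and> H1 i \<noteq> H1 (Suc i)} \<union> {i. i < n \<and> H2 i \<noteq> H2 (Suc i)}" if i: "i < n" for i
    proof (rule ccontr)
      assume "\<not> ?thesis"
      then have e: "H1 i = H1 (Suc i)" "H2 i = H2 (Suc i)" using i by auto
      \<comment> \<open>Modular law: equal sums write u as h + w with h in \<open>H i\<close>, and
        then w lies in the trace of \<open>H (Suc i)\<close> on \<open>W\<close>; equal traces put w
        into \<open>H i\<close>.\<close>
      have "H (Suc i) \<subseteq> H i"
      proof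
        fix u assume u: "u \<in> H (Suc i)"
        have "u \<in> H2 i"
          using e(2) u set_add_mono1[OF sub(1)[of "Suc i"] W] i unfolding H2_def by auto
        then obtain h w where hw: "h \<in> H i" "w \<in> W" "u = h \<oplus>\<^bsub>M\<^esub> w" unfolding H2_def mem_set_add by auto
        have cc: "h \<in> carrier M" "w \<in> carrier M" using hw submodule_subset W sub[of i] i by auto
        have "w = u \<ominus>\<^bsub>M\<^esub> h" using hw cc by (simp add: add_diff_cancel)
        moreover have "u \<ominus>\<^bsub>M\<^esub> h \<in> H (Suc i)"
          using submodule_diff[OF sub(1)[of "Suc i"]] u hw step[of i] i by auto
        ultimately have "w \<in> H1 (Suc i)" using hw unfolding H1_def by auto
        then have "w \<in> H i" using e(1) unfolding H1_def by auto
        then show "u \<in> H i" using hw submoduleE(5)[OF sub(1)[of i]] i by auto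
      qed
      then show False using step[OF i] by auto
    qed
    then have "{..<n} \<subseteq> {i. i < n \<and> H1 i \<noteq> H1 (Suc i)} \<union> {i. i < n \<and> H2 i \<noteq> H2 (Suc i)}" by blast
    then have "n \<le> card {i. i < n \<and> H1 i \<noteq> H1 (Suc i)} + card {i. i < n \<and> H2 i \<noteq> H2 (Suc i)}"
      using card_mono[of "{i. i < n \<and> H1 i \<noteq> H1 (Suc i)} \<union> {i. i < n \<and> H2 i \<noteq> H2 (Suc i)}" "{..<n}"]
        card_Un_le[of "{i. i < n \<and> H1 i \<noteq> H1 (Suc i)}" "{i. i < n \<and> H2 i \<noteq> H2 (Suc i)}"] by simp
    then have "enat n \<le> enat (card {i. i < n \<and> H1 i \<noteq> H1 (Suc i)}) + enat (card {i. i < n \<and> H2 i \<noteq> H2 (Suc i)})"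
      by simp
    then show "enat n \<le> mlen R M B W + mlen R M W Z" using add_mono[OF 1 2] by (rule order_trans)
  qed
next
  show "mlen R M B W + mlen R M W Z \<le> mlen R M B Z"
  proof (cases "mlen R M B Z")
    case (enat k)
    have ne1: "{H. submodule H R M \<and> B \<subseteq> H \<and> H \<subseteq> W} \<noteq> {}" using B assms by auto
    have ne2: "{H. submodule H R M \<and> W \<subseteq> H \<and> H \<subseteq> Z} \<noteq> {}" using W assms by auto
    have "mlen R M B W \<le> enat k" unfolding enat[symmetric] mlen_def
      by (rule chain_len_mono[of _ "\<lambda>H. H"]) (use assms in auto)
    then obtain k1 where k1: "mlen R M B W = enat k1" using enat_ile by blast
    have "mlen R M W Z \<le> enat k" unfolding enat[symmetric] mlen_def
      by (rule chain_len_mono[of _ "\<lambda>H. H"]) (use assms in auto)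
    then obtain k2 where k2: "mlen R M W Z = enat k2" using enat_ile by blast
    obtain H1 where H1: "set_chain {H. submodule H R M \<and> B \<subseteq> H \<and> H \<subseteq> W} H1 k1"
      by (rule chain_len_attained[OF ne1 k1[unfolded mlen_def]])
    obtain H2 where H2: "set_chain {H. submodule H R M \<and> W \<subseteq> H \<and> H \<subseteq> Z} H2 k2"
      by (rule chain_len_attained[OF ne2 k2[unfolded mlen_def]])
    \<comment> \<open>\<open>H2 0\<close> is skipped: \<open>H1 k1\<close> lies in \<open>W\<close>,
      \<open>W\<close> in \<open>H2 0\<close>, and \<open>H2 0\<close> strictly in
      \<open>H2 1\<close>, so the joint is strict without knowing that \<open>H1 k1\<close> and
      \<open>H2 0\<close> equal \<open>W\<close>.\<close>
    define H where "H i = (if i \<le> k1 then H1 i else H2 (i - k1))" for i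
    have "set_chain {H. submodule H R M \<and> B \<subseteq> H \<and> H \<subseteq> Z} H (k1 + k2)"
      unfolding set_chain_def
    proof (intro conjI allI impI)
      fix i assume "i \<le> k1 + k2"
      then show "H i \<in> {H. submodule H R M \<and> B \<subseteq> H \<and> H \<subseteq> Z}"
      proof (cases "i \<le> k1")
        case True
        then have "submodule (H1 i) R M \<and> B \<subseteq> H1 i \<and> H1 i \<subseteq> W"
          using H1 unfolding set_chain_def by blast
        then show ?thesis using assms True unfolding H_def by auto
      next
        case False
        then have "i - k1 \<le> k2" using \<open>i \<le> k1 + k2\<close> by simp
        then have "submodule (H2 (i - k1)) R M \<and> W \<subseteq> H2 (i - k1) \<and> H2 (i - k1) \<subseteq> Z"
          using H2 unfolding set_chain_def by blast
        then show ?thesis using assms False unfolding H_def by auto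
      qed
    next
      fix i assume i: "i < k1 + k2"
      consider "i < k1" | "i = k1" | "i > k1" by linarith
      then show "H i \<subset> H (Suc i)"
      proof cases
        case 2
        then have "k2 > 0" using i by auto
        then have "H1 k1 \<subseteq> W" "W \<subseteq> H2 0" "H2 0 \<subset> H2 (Suc 0)" using H1 H2 unfolding set_chain_def by auto
        then show ?thesis using 2 by (auto simp: H_def)
      next
        case 3
        then have "i - k1 < k2" using i by auto
        then show ?thesis using H2 3 unfolding set_chain_def H_def by (simp add: Suc_diff_le)
      qed (use H1 in \<open>auto simp: set_chain_def H_def\<close>)
    qed
    then have "enat (k1 + k2) \<le> mlen R M B Z" unfolding mlen_def by (rule chain_len_ge)
    then show ?thesis using k1 k2 by simp
  qed simp
qed

text \<open>When \<open>f\<close> embeds Z/B into Z'/B', the assignment H to f(H) + B' is strictly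
  monotone: f(k) in f(H) + B' puts some k - h with h in \<open>H\<close> into \<open>B\<close>,
  hence k into \<open>H\<close>.\<close>

lemma mlen_le_of_semilin:
  assumes P: "module R P" and Q: "module S Q" and f: "semilin R S P Q f"
    and Z: "submodule Z R P"
    and B': "submodule B' S Q" and Z': "submodule Z' S Q"
    and fZ: "\<And>z. z \<in> Z \<Longrightarrow> f z \<in> Z'" and "B' \<subseteq> Z'"
    and ker: "\<And>z. z \<in> Z \<Longrightarrow> f z \<in> B' \<Longrightarrow> z \<in> B"
  shows "mlen R P B Z \<le> mlen S Q B' Z'"
  unfolding mlen_def
proof (rule chain_len_mono[where g = "\<lambda>H. f ` H <+>\<^bsub>Q\<^esub> B'"])
  interpret P: module R P by fact
  interpret Q: module S Q by fact
  fix H assume "H \<in> {H. submodule H R P \<and> B \<subseteq> H \<and> H \<subseteq> Z}"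
  then have H: "submodule H R P" "B \<subseteq> H" "H \<subseteq> Z" by auto
  have fH: "submodule (f ` H) S Q" by (rule semilin_image[OF P Q f H(1)])
  show "f ` H <+>\<^bsub>Q\<^esub> B' \<in> {H. submodule H S Q \<and> B' \<subseteq> H \<and> H \<subseteq> Z'}"
    using Q.submodule_sum[OF fH B'] Q.set_add_mono2[OF fH B'] Q.set_add_least[OF Z', of "f ` H" B'] fZ H \<open>B' \<subseteq> Z'\<close>
    by auto
  fix K assume "K \<in> {H. submodule H R P \<and> B \<subseteq> H \<and> H \<subseteq> Z}" "H \<subset> K"
  then have K: "submodule K R P" "B \<subseteq> K" "K \<subseteq> Z" "H \<subset> K" by auto
  have fK: "submodule (f ` K) S Q" by (rule semilin_image[OF P Q f K(1)])
  from K obtain k where k: "k \<in> K" "k \<notin> H" by auto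
  have "f k \<notin> f ` H <+>\<^bsub>Q\<^esub> B'"
  proof
    assume "f k \<in> f ` H <+>\<^bsub>Q\<^esub> B'"
    then obtain h b where h: "h \<in> H" "b \<in> B'" "f k = f h \<oplus>\<^bsub>Q\<^esub> b" by (auto simp: mem_set_add)
    have c: "k \<in> carrier P" "h \<in> carrier P" "b \<in> carrier Q" "f h \<in> carrier Q"
      using k h H K P.submodule_subset Q.submodule_subset[OF B'] Q.submodule_subset[OF fH] by auto
    have "k \<ominus>\<^bsub>P\<^esub> h \<in> carrier P" using c by simp
    then have "f (h \<oplus>\<^bsub>P\<^esub> (k \<ominus>\<^bsub>P\<^esub> h)) = f h \<oplus>\<^bsub>Q\<^esub> f (k \<ominus>\<^bsub>P\<^esub> h)" "f (k \<ominus>\<^bsub>P\<^esub> h) \<in> carrier Q"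
      using f c unfolding semilin_def by blast+
    then have "f (k \<ominus>\<^bsub>P\<^esub> h) = b" using h c by (simp add: P.diff_add_cancel)
    moreover have d: "k \<ominus>\<^bsub>P\<^esub> h \<in> K" using P.submodule_diff[OF K(1)] k h K by auto
    ultimately have "k \<ominus>\<^bsub>P\<^esub> h \<in> H" using ker[of "k \<ominus>\<^bsub>P\<^esub> h"] h K H by auto
    then have "h \<oplus>\<^bsub>P\<^esub> (k \<ominus>\<^bsub>P\<^esub> h) \<in> H" using P.submoduleE(5)[OF H(1)] h by auto
    then show False using k c by (simp add: P.diff_add_cancel)
  qed
  moreover have "f k \<in> f ` K <+>\<^bsub>Q\<^esub> B'" using Q.set_add_mono1[OF fK B'] k by auto
  moreover have "f ` H <+>\<^bsub>Q\<^esub> B' \<subseteq> f ` K <+>\<^bsub>Q\<^esub> B'" using K unfolding set_add_def' by blast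
  ultimately show "f ` H <+>\<^bsub>Q\<^esub> B' \<subset> f ` K <+>\<^bsub>Q\<^esub> B'" by auto
qed

text \<open>Dually, when \<open>f\<close> maps \<open>Z\<close> onto Z'/B', taking preimages
  separates the submodules between \<open>B'\<close> and \<open>Z'\<close>.\<close>

lemma mlen_ge_of_semilin:
  assumes P: "module R P" and Q: "module S Q" and f: "semilin R S P Q f"
    and Z: "submodule Z R P" and B: "B \<subseteq> Z"
    and fB: "\<And>b. b \<in> B \<Longrightarrow> f b \<in> B'"
    and surj: "\<And>z'. z' \<in> Z' \<Longrightarrow> \<exists>z\<in>Z. \<exists>b\<in>B'. z' = f z \<oplus>\<^bsub>Q\<^esub> b"
  shows "mlen S Q B' Z' \<le> mlen R P B Z"
  unfolding mlen_def
proof (rule chain_len_mono[where g = "\<lambda>H. {u \<in> carrier P. f u \<in> H} \<inter> Z"])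
  interpret P: module R P by fact
  interpret Q: module S Q by fact
  fix H assume "H \<in> {H. submodule H S Q \<and> B' \<subseteq> H \<and> H \<subseteq> Z'}"
  then have H: "submodule H S Q" "B' \<subseteq> H" "H \<subseteq> Z'" by auto
  show "{u \<in> carrier P. f u \<in> H} \<inter> Z \<in> {H. submodule H R P \<and> B \<subseteq> H \<and> H \<subseteq> Z}"
    using P.submodule_Int[OF semilin_vimage[OF P Q f H(1)] Z] B fB H P.submodule_subset[OF Z] by auto
  fix K assume "K \<in> {H. submodule H S Q \<and> B' \<subseteq> H \<and> H \<subseteq> Z'}" "H \<subset> K"
  then have K: "submodule K S Q" "B' \<subseteq> K" "K \<subseteq> Z'" "H \<subset> K" by auto
  from K obtain k where k: "k \<in> K" "k \<notin> H" by auto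
  obtain z b where z: "z \<in> Z" "b \<in> B'" "k = f z \<oplus>\<^bsub>Q\<^esub> b" using surj k K by blast
  have c: "z \<in> carrier P" using z P.submodule_subset[OF Z] by auto
  then have fz: "f z \<in> carrier Q" using f unfolding semilin_def by auto
  have bc: "b \<in> carrier Q" using z K Q.submodule_subset by auto
  have "f z \<notin> H" using z k H Q.submoduleE(5)[OF H(1)] by auto
  moreover have "f z \<in> K"
  proof -
    have "k \<ominus>\<^bsub>Q\<^esub> b \<in> K" using Q.submodule_diff[OF K(1)] z k K by auto
    moreover have "k \<ominus>\<^bsub>Q\<^esub> b = f z" using z(3) fz bc by (simp add: Q.add_diff_cancel Q.M.a_comm)
    ultimately show ?thesis by simp
  qed
  ultimately show "{u \<in> carrier P. f u \<in> H} \<inter> Z \<subset> {u \<in> carrier P. f u \<in> K} \<inter> Z"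
    using K z c by blast
qed

text \<open>Plays the part of an isomorphism from Z/B to Z'/B', with the two modules possibly over
  different rings. The conditions on elements make the induced map well defined, injective and
  onto.\<close>

lemma mlen_eq_of_semilin:
  assumes "module R P" "module S Q" "semilin R S P Q f"
    and "submodule Z R P" "B \<subseteq> Z"
    and "submodule B' S Q" "submodule Z' S Q" "B' \<subseteq> Z'"
    and "\<And>z. z \<in> Z \<Longrightarrow> f z \<in> Z'"
    and "\<And>z. z \<in> Z \<Longrightarrow> f z \<in> B' \<longleftrightarrow> z \<in> B"
    and "\<And>z'. z' \<in> Z' \<Longrightarrow> \<exists>z\<in>Z. \<exists>b\<in>B'. z' = f z \<oplus>\<^bsub>Q\<^esub> b"
  shows "mlen R P B Z = mlen S Q B' Z'"
  using assms
  by (intro antisym mlen_le_of_semilin[where f = f] mlen_ge_of_semilin[where f = f]) auto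

section \<open>Constructions of modules\<close>

lemma (in module) submodule_abelian_subgroup: "submodule K R M \<Longrightarrow> abelian_subgroup K M"
  by (intro abelian_subgroupI3 additive_subgroup.intro submodule.axioms(1)) (auto intro: M.abelian_group_axioms)

lemma (in module) mem_coset_iff:
  assumes K: "submodule K R M" and u: "u \<in> carrier M"
  shows "w \<in> K +>\<^bsub>M\<^esub> u \<longleftrightarrow> w \<in> carrier M \<and> w \<ominus>\<^bsub>M\<^esub> u \<in> K"
proof -
  interpret K: abelian_subgroup K M by (rule submodule_abelian_subgroup[OF K])
  show ?thesis
    using K.a_rcos_module[OF u, of w] u K.a_elemrcos_carrier by (auto simp: a_minus_def)
qed

lemma (in module) coset_self: "submodule K R M \<Longrightarrow> u \<in> carrier M \<Longrightarrow> u \<in> K +>\<^bsub>M\<^esub> u"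
  by (simp add: mem_coset_iff submodule_zero a_minus_def M.r_neg)

lemma (in module) coset_eq_iff:
  assumes K: "submodule K R M" and u: "u \<in> carrier M" and v: "v \<in> carrier M"
  shows "K +>\<^bsub>M\<^esub> u = K +>\<^bsub>M\<^esub> v \<longleftrightarrow> u \<ominus>\<^bsub>M\<^esub> v \<in> K"
proof -
  interpret K: abelian_subgroup K M by (rule submodule_abelian_subgroup[OF K])
  show ?thesis
    using K.a_repr_independence'[of u v] v u coset_self[OF K u] mem_coset_iff[OF K v, of u] by auto
qed

lemma (in module) coset_zero: "submodule K R M \<Longrightarrow> K +>\<^bsub>M\<^esub> \<zero>\<^bsub>M\<^esub> = K"
  using submodule_subset by (intro M.a_coset_add_zero) auto

lemma (in module) coset_eq_zero_iff:
  "submodule K R M \<Longrightarrow> u \<in> carrier M \<Longrightarrow> K +>\<^bsub>M\<^esub> u = K \<longleftrightarrow> u \<in> K"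
  using coset_eq_iff[of K u "\<zero>\<^bsub>M\<^esub>"] diff_add_cancel[of u "\<zero>\<^bsub>M\<^esub>"] by (simp add: coset_zero)

lemma carrier_fact_module: "carrier (fact_module M K) = (\<lambda>u. K +>\<^bsub>M\<^esub> u) ` carrier M"
  unfolding fact_module_def A_RCOSETS_def' by auto

lemma zero_fact_module: "\<zero>\<^bsub>fact_module M K\<^esub> = K"
  unfolding fact_module_def by simp

lemma (in module) add_fact_module:
  assumes "submodule K R M" "u \<in> carrier M" "v \<in> carrier M"
  shows "(K +>\<^bsub>M\<^esub> u) \<oplus>\<^bsub>fact_module M K\<^esub> (K +>\<^bsub>M\<^esub> v) = K +>\<^bsub>M\<^esub> (u \<oplus>\<^bsub>M\<^esub> v)"
proof -
  interpret K: abelian_subgroup K M by (rule submodule_abelian_subgroup[OF assms(1)])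
  show ?thesis unfolding fact_module_def using K.a_rcos_sum assms by simp
qed

text \<open>The unions over a coset in the quotient constructions collapse to any one representative.\<close>

lemma (in module) Union_coset:
  assumes K: "submodule K R M" and u: "u \<in> carrier M"
    and f: "\<And>v. v \<in> carrier M \<Longrightarrow> v \<ominus>\<^bsub>M\<^esub> u \<in> K \<Longrightarrow> f v = f u"
  shows "(\<Union>v\<in>K +>\<^bsub>M\<^esub> u. f v) = f u"
proof -
  have "f v = f u" if "v \<in> K +>\<^bsub>M\<^esub> u" for v
    using that f mem_coset_iff[OF K u] by auto
  then have "f ` (K +>\<^bsub>M\<^esub> u) = {f u}" using coset_self[OF K u] by blast
  then show ?thesis by simp
qed

lemma (in module) smult_fact_module:
  assumes K: "submodule K R M" and a: "a \<in> carrier R" and u: "u \<in> carrier M"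
  shows "a \<odot>\<^bsub>fact_module M K\<^esub> (K +>\<^bsub>M\<^esub> u) = K +>\<^bsub>M\<^esub> (a \<odot>\<^bsub>M\<^esub> u)"
proof -
  have "K +>\<^bsub>M\<^esub> a \<odot>\<^bsub>M\<^esub> v = K +>\<^bsub>M\<^esub> a \<odot>\<^bsub>M\<^esub> u" if "v \<in> carrier M" "v \<ominus>\<^bsub>M\<^esub> u \<in> K" for v
    using that a u submoduleE(4)[OF K a] by (simp add: coset_eq_iff[OF K] flip: smult_diff_r)
  from Union_coset[OF K u, of "\<lambda>v. K +>\<^bsub>M\<^esub> a \<odot>\<^bsub>M\<^esub> v", OF this]
  show ?thesis by (simp add: fact_module_def)
qed

lemma (in module) module_fact_module:
  assumes K: "submodule K R M"
  shows "module R (fact_module M K)"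
proof (rule moduleI)
  note s = carrier_fact_module add_fact_module[OF K] smult_fact_module[OF K]
  have z: "\<zero>\<^bsub>fact_module M K\<^esub> = K +>\<^bsub>M\<^esub> \<zero>\<^bsub>M\<^esub>" by (simp add: zero_fact_module coset_zero[OF K])
  show "abelian_group (fact_module M K)"
  proof (rule abelian_groupI)
    fix X assume "X \<in> carrier (fact_module M K)"
    then obtain u where u: "u \<in> carrier M" "X = K +>\<^bsub>M\<^esub> u" by (auto simp: s)
    then have "(K +>\<^bsub>M\<^esub> (\<ominus>\<^bsub>M\<^esub> u)) \<oplus>\<^bsub>fact_module M K\<^esub> X = \<zero>\<^bsub>fact_module M K\<^esub>"
      by (simp add: s z M.l_neg)
    moreover have "K +>\<^bsub>M\<^esub> (\<ominus>\<^bsub>M\<^esub> u) \<in> carrier (fact_module M K)" using u by (auto simp: s)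
    ultimately show "\<exists>Y\<in>carrier (fact_module M K). Y \<oplus>\<^bsub>fact_module M K\<^esub> X = \<zero>\<^bsub>fact_module M K\<^esub>" by blast
  qed (auto simp: s z M.a_ac)
qed (use K in \<open>auto simp: carrier_fact_module add_fact_module smult_fact_module
    smult_l_distr smult_r_distr smult_assoc1 intro: R.cring_axioms\<close>)

lemma (in module) mhom_coset:
  "submodule K R M \<Longrightarrow> mhom R M (fact_module M K) (\<lambda>u. K +>\<^bsub>M\<^esub> u)"
  by (intro mhomI) (auto simp: carrier_fact_module add_fact_module smult_fact_module)

lemma (in module) submodule_of_submodule_iff:
  assumes Z: "submodule Z R M"
  shows "submodule H R (M\<lparr>carrier := Z\<rparr>) \<longleftrightarrow> submodule H R M \<and> H \<subseteq> Z"
proof -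
  interpret Z: module R "M\<lparr>carrier := Z\<rparr>" by (rule submodule.submodule_is_module[OF Z module_axioms])
  show ?thesis
  proof
    assume H: "submodule H R (M\<lparr>carrier := Z\<rparr>)"
    have "H \<subseteq> Z" using Z.submodule_subset[OF H] by auto
    moreover have "submodule H R M"
      using Z.submodule_zero[OF H] Z.submoduleE(4,5)[OF H] \<open>H \<subseteq> Z\<close> submodule_subset[OF Z]
      by (intro submoduleI') auto
    ultimately show "submodule H R M \<and> H \<subseteq> Z" by simp
  next
    assume H: "submodule H R M \<and> H \<subseteq> Z"
    then show "submodule H R (M\<lparr>carrier := Z\<rparr>)"
      using submodule_zero[of H] submoduleE(4,5)[of H]
      by (intro Z.submoduleI') auto
  qed
qed

text \<open>Turns the length of Ext, which is defined as a quotient of the cocycles, into the length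
  of an interval. The map to be fed into \<open>mlen_eq_of_semilin\<close> is the coset map.\<close>

lemma (in module) module_length_subquotient:
  assumes Z: "submodule Z R M" and B: "submodule B R M" and "B \<subseteq> Z"
  shows "module_length R (fact_module (M\<lparr>carrier := Z\<rparr>) B) = mlen R M B Z"
proof -
  let ?Z = "M\<lparr>carrier := Z\<rparr>" and ?Q = "fact_module (M\<lparr>carrier := Z\<rparr>) B"
  interpret Z: module R ?Z by (rule submodule.submodule_is_module[OF Z module_axioms])
  have B': "submodule B R ?Z" using assms by (simp add: submodule_of_submodule_iff)
  interpret Q: module R ?Q by (rule Z.module_fact_module[OF B'])
  have "mlen R M B Z = mlen R ?Z B Z"
    unfolding mlen_def using submodule_of_submodule_iff[OF Z] by (metis (no_types, lifting))
  also have "\<dots> = mlen R ?Q {\<zero>\<^bsub>?Q\<^esub>} (carrier ?Q)"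
  proof (rule mlen_eq_of_semilin[where f = "\<lambda>u. B +>\<^bsub>?Z\<^esub> u"])
    show "semilin R R ?Z ?Q (\<lambda>u. B +>\<^bsub>?Z\<^esub> u)" by (rule mhom_semilin[OF Z.mhom_coset[OF B']])
    fix X assume "X \<in> carrier ?Q"
    then obtain z where "z \<in> Z" "X = B +>\<^bsub>?Z\<^esub> z" by (auto simp: carrier_fact_module)
    moreover then have "X = X \<oplus>\<^bsub>?Q\<^esub> \<zero>\<^bsub>?Q\<^esub>" by (metis Q.M.r_zero \<open>X \<in> carrier ?Q\<close>)
    ultimately show "\<exists>z\<in>Z. \<exists>b\<in>{\<zero>\<^bsub>?Q\<^esub>}. X = (B +>\<^bsub>?Z\<^esub> z) \<oplus>\<^bsub>?Q\<^esub> b" by blast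
  next
    show "submodule Z R ?Z" using Z.carrier_is_submodule by simp
    show "z \<in> Z \<Longrightarrow> (B +>\<^bsub>?Z\<^esub> z \<in> {\<zero>\<^bsub>?Q\<^esub>}) = (z \<in> B)" for z
      using Z.coset_eq_zero_iff[OF B', of z] by (simp add: zero_fact_module)
    show "z \<in> Z \<Longrightarrow> B +>\<^bsub>?Z\<^esub> z \<in> carrier ?Q" for z by (auto simp: carrier_fact_module)
  qed (rule Z.module_axioms Q.module_axioms \<open>B \<subseteq> Z\<close> Q.carrier_is_submodule Q.submodule_zero_set | simp)+
  finally show ?thesis by (simp add: Q.module_length_eq_mlen)
qed

lemma module_hom_module:
  assumes "module R F" "module R N" shows "module R (hom_module R F N)"
proof -
  interpret F: module R F by fact
  interpret N: module R N by fact
  let ?H = "hom_module R F N"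
  note hs = hom_module_def module_homs_iff
  have cl: "f u \<in> carrier N" if "f \<in> carrier ?H" "u \<in> carrier F" for f u
    using that mhom_closed by (auto simp: hs)
  have ext: "f = g" if "f \<in> carrier ?H" "g \<in> carrier ?H" "\<And>u. u \<in> carrier F \<Longrightarrow> f u = g u" for f g
    using that by (auto simp: hs intro: extensionalityI)
  have add: "f \<oplus>\<^bsub>?H\<^esub> g \<in> carrier ?H" if "f \<in> carrier ?H" "g \<in> carrier ?H" for f g
    using that mhom_add_fun[OF assms(2), of F f g] mhom_restrict[OF assms(1)] by (auto simp: hs)
  have zero: "\<zero>\<^bsub>?H\<^esub> \<in> carrier ?H"
    using mhom_const_zero[OF assms(2)] mhom_restrict[OF assms(1)] by (auto simp: hs)
  have sm: "a \<odot>\<^bsub>?H\<^esub> f \<in> carrier ?H" if "f \<in> carrier ?H" "a \<in> carrier R" for a f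
    using that mhom_smult_fun[OF assms(2), of F f a] mhom_restrict[OF assms(1)] by (auto simp: hs)
  have ev: "(f \<oplus>\<^bsub>?H\<^esub> g) u = f u \<oplus>\<^bsub>N\<^esub> g u" "\<zero>\<^bsub>?H\<^esub> u = \<zero>\<^bsub>N\<^esub>" "(a \<odot>\<^bsub>?H\<^esub> f) u = a \<odot>\<^bsub>N\<^esub> f u"
    if "u \<in> carrier F" for f g u a using that by (auto simp: hs)
  show ?thesis
  proof (rule moduleI)
    show "abelian_group ?H"
    proof (rule abelian_groupI)
      fix f assume f: "f \<in> carrier ?H"
      let ?g = "(\<ominus>\<^bsub>R\<^esub> \<one>\<^bsub>R\<^esub>) \<odot>\<^bsub>?H\<^esub> f"
      have g: "?g \<in> carrier ?H" using sm[OF f] by simp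
      moreover have "?g \<oplus>\<^bsub>?H\<^esub> f = \<zero>\<^bsub>?H\<^esub>"
        by (rule ext[OF add[OF g f] zero]) (simp add: ev N.smult_l_minus N.M.l_neg cl[OF f])
      ultimately show "\<exists>g\<in>carrier ?H. g \<oplus>\<^bsub>?H\<^esub> f = \<zero>\<^bsub>?H\<^esub>" by blast
    next
      fix f g h assume *: "f \<in> carrier ?H" "g \<in> carrier ?H" "h \<in> carrier ?H"
      show "f \<oplus>\<^bsub>?H\<^esub> g \<oplus>\<^bsub>?H\<^esub> h = f \<oplus>\<^bsub>?H\<^esub> (g \<oplus>\<^bsub>?H\<^esub> h)"
        by (intro ext add *) (simp add: ev cl * N.M.a_assoc)
    next
      fix f g assume *: "f \<in> carrier ?H" "g \<in> carrier ?H"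
      show "f \<oplus>\<^bsub>?H\<^esub> g = g \<oplus>\<^bsub>?H\<^esub> f" by (intro ext add *) (simp add: ev cl * N.M.a_comm)
    next
      fix f assume *: "f \<in> carrier ?H"
      show "\<zero>\<^bsub>?H\<^esub> \<oplus>\<^bsub>?H\<^esub> f = f" by (intro ext add zero *) (simp add: ev cl *)
    qed (use add zero in auto)
  next
    fix a b f assume *: "a \<in> carrier R" "b \<in> carrier R" "f \<in> carrier ?H"
    show "(a \<oplus>\<^bsub>R\<^esub> b) \<odot>\<^bsub>?H\<^esub> f = (a \<odot>\<^bsub>?H\<^esub> f) \<oplus>\<^bsub>?H\<^esub> (b \<odot>\<^bsub>?H\<^esub> f)"
      using * by (intro ext add sm) (simp_all add: ev cl N.smult_l_distr)
    show "(a \<otimes>\<^bsub>R\<^esub> b) \<odot>\<^bsub>?H\<^esub> f = a \<odot>\<^bsub>?H\<^esub> (b \<odot>\<^bsub>?H\<^esub> f)"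
      using * by (intro ext sm) (simp_all add: ev cl N.smult_assoc1)
  next
    fix a f g assume *: "a \<in> carrier R" "f \<in> carrier ?H" "g \<in> carrier ?H"
    show "a \<odot>\<^bsub>?H\<^esub> (f \<oplus>\<^bsub>?H\<^esub> g) = (a \<odot>\<^bsub>?H\<^esub> f) \<oplus>\<^bsub>?H\<^esub> (a \<odot>\<^bsub>?H\<^esub> g)"
      using * by (intro ext add sm) (simp_all add: ev cl N.smult_r_distr)
  next
    fix f assume *: "f \<in> carrier ?H"
    show "\<one>\<^bsub>R\<^esub> \<odot>\<^bsub>?H\<^esub> f = f"
      using * by (intro ext sm) (simp_all add: ev cl)
  qed (use sm module.axioms(1)[OF assms(1)] in auto)
qed

section \<open>Free modules, the ring as a module over itself, direct sums\<close>

lemma (in cring) module_free_module: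
  shows "module R (free_module R n)"
proof -
  show ?thesis
  proof (rule moduleI)
    show "abelian_group (free_module R n)"
    proof (rule abelian_groupI)
      fix v assume v: "v \<in> carrier (free_module R n)"
      then have c: "v i \<in> carrier R" for i by (cases "i < n") (auto simp: free_module_def)
      show "\<exists>w\<in>carrier (free_module R n). w \<oplus>\<^bsub>free_module R n\<^esub> v = \<zero>\<^bsub>free_module R n\<^esub>"
        using v c by (intro bexI[of _ "\<lambda>i. \<ominus> v i"]) (auto simp: free_module_def l_neg)
    next
      fix u v w assume *: "u \<in> carrier (free_module R n)" "v \<in> carrier (free_module R n)" "w \<in> carrier (free_module R n)"
      then have "u i \<in> carrier R" "v i \<in> carrier R" "w i \<in> carrier R" for i
        by (cases "i < n"; auto simp: free_module_def)+
      then show "u \<oplus>\<^bsub>free_module R n\<^esub> v \<oplus>\<^bsub>free_module R n\<^esub> w = u \<oplus>\<^bsub>free_module R n\<^esub> (v \<oplus>\<^bsub>free_module R n\<^esub> w)"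
        by (simp add: free_module_def a_assoc)
    next
      fix u v assume *: "u \<in> carrier (free_module R n)" "v \<in> carrier (free_module R n)"
      then have "u i \<in> carrier R" "v i \<in> carrier R" for i
        by (cases "i < n"; auto simp: free_module_def)+
      then show "u \<oplus>\<^bsub>free_module R n\<^esub> v = v \<oplus>\<^bsub>free_module R n\<^esub> u"
        by (simp add: free_module_def a_comm)
    next
      fix u assume *: "u \<in> carrier (free_module R n)"
      then have "u i \<in> carrier R" for i by (cases "i < n"; auto simp: free_module_def)
      then show "\<zero>\<^bsub>free_module R n\<^esub> \<oplus>\<^bsub>free_module R n\<^esub> u = u" by (simp add: free_module_def)
    qed (auto simp: free_module_def)
  next
    fix a b u assume *: "a \<in> carrier R" "b \<in> carrier R" "u \<in> carrier (free_module R n)"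
    then have "u i \<in> carrier R" for i by (cases "i < n"; auto simp: free_module_def)
    then show "(a \<oplus> b) \<odot>\<^bsub>free_module R n\<^esub> u = a \<odot>\<^bsub>free_module R n\<^esub> u \<oplus>\<^bsub>free_module R n\<^esub> b \<odot>\<^bsub>free_module R n\<^esub> u"
      "a \<otimes> b \<odot>\<^bsub>free_module R n\<^esub> u = a \<odot>\<^bsub>free_module R n\<^esub> (b \<odot>\<^bsub>free_module R n\<^esub> u)"
      using * by (auto simp: free_module_def l_distr m_assoc)
  next
    fix a u v assume *: "a \<in> carrier R" "u \<in> carrier (free_module R n)" "v \<in> carrier (free_module R n)"
    then have "u i \<in> carrier R" "v i \<in> carrier R" for i
        by (cases "i < n"; auto simp: free_module_def)+
    then show "a \<odot>\<^bsub>free_module R n\<^esub> (u \<oplus>\<^bsub>free_module R n\<^esub> v) = a \<odot>\<^bsub>free_module R n\<^esub> u \<oplus>\<^bsub>free_module R n\<^esub> a \<odot>\<^bsub>free_module R n\<^esub> v"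
      using * by (auto simp: free_module_def r_distr)
  next
    fix u assume *: "u \<in> carrier (free_module R n)"
    then have "u i \<in> carrier R" for i by (cases "i < n"; auto simp: free_module_def)
    then show "\<one> \<odot>\<^bsub>free_module R n\<^esub> u = u" by (auto simp: free_module_def)
  qed (auto simp: free_module_def intro: cring_axioms)
qed

lemma (in cring) module_self_module:
  shows "module R (self_module R)"
proof -
  show ?thesis
    by (intro moduleI abelian_groupI cring_axioms)
       (auto simp: self_module_def a_ac m_assoc l_distr r_distr intro: bexI[of _ "\<ominus> _"] l_neg)
qed

lemma module_direct_sum:
  assumes "module R M" "module R N" shows "module R (direct_sum M N)"
proof -
  interpret M: module R M by fact
  interpret N: module R N by fact
  show ?thesis
  proof (rule moduleI)
    show "abelian_group (direct_sum M N)"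
    proof (rule abelian_groupI)
      fix w assume "w \<in> carrier (direct_sum M N)"
      then show "\<exists>v\<in>carrier (direct_sum M N). v \<oplus>\<^bsub>direct_sum M N\<^esub> w = \<zero>\<^bsub>direct_sum M N\<^esub>"
        by (intro bexI[of _ "(\<ominus>\<^bsub>M\<^esub> fst w, \<ominus>\<^bsub>N\<^esub> snd w)"])
           (auto simp: direct_sum_def M.M.l_neg N.M.l_neg)
    qed (auto simp: direct_sum_def M.M.a_ac N.M.a_ac)
  qed (auto simp: direct_sum_def M.smult_l_distr N.smult_l_distr M.smult_r_distr N.smult_r_distr
      M.smult_assoc1 N.smult_assoc1 intro: module.axioms(1)[OF assms(1)])
qed

text \<open>Restriction of scalars. The carrier is unchanged, so a map that is linear over the
  quotient ring is the same function when read over \<open>R\<close>.\<close>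

definition restr :: "('a \<Rightarrow> 's) \<Rightarrow> ('s, 'b, 'm) module_scheme \<Rightarrow> ('a, 'b) module" where
  "restr \<rho> X = \<lparr>carrier = carrier X, mult = undefined, one = undefined,
     zero = \<zero>\<^bsub>X\<^esub>, add = add X, smult = (\<lambda>a u. \<rho> a \<odot>\<^bsub>X\<^esub> u)\<rparr>"

lemma module_restr:
  assumes "module S X" "cring R" "\<rho> \<in> ring_hom R S" shows "module R (restr \<rho> X)"
proof -
  interpret X: module S X by fact
  show ?thesis
  proof (rule moduleI[OF assms(2)])
    show "abelian_group (restr \<rho> X)"
    proof (rule abelian_groupI)
      fix w assume "w \<in> carrier (restr \<rho> X)"
      then show "\<exists>v\<in>carrier (restr \<rho> X). v \<oplus>\<^bsub>restr \<rho> X\<^esub> w = \<zero>\<^bsub>restr \<rho> X\<^esub>"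
        by (intro bexI[of _ "\<ominus>\<^bsub>X\<^esub> w"]) (auto simp: restr_def X.M.l_neg)
    qed (auto simp: restr_def X.M.a_ac)
  qed (use ring_hom_closed[OF assms(3)] ring_hom_add[OF assms(3)] ring_hom_mult[OF assms(3)]
        ring_hom_one[OF assms(3)] in
      \<open>auto simp: restr_def X.smult_l_distr X.smult_r_distr X.smult_assoc1\<close>)
qed

text \<open>Representatives of a coset of \<open>A\<close> differ by elements that kill
  \<open>M\<close>, so they all act alike and the image set under \<open>the_elem\<close> is a
  singleton.\<close>

lemma (in module) smult_module_over_quot:
  assumes A: "ideal A R" and ann: "\<And>a u. a \<in> A \<Longrightarrow> u \<in> carrier M \<Longrightarrow> a \<odot>\<^bsub>M\<^esub> u = \<zero>\<^bsub>M\<^esub>"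
    and a: "a \<in> carrier R" and u: "u \<in> carrier M"
  shows "(A +>\<^bsub>R\<^esub> a) \<odot>\<^bsub>module_over_quot M\<^esub> u = a \<odot>\<^bsub>M\<^esub> u"
proof -
  interpret A: ideal A R by fact
  have "b \<odot>\<^bsub>M\<^esub> u = a \<odot>\<^bsub>M\<^esub> u" if b: "b \<in> A +>\<^bsub>R\<^esub> a" for b
  proof -
    obtain c where c: "c \<in> A" "b = c \<oplus>\<^bsub>R\<^esub> a" using b by (auto simp: a_r_coset_def')
    have "b \<odot>\<^bsub>M\<^esub> u = c \<odot>\<^bsub>M\<^esub> u \<oplus>\<^bsub>M\<^esub> a \<odot>\<^bsub>M\<^esub> u"
      unfolding c(2) by (rule smult_l_distr[OF A.Icarr[OF c(1)] a u])
    also have "\<dots> = a \<odot>\<^bsub>M\<^esub> u" unfolding ann[OF c(1) u] by (rule M.l_zero[OF smult_closed[OF a u]])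
    finally show ?thesis .
  qed
  then have "(\<lambda>b. b \<odot>\<^bsub>M\<^esub> u) ` (A +>\<^bsub>R\<^esub> a) = (\<lambda>b. a \<odot>\<^bsub>M\<^esub> u) ` (A +>\<^bsub>R\<^esub> a)"
    by (rule image_cong[OF refl])
  also have "\<dots> = {a \<odot>\<^bsub>M\<^esub> u}"
    using A.a_rcos_self[OF a] by blast
  finally have "(\<lambda>b. b \<odot>\<^bsub>M\<^esub> u) ` (A +>\<^bsub>R\<^esub> a) = {a \<odot>\<^bsub>M\<^esub> u}" .
  then show ?thesis unfolding module_over_quot_def by simp
qed

lemma (in module) module_module_over_quot:
  assumes A: "ideal A R" and ann: "\<And>a u. a \<in> A \<Longrightarrow> u \<in> carrier M \<Longrightarrow> a \<odot>\<^bsub>M\<^esub> u = \<zero>\<^bsub>M\<^esub>"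
  shows "module (R Quot A) (module_over_quot M)"
proof -
  interpret A: ideal A R by fact
  note sm = smult_module_over_quot[OF A ann]
  have ca: "\<exists>a\<in>carrier R. X = A +>\<^bsub>R\<^esub> a" if "X \<in> carrier (R Quot A)" for X
    using that unfolding FactRing_def A_RCOSETS_def' by auto
  have add: "(A +>\<^bsub>R\<^esub> a) \<oplus>\<^bsub>R Quot A\<^esub> (A +>\<^bsub>R\<^esub> b) = A +>\<^bsub>R\<^esub> (a \<oplus>\<^bsub>R\<^esub> b)"
    "(A +>\<^bsub>R\<^esub> a) \<otimes>\<^bsub>R Quot A\<^esub> (A +>\<^bsub>R\<^esub> b) = A +>\<^bsub>R\<^esub> (a \<otimes>\<^bsub>R\<^esub> b)"
    if "a \<in> carrier R" "b \<in> carrier R" for a b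
    using that by (simp_all add: ring_hom_add[OF A.rcos_ring_hom] ring_hom_mult[OF A.rcos_ring_hom])
  have one: "\<one>\<^bsub>R Quot A\<^esub> = A +>\<^bsub>R\<^esub> \<one>\<^bsub>R\<^esub>" by (simp add: FactRing_def)
  have car: "carrier (module_over_quot M) = carrier M" "add (module_over_quot M) = add M"
    "\<zero>\<^bsub>module_over_quot M\<^esub> = \<zero>\<^bsub>M\<^esub>" by (simp_all add: module_over_quot_def)
  show ?thesis
  proof (rule moduleI)
    show "cring (R Quot A)" by (rule A.quotient_is_cring[OF R.cring_axioms])
    show "abelian_group (module_over_quot M)"
    proof (rule abelian_groupI)
      fix w assume "w \<in> carrier (module_over_quot M)"
      then show "\<exists>v\<in>carrier (module_over_quot M). v \<oplus>\<^bsub>module_over_quot M\<^esub> w = \<zero>\<^bsub>module_over_quot M\<^esub>"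
        by (intro bexI[of _ "\<ominus>\<^bsub>M\<^esub> w"]) (auto simp: car M.l_neg)
    qed (auto simp: car M.a_ac)
  qed (auto dest!: ca simp: car sm add one smult_l_distr smult_r_distr smult_assoc1)
qed

section \<open>M/xM as a module over R/xR\<close>

lemma (in module) submodule_smult_image:
  assumes "x \<in> carrier R" shows "submodule ((\<lambda>u. x \<odot>\<^bsub>M\<^esub> u) ` carrier M) R M"
proof (rule submodule_image[OF module_axioms module_axioms _ carrier_is_submodule])
  show "mhom R M M (\<lambda>u. x \<odot>\<^bsub>M\<^esub> u)" by (rule mhom_smult_fun[OF module_axioms mhom_ident assms])
qed

locale module_mod_elt = module R M for R (structure) and M (structure) +
  fixes x
  assumes x: "x \<in> carrier R"
begin

definition "xM = (\<lambda>u. x \<odot>\<^bsub>M\<^esub> u) ` carrier M"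

definition "proj u = xM +>\<^bsub>M\<^esub> u"

lemma submodule_xM: "submodule xM R M"
  unfolding xM_def by (rule submodule_smult_image[OF x])

lemma ideal_PIdl: "ideal (PIdl x) R"
  by (rule R.cgenideal_ideal[OF x])

lemma annihilates:
  assumes "a \<in> PIdl x" "X \<in> carrier (fact_module M xM)"
  shows "a \<odot>\<^bsub>fact_module M xM\<^esub> X = \<zero>\<^bsub>fact_module M xM\<^esub>"
proof -
  obtain r where r: "r \<in> carrier R" "a = r \<otimes> x" using assms by (auto simp: cgenideal_def)
  obtain u where u: "u \<in> carrier M" "X = xM +>\<^bsub>M\<^esub> u" using assms by (auto simp: carrier_fact_module)
  have "a \<odot>\<^bsub>M\<^esub> u = x \<odot>\<^bsub>M\<^esub> (r \<odot>\<^bsub>M\<^esub> u)"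
    using r u x by (simp add: R.m_comm flip: smult_assoc1)
  then have "a \<odot>\<^bsub>M\<^esub> u \<in> xM" unfolding xM_def using r u by auto
  then show ?thesis
    using r u x by (simp add: smult_fact_module[OF submodule_xM] zero_fact_module coset_eq_zero_iff[OF submodule_xM])
qed

lemma mod_elt_eq: "mod_elt M x = module_over_quot (fact_module M xM)"
  by (simp add: mod_elt_def xM_def)

lemma module_mod_elt: "module (R Quot PIdl x) (mod_elt M x)"
  unfolding mod_elt_eq
  by (rule module.module_module_over_quot[OF module_fact_module[OF submodule_xM] ideal_PIdl annihilates])

lemma carrier_mod_elt: "carrier (mod_elt M x) = proj ` carrier M"
  by (simp add: mod_elt_eq module_over_quot_def carrier_fact_module proj_def image_def)

lemma zero_mod_elt: "\<zero>\<^bsub>mod_elt M x\<^esub> = xM"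
  by (simp add: mod_elt_eq module_over_quot_def zero_fact_module)

lemma proj_closed: "u \<in> carrier M \<Longrightarrow> proj u \<in> carrier (mod_elt M x)"
  by (simp add: carrier_mod_elt)

lemma proj_add: "u \<in> carrier M \<Longrightarrow> v \<in> carrier M \<Longrightarrow>
    proj (u \<oplus>\<^bsub>M\<^esub> v) = proj u \<oplus>\<^bsub>mod_elt M x\<^esub> proj v"
  by (simp add: mod_elt_eq module_over_quot_def proj_def flip: add_fact_module[OF submodule_xM])

lemma proj_smult: "a \<in> carrier R \<Longrightarrow> u \<in> carrier M \<Longrightarrow>
    proj (a \<odot>\<^bsub>M\<^esub> u) = (PIdl x +> a) \<odot>\<^bsub>mod_elt M x\<^esub> proj u"
  unfolding mod_elt_eq
  by (subst module.smult_module_over_quot[OF module_fact_module[OF submodule_xM] ideal_PIdl annihilates])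
     (auto simp: proj_def carrier_fact_module smult_fact_module[OF submodule_xM])

lemma mhom_proj: "mhom R M (restr ((+>) (PIdl x)) (mod_elt M x)) proj"
  by (intro mhomI) (auto simp: restr_def proj_closed proj_add proj_smult)

lemma proj_eq_zero_iff: "u \<in> carrier M \<Longrightarrow> proj u = \<zero>\<^bsub>mod_elt M x\<^esub> \<longleftrightarrow> (\<exists>v\<in>carrier M. u = x \<odot>\<^bsub>M\<^esub> v)"
  unfolding zero_mod_elt proj_def coset_eq_zero_iff[OF submodule_xM] by (auto simp: xM_def)

end

section \<open>Free modules\<close>

definition unit_vec :: "('a, 'r) ring_scheme \<Rightarrow> nat \<Rightarrow> nat \<Rightarrow> 'a" where
  "unit_vec R i = (\<lambda>j. if j = i then \<one>\<^bsub>R\<^esub> else \<zero>\<^bsub>R\<^esub>)"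

lemma (in cring) unit_vec_closed: "i < n \<Longrightarrow> unit_vec R i \<in> carrier (free_module R n)"
  by (auto simp: unit_vec_def free_module_def)

lemma mhom_free_eqI:
  assumes P: "module R P" and f: "mhom R (free_module R n) P f" and g: "mhom R (free_module R n) P g"
    and eq: "\<And>i. i < n \<Longrightarrow> f (unit_vec R i) = g (unit_vec R i)"
    and v: "v \<in> carrier (free_module R n)"
  shows "f v = g v"
proof -
  interpret P: module R P by fact
  interpret F: module R "free_module R n" by (rule P.R.module_free_module)
  let ?F = "free_module R n"
  \<comment> \<open>Induction on a bound \<open>k\<close> from which on all coordinates vanish: the
    last remaining coordinate is split off as a multiple of a unit vector.\<close>
  have "f v = g v" if "k \<le> n" "v \<in> carrier ?F" "\<And>i. i \<ge> k \<Longrightarrow> v i = \<zero>\<^bsub>R\<^esub>" for k v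
    using that
  proof (induction k arbitrary: v)
    case 0
    then have "v = \<zero>\<^bsub>?F\<^esub>" by (auto simp: free_module_def)
    then show ?case using mhom_zero[OF F.module_axioms P f] mhom_zero[OF F.module_axioms P g] by simp
  next
    case (Suc k)
    have vk: "v k \<in> carrier R" "k < n" using Suc.prems by (auto simp: free_module_def)
    let ?w = "v(k := \<zero>\<^bsub>R\<^esub>)"
    have w: "?w \<in> carrier ?F" using Suc.prems(2) by (auto simp: free_module_def)
    have "v i \<in> carrier R" for i using Suc.prems(2) by (cases "i < n") (auto simp: free_module_def)
    then have v_eq: "v = ?w \<oplus>\<^bsub>?F\<^esub> v k \<odot>\<^bsub>?F\<^esub> unit_vec R k"
      by (auto simp: free_module_def unit_vec_def fun_eq_iff)
    have "f ?w = g ?w"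
    proof (rule Suc.IH)
      show "?w i = \<zero>\<^bsub>R\<^esub>" if "i \<ge> k" for i using Suc.prems(3)[of i] that by (cases "i = k") auto
      show "?w \<in> carrier ?F" by (rule w)
    qed (use Suc.prems(1) in simp)
    moreover have "f (v k \<odot>\<^bsub>?F\<^esub> unit_vec R k) = g (v k \<odot>\<^bsub>?F\<^esub> unit_vec R k)"
      using mhom_smult[OF f] mhom_smult[OF g] vk eq P.R.unit_vec_closed by simp
    ultimately show ?case
      using mhom_add[OF f w, of "v k \<odot>\<^bsub>?F\<^esub> unit_vec R k"] mhom_add[OF g w, of "v k \<odot>\<^bsub>?F\<^esub> unit_vec R k"]
        vk P.R.unit_vec_closed[OF vk(2)] v_eq by simp
  qed
  from this[of n v] v show ?thesis by (auto simp: free_module_def)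
qed

lemma free_lift:
  assumes P: "module R P" and g: "\<And>i. i < n \<Longrightarrow> g i \<in> carrier P"
  obtains h where "mhom R (free_module R n) P h" "\<And>i. i < n \<Longrightarrow> h (unit_vec R i) = g i"
proof -
  interpret P: module R P by fact
  let ?F = "free_module R n"
  \<comment> \<open>The clause for \<open>i \<ge> k\<close> matters: the \<open>k\<close>-th unit
    vector still goes to zero, so adding the \<open>k\<close>-th coordinate times \<open>g k\<close>
    gives it the value \<open>g k\<close> and leaves the earlier values alone.\<close>
  have "\<exists>h. mhom R ?F P h \<and> (\<forall>i<k. h (unit_vec R i) = g i) \<and> (\<forall>i\<ge>k. h (unit_vec R i) = \<zero>\<^bsub>P\<^esub>)"
    if "k \<le> n" for k using that
  proof (induction k)
    case 0
    show ?case using mhom_const_zero[OF P] by auto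
  next
    case (Suc k)
    then obtain h where h: "mhom R ?F P h" "\<And>i. i < k \<Longrightarrow> h (unit_vec R i) = g i"
      "\<And>i. i \<ge> k \<Longrightarrow> h (unit_vec R i) = \<zero>\<^bsub>P\<^esub>" by auto
    have gk: "g k \<in> carrier P" using g Suc by auto
    have "mhom R ?F P (\<lambda>v. v k \<odot>\<^bsub>P\<^esub> g k)"
      using Suc.prems gk by (intro mhomI) (auto simp: free_module_def P.smult_l_distr P.smult_assoc1)
    then have "mhom R ?F P (\<lambda>v. h v \<oplus>\<^bsub>P\<^esub> v k \<odot>\<^bsub>P\<^esub> g k)" by (rule mhom_add_fun[OF P h(1)])
    then show ?case using h(2,3) gk g Suc.prems
      by (intro exI[of _ "\<lambda>v. h v \<oplus>\<^bsub>P\<^esub> v k \<odot>\<^bsub>P\<^esub> g k"])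
         (auto simp: unit_vec_def less_Suc_eq)
  qed
  from this[of n] that show ?thesis by auto
qed

text \<open>The condition concerns the values of \<open>f\<close> and not all of \<open>Q\<close>,
  so lifts are also available along differentials and along embeddings, which are not onto.\<close>

lemma free_projective:
  assumes P: "module R P" and Q: "module R Q" and p: "mhom R P Q p" and f: "mhom R (free_module R n) Q f"
    and sub: "\<And>v. v \<in> carrier (free_module R n) \<Longrightarrow> f v \<in> p ` carrier P"
  obtains h where "mhom R (free_module R n) P h" "\<And>v. v \<in> carrier (free_module R n) \<Longrightarrow> p (h v) = f v"
proof -
  interpret P: module R P by fact
  have "\<exists>u. u \<in> carrier P \<and> p u = f (unit_vec R i)" if "i < n" for i
    using sub[OF P.R.unit_vec_closed[OF that]] by auto
  then obtain g where g: "\<And>i. i < n \<Longrightarrow> g i \<in> carrier P \<and> p (g i) = f (unit_vec R i)" by metis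
  obtain h where h: "mhom R (free_module R n) P h" "\<And>i. i < n \<Longrightarrow> h (unit_vec R i) = g i"
    using free_lift[OF P, of n g] g by blast
  have "p (h v) = f v" if "v \<in> carrier (free_module R n)" for v
    by (rule mhom_free_eqI[OF Q mhom_compose[OF h(1) p] f _ that]) (use h g in auto)
  with h that show ?thesis by blast
qed

text \<open>The map sends u to g of any \<beta>-preimage of \<alpha> u; the kernel condition makes
  the choice of the preimage immaterial. With \<alpha> the identity it factors \<open>g\<close>
  through a surjection \<beta>. Freeness is not involved, which suits sources that are free over the
  quotient ring but not over \<open>R\<close>.\<close>

lemma mhom_factor:
  assumes X: "module R X" and W: "module R W" and Y: "module R Y" and Q: "module R Q"
    and \<alpha>: "mhom R X Y \<alpha>" and \<beta>: "mhom R W Y \<beta>" and g: "mhom R W Q g"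
    and sub: "\<And>u. u \<in> carrier X \<Longrightarrow> \<alpha> u \<in> \<beta> ` carrier W"
    and ker: "\<And>w. w \<in> carrier W \<Longrightarrow> \<beta> w = \<zero>\<^bsub>Y\<^esub> \<Longrightarrow> g w = \<zero>\<^bsub>Q\<^esub>"
  obtains f where "mhom R X Q f"
    "\<And>u w. u \<in> carrier X \<Longrightarrow> w \<in> carrier W \<Longrightarrow> \<beta> w = \<alpha> u \<Longrightarrow> f u = g w"
proof -
  interpret X: module R X by fact
  interpret W: module R W by fact
  interpret Y: module R Y by fact
  interpret Q: module R Q by fact
  have wd: "g w = g w'" if "w \<in> carrier W" "w' \<in> carrier W" "\<beta> w = \<beta> w'" for w w'
  proof -
    have "\<beta> (w \<ominus>\<^bsub>W\<^esub> w') = \<zero>\<^bsub>Y\<^esub>"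
      using that mhom_closed[OF \<beta>] by (simp add: mhom_diff[OF W Y \<beta>] Y.diff_eq_zero_iff)
    then have "g (w \<ominus>\<^bsub>W\<^esub> w') = \<zero>\<^bsub>Q\<^esub>" using ker that by simp
    then show ?thesis using that mhom_closed[OF g] by (simp add: mhom_diff[OF W Q g] Q.diff_eq_zero_iff)
  qed
  define s where "s u = (SOME w. w \<in> carrier W \<and> \<beta> w = \<alpha> u)" for u
  have s: "s u \<in> carrier W" "\<beta> (s u) = \<alpha> u" if "u \<in> carrier X" for u
  proof -
    have "\<exists>w. w \<in> carrier W \<and> \<beta> w = \<alpha> u" using sub[OF that] by auto
    from someI_ex[OF this] show "s u \<in> carrier W" "\<beta> (s u) = \<alpha> u" unfolding s_def by auto
  qed
  have eq: "g (s u) = g w" if "u \<in> carrier X" "w \<in> carrier W" "\<beta> w = \<alpha> u" for u w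
    using wd[OF s(1)[OF that(1)] that(2)] s(2) that by simp
  have "mhom R X Q (\<lambda>u. g (s u))"
  proof (rule mhomI)
    fix u v assume uv: "u \<in> carrier X" "v \<in> carrier X"
    have "g (s (u \<oplus>\<^bsub>X\<^esub> v)) = g (s u \<oplus>\<^bsub>W\<^esub> s v)"
      using uv s by (intro eq) (auto simp: mhom_add[OF \<beta>] mhom_add[OF \<alpha>])
    then show "g (s (u \<oplus>\<^bsub>X\<^esub> v)) = g (s u) \<oplus>\<^bsub>Q\<^esub> g (s v)" using uv s by (simp add: mhom_add[OF g])
  next
    fix a u assume uv: "a \<in> carrier R" "u \<in> carrier X"
    have "g (s (a \<odot>\<^bsub>X\<^esub> u)) = g (a \<odot>\<^bsub>W\<^esub> s u)"
      using uv s by (intro eq) (auto simp: mhom_smult[OF \<beta>] mhom_smult[OF \<alpha>])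
    then show "g (s (a \<odot>\<^bsub>X\<^esub> u)) = a \<odot>\<^bsub>Q\<^esub> g (s u)" using uv s by (simp add: mhom_smult[OF g])
  qed (use s mhom_closed[OF g] in auto)
  then show ?thesis using that eq by blast
qed

lemma mlen_mono: "B' \<subseteq> B \<Longrightarrow> Z \<subseteq> Z' \<Longrightarrow> mlen R M B Z \<le> mlen R M B' Z'"
  unfolding mlen_def by (rule chain_len_mono[of _ "\<lambda>H. H"]) auto

text \<open>Filter Hom(R^n, L) by the maps that vanish on the first j unit vectors: evaluation at
  the next unit vector embeds each factor of this filtration into \<open>L\<close>.\<close>

lemma module_length_hom_free_finite:
  assumes L: "module R L" and fin: "module_length R L \<noteq> \<infinity>"
  shows "module_length R (hom_module R (free_module R n) L) \<noteq> \<infinity>"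
proof -
  interpret L: module R L by fact
  let ?F = "free_module R n"
  let ?C = "hom_module R ?F L"
  interpret F: module R ?F by (rule L.R.module_free_module)
  interpret C: module R ?C by (rule module_hom_module[OF F.module_axioms L])
  define E where "E j = {f \<in> carrier ?C. \<forall>i<j. i < n \<longrightarrow> f (unit_vec R i) = \<zero>\<^bsub>L\<^esub>}" for j
  have ev: "mhom R ?C L (\<lambda>f. f (unit_vec R j))" if "j < n" for j
    using L.R.unit_vec_closed[OF that]
    by (intro mhomI) (auto simp: hom_module_def module_homs_iff
        dest: mhom_closed[of R ?F L _ "unit_vec R j"])
  have z: "f (unit_vec R i) = \<zero>\<^bsub>L\<^esub>" if "f = \<zero>\<^bsub>?C\<^esub>" "i < n" for f i
    using that L.R.unit_vec_closed by (simp add: hom_module_def)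
  have E: "submodule (E j) R ?C" for j
  proof (rule C.submoduleI')
    show "\<zero>\<^bsub>?C\<^esub> \<in> E j" using z by (simp add: E_def)
  qed (auto simp: E_def mhom_add[OF ev] mhom_smult[OF ev])
  have "mlen R ?C (E j) (carrier ?C) \<noteq> \<infinity>" if "j \<le> n" for j using that
  proof (induction j)
    case 0
    have "E 0 = carrier ?C" by (auto simp: E_def)
    then show ?case using C.mlen_refl by simp
  next
    case (Suc j)
    have "mlen R ?C (E (Suc j)) (E j) \<le> mlen R L {\<zero>\<^bsub>L\<^esub>} (carrier L)"
      using Suc.prems L.carrier_is_submodule L.submodule_zero_set mhom_closed[OF ev[of j]]
      by (intro mlen_le_of_semilin[where f = "\<lambda>f. f (unit_vec R j)", OF C.module_axioms L mhom_semilin[OF ev] E])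
         (auto simp: E_def less_Suc_eq)
    then have "mlen R ?C (E (Suc j)) (E j) \<noteq> \<infinity>"
      using fin enat_ord_simps(5) by (metis L.module_length_eq_mlen)
    moreover have "mlen R ?C (E (Suc j)) (carrier ?C) = mlen R ?C (E (Suc j)) (E j) + mlen R ?C (E j) (carrier ?C)"
      by (rule C.mlen_additive[OF E E C.carrier_is_submodule]) (auto simp: E_def)
    ultimately show ?case using Suc by (simp add: plus_eq_infty_iff_enat)
  qed
  from this[of n] have n: "mlen R ?C (E n) (carrier ?C) \<noteq> \<infinity>" by simp
  have "E n = {\<zero>\<^bsub>?C\<^esub>}"
  proof -
    have "f = \<zero>\<^bsub>?C\<^esub>" if "f \<in> E n" for f
    proof (rule extensionalityI)
      show "f \<in> extensional (carrier ?F)" using that by (auto simp: E_def hom_module_def module_homs_iff)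
      show "\<zero>\<^bsub>?C\<^esub> \<in> extensional (carrier ?F)" by (auto simp: hom_module_def)
      have h: "mhom R ?F L f" using that by (auto simp: E_def hom_module_def module_homs_iff)
      fix v assume v: "v \<in> carrier ?F"
      have "f v = \<zero>\<^bsub>L\<^esub>"
        by (rule mhom_free_eqI[OF L h mhom_const_zero[OF L] _ v]) (use that in \<open>auto simp: E_def\<close>)
      then show "f v = \<zero>\<^bsub>?C\<^esub> v" using v by (simp add: hom_module_def)
    qed
    then show ?thesis using C.submodule_zero[OF E] by auto
  qed
  then show ?thesis using n by (simp add: C.module_length_eq_mlen)
qed

section \<open>Noetherian modules\<close>

definition mspan :: "('a, 'r) ring_scheme \<Rightarrow> ('a, 'b, 'm) module_scheme \<Rightarrow> 'b set \<Rightarrow> 'b set" where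
  "mspan R M A = \<Inter>{H. submodule H R M \<and> A \<subseteq> H}"

lemma (in module) submodule_mspan: "A \<subseteq> carrier M \<Longrightarrow> submodule (mspan R M A) R M"
  unfolding mspan_def using carrier_is_submodule by (intro submodule_Inter) auto

lemma mspan_superset: "A \<subseteq> mspan R M A"
  unfolding mspan_def by auto

lemma mspan_least: "submodule H R M \<Longrightarrow> A \<subseteq> H \<Longrightarrow> mspan R M A \<subseteq> H"
  unfolding mspan_def by auto

lemma fin_gen_module_iff:
  "fin_gen_module R M \<longleftrightarrow> module R M \<and> (\<exists>A. finite A \<and> A \<subseteq> carrier M \<and> mspan R M A = carrier M)"
proof (cases "module R M")
  case True
  then interpret module R M .
  have "(\<forall>H. submodule H R M \<and> A \<subseteq> H \<longrightarrow> H = carrier M) \<longleftrightarrow> mspan R M A = carrier M"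
    if "A \<subseteq> carrier M" for A
  proof
    assume "\<forall>H. submodule H R M \<and> A \<subseteq> H \<longrightarrow> H = carrier M"
    then show "mspan R M A = carrier M" using submodule_mspan[OF that] mspan_superset[of A] by blast
  next
    assume *: "mspan R M A = carrier M"
    show "\<forall>H. submodule H R M \<and> A \<subseteq> H \<longrightarrow> H = carrier M"
      using mspan_least[of _ R M A] * submoduleE(1) by (metis subset_antisym)
  qed
  then show ?thesis unfolding fin_gen_module_def by (metis (no_types, lifting))
qed (simp add: fin_gen_module_def)

definition noeth :: "('a, 'r) ring_scheme \<Rightarrow> ('a, 'b, 'm) module_scheme \<Rightarrow> bool" where
  "noeth R M \<longleftrightarrow> (\<forall>H. submodule H R M \<longrightarrow> (\<exists>A. finite A \<and> A \<subseteq> H \<and> H = mspan R M A))"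

lemma (in module) submodule_cyclic:
  assumes "u \<in> carrier M" shows "submodule ((\<lambda>r. r \<odot>\<^bsub>M\<^esub> u) ` carrier R) R M"
proof (rule submoduleI')
  show "\<zero>\<^bsub>M\<^esub> \<in> (\<lambda>r. r \<odot>\<^bsub>M\<^esub> u) ` carrier R" using assms by (intro image_eqI[of _ _ \<zero>]) auto
  show "a \<oplus>\<^bsub>M\<^esub> b \<in> (\<lambda>r. r \<odot>\<^bsub>M\<^esub> u) ` carrier R"
    if "a \<in> (\<lambda>r. r \<odot>\<^bsub>M\<^esub> u) ` carrier R" "b \<in> (\<lambda>r. r \<odot>\<^bsub>M\<^esub> u) ` carrier R" for a b
    using that assms by (auto simp flip: smult_l_distr)
  show "a \<odot>\<^bsub>M\<^esub> b \<in> (\<lambda>r. r \<odot>\<^bsub>M\<^esub> u) ` carrier R"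
    if "a \<in> carrier R" "b \<in> (\<lambda>r. r \<odot>\<^bsub>M\<^esub> u) ` carrier R" for a b
    using that assms by (auto simp flip: smult_assoc1)
qed (use assms in auto)

lemma (in cring) idealI_cring:
  assumes "J \<subseteq> carrier R" "\<zero> \<in> J" and add: "\<And>a b. a \<in> J \<Longrightarrow> b \<in> J \<Longrightarrow> a \<oplus> b \<in> J"
    and mult: "\<And>a r. a \<in> J \<Longrightarrow> r \<in> carrier R \<Longrightarrow> r \<otimes> a \<in> J"
  shows "ideal J R"
proof (rule idealI[OF ring_axioms])
  show "subgroup J (add_monoid R)"
  proof
    fix a assume a: "a \<in> J"
    then have "(\<ominus> \<one>) \<otimes> a \<in> J" using mult by simp
    moreover have "(\<ominus> \<one>) \<otimes> a = \<ominus> a" using a assms(1) by (auto simp: l_minus)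
    ultimately show "inv\<^bsub>add_monoid R\<^esub> a \<in> J" by (simp add: a_inv_def)
  qed (use assms in auto)
qed (use assms m_comm in \<open>auto simp: subset_iff\<close>)

text \<open>The coefficients of \<open>u\<close> that occur in elements of \<open>H\<close>, modulo
  \<open>N\<close>. They play the role of the leading coefficients in Hilbert's basis
  theorem.\<close>

lemma (in module) ideal_coefficients:
  assumes H: "submodule H R M" and N: "submodule N R M" and u: "u \<in> carrier M"
  shows "ideal {r \<in> carrier R. \<exists>s\<in>N. s \<oplus>\<^bsub>M\<^esub> r \<odot>\<^bsub>M\<^esub> u \<in> H} R"
proof (rule R.idealI_cring)
  let ?J = "{r \<in> carrier R. \<exists>s\<in>N. s \<oplus>\<^bsub>M\<^esub> r \<odot>\<^bsub>M\<^esub> u \<in> H}"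
  show "\<zero> \<in> ?J" using submodule_zero[OF H] submodule_zero[OF N] u by (auto intro!: bexI[of _ "\<zero>\<^bsub>M\<^esub>"])
  fix a assume a: "a \<in> ?J"
  then obtain s where s: "s \<in> N" "s \<oplus>\<^bsub>M\<^esub> a \<odot>\<^bsub>M\<^esub> u \<in> H" "a \<in> carrier R" by auto
  have sc: "s \<in> carrier M" using submodule_subset[OF N s(1)] .
  {
    fix b assume "b \<in> ?J"
    then obtain t where t: "t \<in> N" "t \<oplus>\<^bsub>M\<^esub> b \<odot>\<^bsub>M\<^esub> u \<in> H" "b \<in> carrier R" by auto
    have tc: "t \<in> carrier M" using submodule_subset[OF N t(1)] .
    have "(s \<oplus>\<^bsub>M\<^esub> a \<odot>\<^bsub>M\<^esub> u) \<oplus>\<^bsub>M\<^esub> (t \<oplus>\<^bsub>M\<^esub> b \<odot>\<^bsub>M\<^esub> u) = (s \<oplus>\<^bsub>M\<^esub> t) \<oplus>\<^bsub>M\<^esub> (a \<oplus> b) \<odot>\<^bsub>M\<^esub> u"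
      using s t u sc tc by (simp add: smult_l_distr M.a_ac)
    then show "a \<oplus> b \<in> ?J"
      using submoduleE(5)[OF H s(2) t(2)] submoduleE(5)[OF N s(1) t(1)] s(3) t(3) by auto
  }
  fix r assume r: "r \<in> carrier R"
  have "r \<odot>\<^bsub>M\<^esub> (s \<oplus>\<^bsub>M\<^esub> a \<odot>\<^bsub>M\<^esub> u) = r \<odot>\<^bsub>M\<^esub> s \<oplus>\<^bsub>M\<^esub> (r \<otimes> a) \<odot>\<^bsub>M\<^esub> u"
    using s u r sc by (simp add: smult_r_distr smult_assoc1)
  then show "r \<otimes> a \<in> ?J"
    using submoduleE(4)[OF H r s(2)] submoduleE(4)[OF N r s(1)] s(3) r by auto
qed auto

text \<open>Induction on the generators. With \<open>?N\<close> spanned by all but one generator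
  \<open>u\<close>, the part of \<open>H\<close> in \<open>?N\<close> is finitely generated by
  induction, and the ideal of coefficients of \<open>u\<close> because the ring is Noetherian.
  Generators of the first and lifts of generators of the second together generate
  \<open>H\<close>.\<close>

lemma (in module) noeth_of_fin_gen:
  assumes R: "noetherian_ring R" and M: "fin_gen_module R M"
  shows "noeth R M"
proof -
  have fg: "\<exists>B. finite B \<and> B \<subseteq> H \<and> H = mspan R M B"
    if "finite A" "A \<subseteq> carrier M" "submodule H R M" "H \<subseteq> mspan R M A" for A H
    using that
  proof (induction A arbitrary: H rule: finite_induct)
    case empty
    have "mspan R M {} \<subseteq> {\<zero>\<^bsub>M\<^esub>}" by (rule mspan_least[OF submodule_zero_set]) simp
    then have "H = {\<zero>\<^bsub>M\<^esub>}" using empty submodule_zero[OF empty(2)] by auto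
    moreover have "mspan R M {} = {\<zero>\<^bsub>M\<^esub>}"
      using \<open>mspan R M {} \<subseteq> {\<zero>\<^bsub>M\<^esub>}\<close> submodule_zero[OF submodule_mspan[of "{}"]] by auto
    ultimately show ?case by (intro exI[of _ "{}"]) auto
  next
    case (insert u A)
    note H = insert.prems(2)
    let ?N = "mspan R M A"
    have u: "u \<in> carrier M" and A: "A \<subseteq> carrier M" using insert by auto
    have N: "submodule ?N R M" by (rule submodule_mspan[OF A])
    define J where "J K = {r \<in> carrier R. \<exists>s\<in>?N. s \<oplus>\<^bsub>M\<^esub> r \<odot>\<^bsub>M\<^esub> u \<in> K}" for K
    have J: "ideal (J K) R" if "submodule K R M" for K
      unfolding J_def by (rule ideal_coefficients[OF that N u])
    have sub: "mspan R M (insert u A) \<subseteq> ?N <+>\<^bsub>M\<^esub> ((\<lambda>r. r \<odot>\<^bsub>M\<^esub> u) ` carrier R)"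
    proof (rule mspan_least[OF submodule_sum[OF N submodule_cyclic[OF u]]])
      have "u \<in> (\<lambda>r. r \<odot>\<^bsub>M\<^esub> u) ` carrier R" using u by (intro image_eqI[of _ _ \<one>]) auto
      then show "insert u A \<subseteq> ?N <+>\<^bsub>M\<^esub> ((\<lambda>r. r \<odot>\<^bsub>M\<^esub> u) ` carrier R)"
        using set_add_mono1[OF N submodule_cyclic[OF u]] set_add_mono2[OF N submodule_cyclic[OF u]]
          mspan_superset[of A R M] by auto
    qed
    obtain T where T: "T \<subseteq> carrier R" "finite T" "J H = Idl T"
      using noetherian_ring.finetely_gen[OF R J[OF H]] by auto
    have "T \<subseteq> J H" unfolding T(3) by (rule R.genideal_self[OF T(1)])
    then have "\<exists>h\<in>H. \<exists>s\<in>?N. h = s \<oplus>\<^bsub>M\<^esub> t \<odot>\<^bsub>M\<^esub> u" if "t \<in> T" for t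
      using that unfolding J_def by blast
    then obtain h where h: "\<And>t. t \<in> T \<Longrightarrow> h t \<in> H \<and> (\<exists>s\<in>?N. h t = s \<oplus>\<^bsub>M\<^esub> t \<odot>\<^bsub>M\<^esub> u)" by metis
    obtain B where B: "finite B" "B \<subseteq> H \<inter> ?N" "H \<inter> ?N = mspan R M B"
      using insert.IH[OF A submodule_Int[OF H N]] by auto
    let ?B = "h ` T \<union> B"
    let ?K = "mspan R M ?B"
    have Bsub: "?B \<subseteq> H" using h B by auto
    then have Bc: "?B \<subseteq> carrier M" using submodule_subset[OF H] by auto
    have K: "submodule ?K R M" by (rule submodule_mspan[OF Bc])
    have KH: "?K \<subseteq> H" by (rule mspan_least[OF H Bsub])
    have BK: "?B \<subseteq> ?K" by (rule mspan_superset)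
    have "T \<subseteq> J ?K"
    proof
      fix t assume t: "t \<in> T"
      then obtain s where "s \<in> ?N" "h t = s \<oplus>\<^bsub>M\<^esub> t \<odot>\<^bsub>M\<^esub> u" using h by blast
      moreover have "h t \<in> ?K" using t BK by auto
      ultimately show "t \<in> J ?K" using t T(1) unfolding J_def by auto
    qed
    then have JJ: "J H \<subseteq> J ?K" unfolding T(3) by (rule R.genideal_minimal[OF J[OF K]])
    have "H \<inter> ?N \<subseteq> ?K" unfolding B(3) by (rule mspan_least[OF K]) (use BK in auto)
    \<comment> \<open>An element of \<open>H\<close> is compared with one of \<open>?K\<close> that
      has the same coefficient of \<open>u\<close>; the difference lies in
      \<open>H \<inter> ?N\<close>, which \<open>?K\<close> contains.\<close>
    have "H \<subseteq> ?K"
    proof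
      fix w assume w: "w \<in> H"
      then obtain s r where sr: "s \<in> ?N" "r \<in> carrier R" "w = s \<oplus>\<^bsub>M\<^esub> r \<odot>\<^bsub>M\<^esub> u"
        using insert.prems(3) sub by (fastforce simp: mem_set_add)
      then have "r \<in> J H" using w unfolding J_def by auto
      then obtain s' where s': "s' \<in> ?N" "s' \<oplus>\<^bsub>M\<^esub> r \<odot>\<^bsub>M\<^esub> u \<in> ?K" using JJ unfolding J_def by auto
      have c: "s \<in> carrier M" "s' \<in> carrier M" "r \<odot>\<^bsub>M\<^esub> u \<in> carrier M"
        using sr(1,2) s'(1) u submodule_subset[OF N] by auto
      have e: "(s \<ominus>\<^bsub>M\<^esub> s') \<oplus>\<^bsub>M\<^esub> (s' \<oplus>\<^bsub>M\<^esub> r \<odot>\<^bsub>M\<^esub> u) = w"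
      proof -
        have "(s \<ominus>\<^bsub>M\<^esub> s') \<oplus>\<^bsub>M\<^esub> (s' \<oplus>\<^bsub>M\<^esub> r \<odot>\<^bsub>M\<^esub> u) = (s' \<oplus>\<^bsub>M\<^esub> (s \<ominus>\<^bsub>M\<^esub> s')) \<oplus>\<^bsub>M\<^esub> r \<odot>\<^bsub>M\<^esub> u"
          using c by (simp add: M.a_ac)
        then show ?thesis using c sr(3) by (simp add: diff_add_cancel)
      qed
      have "w \<ominus>\<^bsub>M\<^esub> (s' \<oplus>\<^bsub>M\<^esub> r \<odot>\<^bsub>M\<^esub> u) = s \<ominus>\<^bsub>M\<^esub> s'"
        unfolding e[symmetric] using c by (subst M.a_comm) (auto simp: add_diff_cancel)
      moreover have "w \<ominus>\<^bsub>M\<^esub> (s' \<oplus>\<^bsub>M\<^esub> r \<odot>\<^bsub>M\<^esub> u) \<in> H"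
        using submodule_diff[OF H w] s'(2) KH by auto
      ultimately have "s \<ominus>\<^bsub>M\<^esub> s' \<in> ?K"
        using \<open>H \<inter> ?N \<subseteq> ?K\<close> submodule_diff[OF N sr(1) s'(1)] by auto
      then show "w \<in> ?K" using submoduleE(5)[OF K _ s'(2)] e by metis
    qed
    then have "H = ?K" using KH by auto
    moreover have "finite ?B" using T(2) B(1) by auto
    ultimately show ?case using Bsub by blast
  qed
  obtain A where "finite A" "A \<subseteq> carrier M" "mspan R M A = carrier M"
    using M by (auto simp: fin_gen_module_iff)
  then show ?thesis unfolding noeth_def using fg submoduleE(1) by metis
qed

text \<open>Zorn's lemma applies because the union of a chain is finitely generated: one member of
  the chain contains the generators and so equals the union.\<close>

lemma (in module) noeth_maximal:
  assumes n: "noeth R M" and ne: "\<F> \<noteq> {}" and sub: "\<And>H. H \<in> \<F> \<Longrightarrow> submodule H R M"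
  obtains K where "K \<in> \<F>" "\<And>H. H \<in> \<F> \<Longrightarrow> K \<subseteq> H \<Longrightarrow> H = K"
proof -
  have "\<exists>K\<in>\<F>. \<forall>X\<in>\<F>. K \<subseteq> X \<longrightarrow> X = K"
  proof (rule subset_Zorn_nonempty[OF ne])
    fix C assume C: "C \<noteq> {}" "subset.chain \<F> C"
    then have CF: "C \<subseteq> \<F>" and ch: "\<And>X Y. X \<in> C \<Longrightarrow> Y \<in> C \<Longrightarrow> X \<subseteq> Y \<or> Y \<subseteq> X"
      unfolding subset_chain_def by auto
    have s: "submodule X R M" if "X \<in> C" for X using that CF sub by auto
    have "submodule (\<Union>C) R M"
    proof (rule submoduleI')
      show "\<Union>C \<subseteq> carrier M" using s submodule_subset by blast
      show "\<zero>\<^bsub>M\<^esub> \<in> \<Union>C" using C(1) s submodule_zero by blast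
      show "a \<oplus>\<^bsub>M\<^esub> b \<in> \<Union>C" if ab: "a \<in> \<Union>C" "b \<in> \<Union>C" for a b
      proof -
        obtain X Y where XY: "a \<in> X" "b \<in> Y" "X \<in> C" "Y \<in> C" using ab by auto
        then consider "a \<in> Y" | "b \<in> X" using ch by blast
        then show ?thesis using XY submoduleE(5)[OF s] by cases blast+
      qed
      show "a \<odot>\<^bsub>M\<^esub> u \<in> \<Union>C" if "a \<in> carrier R" "u \<in> \<Union>C" for a u
        using that submoduleE(4)[OF s] by blast
    qed
    then obtain A where A: "finite A" "A \<subseteq> \<Union>C" "\<Union>C = mspan R M A" using n unfolding noeth_def by metis
    obtain X where X: "X \<in> C" "A \<subseteq> X"
      using finite_subset_Union_chain[OF A(1,2) C(1) C(2)] by auto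
    have "\<Union>C \<subseteq> X" unfolding A(3) by (rule mspan_least[OF s[OF X(1)] X(2)])
    then have "\<Union>C = X" using X by auto
    then show "\<Union>C \<in> \<F>" using X CF by auto
  qed
  then show ?thesis using that by blast
qed

text \<open>Carries results on modules, such as \<open>noeth_maximal\<close> and later
  \<open>associated_prime\<close>, over to ideals.\<close>

lemma (in cring) submodule_self_module_iff: "submodule H R (self_module R) \<longleftrightarrow> ideal H R"
proof
  interpret S: module R "self_module R" by (rule module_self_module)
  assume H: "submodule H R (self_module R)"
  show "ideal H R"
    using S.submodule_subset[OF H] S.submodule_zero[OF H] S.submoduleE(4,5)[OF H]
    by (intro idealI_cring) (auto simp: self_module_def)
next
  interpret S: module R "self_module R" by (rule module_self_module)
  assume "ideal H R"
  then interpret H: ideal H R .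
  show "submodule H R (self_module R)"
    using H.Icarr H.I_l_closed by (intro S.submoduleI') (auto simp: self_module_def)
qed

lemma (in cring) fin_gen_self_module: "fin_gen_module R (self_module R)"
proof -
  interpret S: module R "self_module R" by (rule module_self_module)
  have "mspan R (self_module R) {\<one>} = carrier (self_module R)"
  proof -
    have s: "submodule (mspan R (self_module R) {\<one>}) R (self_module R)"
      by (rule S.submodule_mspan) (auto simp: self_module_def)
    have "r \<in> mspan R (self_module R) {\<one>}" if r: "r \<in> carrier R" for r
      using S.submoduleE(4)[OF s r, of \<one>] mspan_superset[of "{\<one>}" R "self_module R"] r
      by (simp add: self_module_def)
    then show ?thesis using S.submodule_subset[OF s] by (auto simp: self_module_def)
  qed
  then show ?thesis unfolding fin_gen_module_iff using S.module_axioms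
    by (intro conjI exI[of _ "{\<one>}"]) (auto simp: self_module_def)
qed

lemma (in cring) noeth_self_module: "noetherian_ring R \<Longrightarrow> noeth R (self_module R)"
  by (rule module.noeth_of_fin_gen[OF module_self_module _ fin_gen_self_module])

lemma (in cring) ideal_maximal:
  assumes "noetherian_ring R" "\<F> \<noteq> {}" "\<And>H. H \<in> \<F> \<Longrightarrow> ideal H R"
  obtains K where "K \<in> \<F>" "\<And>H. H \<in> \<F> \<Longrightarrow> K \<subseteq> H \<Longrightarrow> H = K"
  using module.noeth_maximal[OF module_self_module noeth_self_module[OF assms(1)] assms(2)] assms(3)
  unfolding submodule_self_module_iff by blast

text \<open>The projection onto the quotient by the span of the unit vectors agrees with the zero
  map on them, hence everywhere. This avoids expanding a vector as a finite sum.\<close>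

lemma (in cring) fin_gen_free_module: "fin_gen_module R (free_module R n)"
proof -
  let ?F = "free_module R n" and ?A = "unit_vec R ` {..<n}"
  interpret F: module R ?F by (rule module_free_module)
  have A: "?A \<subseteq> carrier ?F" using unit_vec_closed by auto
  let ?H = "mspan R ?F ?A"
  have H: "submodule ?H R ?F" by (rule F.submodule_mspan[OF A])
  interpret Q: module R "fact_module ?F ?H" by (rule F.module_fact_module[OF H])
  have "v \<in> ?H" if v: "v \<in> carrier ?F" for v
  proof -
    have "?H +>\<^bsub>?F\<^esub> v = \<zero>\<^bsub>fact_module ?F ?H\<^esub>"
    proof (rule mhom_free_eqI[OF Q.module_axioms F.mhom_coset[OF H] mhom_const_zero[OF Q.module_axioms] _ v])
      show "?H +>\<^bsub>?F\<^esub> unit_vec R i = \<zero>\<^bsub>fact_module ?F ?H\<^esub>" if "i < n" for i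
        using that mspan_superset[of ?A R ?F] unit_vec_closed[OF that]
        by (auto simp: zero_fact_module F.coset_eq_zero_iff[OF H])
    qed
    then show ?thesis using v by (simp add: zero_fact_module F.coset_eq_zero_iff[OF H])
  qed
  then have "?H = carrier ?F" using F.submodule_subset[OF H] by blast
  then show ?thesis unfolding fin_gen_module_iff using F.module_axioms A by blast
qed

lemma noeth_free_cover:
  assumes M: "module R M" and n: "noeth R M" and H: "submodule H R M"
  obtains b h where "h \<in> module_homs R (free_module R b) M" "h ` carrier (free_module R b) = H"
proof -
  interpret module R M by fact
  obtain A where A: "finite A" "A \<subseteq> H" "H = mspan R M A" using n H unfolding noeth_def by metis
  obtain gs where gs: "set gs = A" using finite_list[OF A(1)] by auto
  let ?F = "free_module R (length gs)"
  interpret F: module R ?F by (rule R.module_free_module)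
  have gc: "gs ! i \<in> carrier M" if "i < length gs" for i
    using nth_mem[OF that] gs A(2) submodule_subset[OF H] by blast
  obtain h where h: "mhom R ?F M h" "\<And>i. i < length gs \<Longrightarrow> h (unit_vec R i) = gs ! i"
    using free_lift[OF M, of "length gs" "\<lambda>i. gs ! i"] gc by auto
  have "h ` carrier ?F \<subseteq> H"
  proof -
    have "carrier ?F \<subseteq> {v \<in> carrier ?F. h v \<in> H}"
    proof -
      have s: "submodule {v \<in> carrier ?F. h v \<in> H} R ?F"
        by (rule submodule_vimage[OF F.module_axioms M h(1) H])
      interpret Q: module R "fact_module M H" by (rule module_fact_module[OF H])
      have "h v \<in> H" if v: "v \<in> carrier ?F" for v
      proof -
        \<comment> \<open>The composite into M/H vanishes on the unit vectors, whose images are the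
          generators in \<open>H\<close>; so it vanishes altogether and \<open>h\<close> has its
          values in \<open>H\<close>.\<close>
        have "H +>\<^bsub>M\<^esub> h v = \<zero>\<^bsub>fact_module M H\<^esub>"
        proof (rule mhom_free_eqI[OF Q.module_axioms mhom_compose[OF h(1) mhom_coset[OF H]]
              mhom_const_zero[OF Q.module_axioms] _ v])
          show "H +>\<^bsub>M\<^esub> h (unit_vec R i) = \<zero>\<^bsub>fact_module M H\<^esub>" if "i < length gs" for i
            using that gs A(2) gc[OF that] by (auto simp: h(2) zero_fact_module coset_eq_zero_iff[OF H])
        qed
        then show ?thesis using mhom_closed[OF h(1) v] by (simp add: zero_fact_module coset_eq_zero_iff[OF H])
      qed
      then show ?thesis by auto
    qed
    then show ?thesis by auto
  qed
  moreover have "H \<subseteq> h ` carrier ?F" unfolding A(3)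
  proof (rule mspan_least[OF submodule_image[OF F.module_axioms M h(1) F.carrier_is_submodule]])
    show "A \<subseteq> h ` carrier ?F"
      using gs h(2) R.unit_vec_closed by (metis (no_types, lifting) imageI in_set_conv_nth subsetI)
  qed
  ultimately have "restrict h (carrier ?F) ` carrier ?F = H" by auto
  moreover have "restrict h (carrier ?F) \<in> module_homs R ?F M"
    using h(1) mhom_restrict[OF F.module_axioms] by (auto simp: module_homs_iff)
  ultimately show ?thesis using that by blast
qed

lemma mhom_kernel_submodule:
  assumes "module R M" "module R N" "mhom R M N f"
  shows "submodule {u \<in> carrier M. f u = \<zero>\<^bsub>N\<^esub>} R M"
  using submodule_vimage[OF assms module.submodule_zero_set[OF assms(2)]] by simp

lemma free_resolution_exists:
  assumes R: "noetherian_ring R" and M: "fin_gen_module R M"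
  shows "\<exists>b \<delta> \<pi>. free_resolution R M b \<delta> \<pi>"
proof -
  interpret M: module R M using M by (simp add: fin_gen_module_def)
  let ?F = "free_module R"
  have F: "module R (?F n)" for n by (rule M.R.module_free_module)
  have nF: "noeth R (?F n)" for n by (rule module.noeth_of_fin_gen[OF F R M.R.fin_gen_free_module])
  obtain b0 \<pi> where \<pi>: "\<pi> \<in> module_homs R (?F b0) M" "\<pi> ` carrier (?F b0) = carrier M"
    by (rule noeth_free_cover[OF M.module_axioms M.noeth_of_fin_gen[OF R M] M.carrier_is_submodule])
  \<comment> \<open>A triple (m, k, f) stands for a map from R^m to R^k. \<open>P\<close> anchors
    the first map at the kernel of \<pi>; \<open>Q\<close> is exactness between consecutive maps and
    makes their ranks fit.\<close>
  define P where "P n x \<longleftrightarrow> (case x of (m, k, f) \<Rightarrow> f \<in> module_homs R (?F m) (?F k) \<and>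
      (n = 0 \<longrightarrow> k = b0 \<and> f ` carrier (?F m) = {v \<in> carrier (?F b0). \<pi> v = \<zero>\<^bsub>M\<^esub>}))"
    for n :: nat and x :: "nat \<times> nat \<times> ((nat \<Rightarrow> 'a) \<Rightarrow> (nat \<Rightarrow> 'a))"
  define Q where "Q x y \<longleftrightarrow> (case x of (m, k, f) \<Rightarrow> case y of (m', k', f') \<Rightarrow> k' = m \<and>
      f' ` carrier (?F m') = {v \<in> carrier (?F m). f v = \<zero>\<^bsub>?F k\<^esub>})"
    for x y :: "nat \<times> nat \<times> ((nat \<Rightarrow> 'a) \<Rightarrow> (nat \<Rightarrow> 'a))"
  have "\<exists>f. \<forall>n. P n (f n) \<and> Q (f n) (f (Suc n))"
  proof (rule dependent_nat_choice)
    have "mhom R (?F b0) M \<pi>" using \<pi> by (simp add: module_homs_iff)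
    note s = mhom_kernel_submodule[OF F M.module_axioms this]
    obtain m f where
      "f \<in> module_homs R (?F m) (?F b0)" "f ` carrier (?F m) = {v \<in> carrier (?F b0). \<pi> v = \<zero>\<^bsub>M\<^esub>}"
      by (rule noeth_free_cover[OF F nF s])
    then show "\<exists>x. P 0 x" unfolding P_def by (intro exI[of _ "(m, b0, f)"]) auto
  next
    fix x n assume "P n x"
    obtain m k f where x: "x = (m, k, f)" by (cases x)
    have f: "f \<in> module_homs R (?F m) (?F k)" using \<open>P n x\<close> unfolding P_def x by simp
    have "mhom R (?F m) (?F k) f" using f by (simp add: module_homs_iff)
    note s = mhom_kernel_submodule[OF F F this]
    obtain m' f' where
      "f' \<in> module_homs R (?F m') (?F m)" "f' ` carrier (?F m') = {v \<in> carrier (?F m). f v = \<zero>\<^bsub>?F k\<^esub>}"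
      by (rule noeth_free_cover[OF F nF s])
    then show "\<exists>y. P (Suc n) y \<and> Q x y" unfolding P_def Q_def x by (intro exI[of _ "(m', m, f')"]) auto
  qed
  then obtain s where s: "\<And>n. P n (s n)" "\<And>n. Q (s n) (s (Suc n))" by blast
  define b where "b n = fst (snd (s n))" for n
  define \<delta> where "\<delta> n = snd (snd (s n))" for n
  have bS: "fst (s n) = b (Suc n)" for n
    using s(2)[of n] unfolding Q_def b_def by (simp split: prod.splits)
  have s_eq: "s n = (b (Suc n), b n, \<delta> n)" for n
    by (simp add: bS[symmetric]) (simp add: b_def \<delta>_def)
  have "free_resolution R M b \<delta> \<pi>"
    unfolding free_resolution_def
  proof (intro conjI allI)
    show "\<delta> i \<in> module_homs R (?F (b (Suc i))) (?F (b i))" for i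
      using s(1)[of i] unfolding P_def s_eq by simp
    have b0: "b 0 = b0" using s(1)[of 0] unfolding P_def s_eq by simp
    show "\<pi> \<in> module_homs R (?F (b 0)) M" "\<pi> ` carrier (?F (b 0)) = carrier M"
      using \<pi> b0 by simp_all
    show "\<delta> 0 ` carrier (?F (b 1)) = {v \<in> carrier (?F (b 0)). \<pi> v = \<zero>\<^bsub>M\<^esub>}"
      using s(1)[of 0] unfolding P_def s_eq by simp
    show "\<delta> (Suc i) ` carrier (?F (b (Suc (Suc i)))) =
        {v \<in> carrier (?F (b (Suc i))). \<delta> i v = \<zero>\<^bsub>?F (b i)\<^esub>}" for i
      using s(2)[of i] unfolding Q_def s_eq by simp
  qed
  then show ?thesis by blast
qed

text \<open>The augmentation is not part of the chosen pair; it is recovered as a witness and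
  becomes a parameter of the locale \<open>resolved\<close>.\<close>

lemma chosen_resolution_is_resolution:
  assumes "noetherian_ring R" "fin_gen_module R M"
  obtains \<pi> where "free_resolution R M (fst (chosen_resolution R M)) (snd (chosen_resolution R M)) \<pi>"
proof -
  obtain b \<delta> \<pi> where "free_resolution R M b \<delta> \<pi>" using free_resolution_exists[OF assms] by blast
  then have "\<exists>r. case r of (b, \<delta>) \<Rightarrow> \<exists>\<pi>. free_resolution R M b \<delta> \<pi>" by auto
  from someI_ex[OF this] have "case chosen_resolution R M of (b, \<delta>) \<Rightarrow> \<exists>\<pi>. free_resolution R M b \<delta> \<pi>"
    unfolding chosen_resolution_def .
  then have "\<exists>\<pi>. free_resolution R M (fst (chosen_resolution R M)) (snd (chosen_resolution R M)) \<pi>"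
    by (cases "chosen_resolution R M") simp
  then show ?thesis by (rule exE) (rule that)
qed

section \<open>Powers of ideals\<close>

lemma ideals_set_simps [simp]: "one (ideals_set R) = carrier R" "mult (ideals_set R) = ideal_prod R"
  by (simp_all add: ideals_set_def)

lemma ideal_pow_0: "ideal_pow R I 0 = carrier R"
  by (simp add: nat_pow_def ideals_set_def)

lemma ideal_pow_Suc: "ideal_pow R I (Suc n) = ideal_prod R (ideal_pow R I n) I"
  by (simp add: nat_pow_def ideals_set_def)

lemma (in cring) ideal_ideal_pow: "ideal I R \<Longrightarrow> ideal (ideal_pow R I n) R"
  by (induction n) (simp_all add: ideal_pow_0 ideal_pow_Suc oneideal ideal_prod_is_ideal)

lemma (in cring) pow_mem_ideal_pow:
  assumes "ideal I R" "a \<in> I" shows "a [^] (n::nat) \<in> ideal_pow R I n"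
proof (induction n)
  case (Suc n)
  then show ?case using assms(2) by (auto simp: ideal_pow_Suc intro: ideal_prod.prod)
qed (simp add: ideal_pow_0)

lemma (in module) ideal_smult_closed:
  assumes "A \<subseteq> carrier R" "u \<in> ideal_smult A M" shows "u \<in> carrier M"
  using assms(2) by induction (use assms(1) in auto)

lemma (in module) submodule_ideal_smult:
  assumes "ideal A R" shows "submodule (ideal_smult A M) R M"
proof -
  interpret A: ideal A R by fact
  have A: "A \<subseteq> carrier R" using A.Icarr by auto
  show ?thesis
  proof (rule submoduleI')
    show "\<zero>\<^bsub>M\<^esub> \<in> ideal_smult A M"
      using ideal_smult.smult[of \<zero> A "\<zero>\<^bsub>M\<^esub>" M] A.zero_closed by simp
    fix a u assume a: "a \<in> carrier R" and "u \<in> ideal_smult A M"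
    from this(2) show "a \<odot>\<^bsub>M\<^esub> u \<in> ideal_smult A M"
    proof induction
      case (smult b u)
      have "(a \<otimes> b) \<odot>\<^bsub>M\<^esub> u \<in> ideal_smult A M"
        using smult a A.I_l_closed by (intro ideal_smult.smult) auto
      then show ?case using smult a A by (auto simp: smult_assoc1)
    next
      case (sum u v)
      then show ?case using a ideal_smult_closed[OF A]
        by (simp add: smult_r_distr ideal_smult.sum)
    qed
  qed (use ideal_smult_closed[OF A] ideal_smult.sum in auto)
qed

lemma (in module) ideal_smult_least:
  assumes K: "submodule K R M" and "\<And>a u. a \<in> A \<Longrightarrow> u \<in> carrier M \<Longrightarrow> a \<odot>\<^bsub>M\<^esub> u \<in> K"
  shows "ideal_smult A M \<subseteq> K"
proof
  fix u assume "u \<in> ideal_smult A M"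
  then show "u \<in> K" by induction (use assms submoduleE(5)[OF K] in auto)
qed

lemma (in module) submodule_pow_smult: "ideal I R \<Longrightarrow> submodule (pow_smult R I n M) R M"
  by (intro submodule_ideal_smult R.ideal_ideal_pow)

lemma (in module) pow_smult_step:
  assumes I: "ideal I R" and a: "a \<in> I" and u: "u \<in> pow_smult R I n M"
  shows "a \<odot>\<^bsub>M\<^esub> u \<in> pow_smult R I (Suc n) M"
  using u
proof induction
  interpret I: ideal I R by fact
  interpret P: ideal "ideal_pow R I n" R by (rule R.ideal_ideal_pow[OF I])
  case (smult b v)
  have "(b \<otimes> a) \<odot>\<^bsub>M\<^esub> v \<in> pow_smult R I (Suc n) M"
    unfolding ideal_pow_Suc using smult a by (intro ideal_smult.smult ideal_prod.prod)
  then show ?case using smult a I.Icarr P.Icarr by (simp add: R.m_comm flip: smult_assoc1)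
next
  interpret I: ideal I R by fact
  interpret P: ideal "ideal_pow R I n" R by (rule R.ideal_ideal_pow[OF I])
  have c: "u \<in> carrier M" if "u \<in> pow_smult R I n M" for u
    by (rule submodule_subset[OF submodule_pow_smult[OF I] that])
  case (sum u v)
  then show ?case using I.Icarr[OF a] c by (simp add: smult_r_distr ideal_smult.sum)
qed

text \<open>I^(n+1) M is generated by the products of \<open>I\<close> with I^n M: commutativity
  moves the factor from \<open>I\<close> to the front of a product in I^n I.\<close>

lemma (in module) pow_smult_Suc_least:
  assumes I: "ideal I R" and K: "submodule K R M"
    and step: "\<And>a u. a \<in> I \<Longrightarrow> u \<in> pow_smult R I n M \<Longrightarrow> a \<odot>\<^bsub>M\<^esub> u \<in> K"
  shows "pow_smult R I (Suc n) M \<subseteq> K"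
proof (rule ideal_smult_least[OF K])
  interpret I: ideal I R by fact
  interpret P: ideal "ideal_pow R I n" R by (rule R.ideal_ideal_pow[OF I])
  interpret PS: ideal "ideal_pow R I (Suc n)" R by (rule R.ideal_ideal_pow[OF I])
  fix a u assume "a \<in> ideal_pow R I (Suc n)" and u: "u \<in> carrier M"
  then have "a \<in> ideal_prod R (ideal_pow R I n) I" by (simp add: ideal_pow_Suc)
  then have "a \<in> carrier R \<and> a \<odot>\<^bsub>M\<^esub> u \<in> K"
  proof induction
    case (prod i j)
    then have c: "i \<in> carrier R" "j \<in> carrier R" using I.Icarr P.Icarr by auto
    have "j \<odot>\<^bsub>M\<^esub> (i \<odot>\<^bsub>M\<^esub> u) \<in> K" using prod u by (intro step ideal_smult.smult)
    then show ?case using c u by (simp add: R.m_comm flip: smult_assoc1)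
  next
    case (sum s t)
    then show ?case using u submoduleE(5)[OF K] by (simp add: smult_l_distr)
  qed
  then show "a \<odot>\<^bsub>M\<^esub> u \<in> K" by simp
qed

lemma (in module) pow_smult_antimono:
  assumes I: "ideal I R" and "n \<le> k" shows "pow_smult R I k M \<subseteq> pow_smult R I n M"
  using assms(2)
proof (induction k rule: dec_induct)
  case (step k)
  interpret I: ideal I R by fact
  have "pow_smult R I (Suc k) M \<subseteq> pow_smult R I k M"
    by (rule pow_smult_Suc_least[OF I submodule_pow_smult[OF I]])
       (use submoduleE(4)[OF submodule_pow_smult[OF I]] I.Icarr in blast)
  then show ?case using step by auto
qed simp

section \<open>Associated primes, Nakayama's lemma and Krull's intersection theorem\<close>

text \<open>The annihilator of the class of \<open>u\<close> in M/H. The primes of this form are the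
  associated primes of M/H.\<close>

definition colon :: "('a, 'r) ring_scheme \<Rightarrow> ('a, 'b, 'm) module_scheme \<Rightarrow> 'b set \<Rightarrow> 'b \<Rightarrow> 'a set" where
  "colon R M H u = {r \<in> carrier R. r \<odot>\<^bsub>M\<^esub> u \<in> H}"

lemma (in module) ideal_colon:
  assumes H: "submodule H R M" and u: "u \<in> carrier M" shows "ideal (colon R M H u) R"
  unfolding colon_def using u submodule_zero[OF H] submoduleE(4,5)[OF H]
  by (intro R.idealI_cring) (auto simp: smult_l_distr smult_assoc1)

text \<open>A maximal member (H : w) of the family is prime: if b lies outside it, then (H : bw)
  contains it and is again a member, so the two agree, and ab in (H : w) means a in (H :
  bw).\<close>

lemma (in module) associated_prime:
  assumes R: "noetherian_ring R" and H: "submodule H R M" and v: "v \<in> carrier M" "v \<notin> H"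
  obtains w where "w \<in> carrier M" "w \<notin> H" "primeideal (colon R M H w) R" "colon R M H v \<subseteq> colon R M H w"
proof -
  let ?\<F> = "{colon R M H w |w. w \<in> carrier M \<and> w \<notin> H \<and> colon R M H v \<subseteq> colon R M H w}"
  have ne: "?\<F> \<noteq> {}" using v by auto
  obtain p where p: "p \<in> ?\<F>" "\<And>q. q \<in> ?\<F> \<Longrightarrow> p \<subseteq> q \<Longrightarrow> q = p"
    by (rule R.ideal_maximal[OF R ne]) (use ideal_colon[OF H] in auto)
  then obtain w where w: "p = colon R M H w" "w \<in> carrier M" "w \<notin> H" "colon R M H v \<subseteq> colon R M H w" by auto
  have "primeideal p R"
  proof (rule primeidealI[OF _ R.cring_axioms])
    show "ideal p R" unfolding w(1) by (rule ideal_colon[OF H w(2)])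
    have "\<one> \<notin> p" using w by (simp add: colon_def)
    then show "carrier R \<noteq> p" by auto
    fix a b assume ab: "a \<in> carrier R" "b \<in> carrier R" "a \<otimes> b \<in> p"
    show "a \<in> p \<or> b \<in> p"
    proof (rule disjCI)
      assume "b \<notin> p"
      then have bw: "b \<odot>\<^bsub>M\<^esub> w \<notin> H" "b \<odot>\<^bsub>M\<^esub> w \<in> carrier M" using ab w by (auto simp: colon_def)
      have "colon R M H w \<subseteq> colon R M H (b \<odot>\<^bsub>M\<^esub> w)"
      proof
        fix r assume r: "r \<in> colon R M H w"
        then have "b \<odot>\<^bsub>M\<^esub> (r \<odot>\<^bsub>M\<^esub> w) \<in> H" using submoduleE(4)[OF H ab(2)] by (simp add: colon_def)
        then show "r \<in> colon R M H (b \<odot>\<^bsub>M\<^esub> w)" using r ab w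
          by (simp add: colon_def R.m_comm flip: smult_assoc1)
      qed
      then have "colon R M H (b \<odot>\<^bsub>M\<^esub> w) = p" using p(2)[of "colon R M H (b \<odot>\<^bsub>M\<^esub> w)"] bw w by blast
      moreover have "a \<in> colon R M H (b \<odot>\<^bsub>M\<^esub> w)" using ab w by (simp add: colon_def smult_assoc1)
      ultimately show "a \<in> p" by simp
    qed
  qed
  then show ?thesis using that w by simp
qed

lemma (in primeideal) pow_mem_imp_mem:
  assumes "a \<in> carrier R" "a [^] (k::nat) \<in> I" shows "a \<in> I"
  using assms(2)
proof (induction k)
  case 0
  then show ?case using one_imp_carrier I_notcarr by simp
next
  case (Suc k)
  then show ?case using I_prime[of "a [^] k" a] assms(1) by auto
qed

text \<open>The ideals (A : I^n) ascend, so they stop at some n. If (A : I^n) were proper, its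
  quotient ring would have an associated prime, the annihilator of some w. This prime contains
  \<open>I\<close> because it contains powers of all its elements; then Iw lies in (A : I^n), so w
  lies in (A : I^(n+1)) = (A : I^n), a contradiction.\<close>

lemma (in cring) ideal_pow_subset_of_radical:
  assumes R: "noetherian_ring R" and I: "ideal I R" and A: "ideal A R"
    and rad: "\<And>a. a \<in> I \<Longrightarrow> \<exists>k::nat. a [^] k \<in> A"
  obtains n where "ideal_pow R I n \<subseteq> A"
proof -
  interpret A: ideal A R by fact
  interpret I: ideal I R by fact
  interpret S: module R "self_module R" by (rule module_self_module)
  have Pc: "s \<in> carrier R" if "s \<in> ideal_pow R I n" for s n
    using ideal.Icarr[OF ideal_ideal_pow[OF I] that] .
  define B where "B n = {r \<in> carrier R. \<forall>s\<in>ideal_pow R I n. r \<otimes> s \<in> A}" for n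
  have B: "ideal (B n) R" for n
  proof (rule idealI_cring)
    fix a b assume "a \<in> B n" "b \<in> B n"
    then show "a \<oplus> b \<in> B n" using Pc by (auto simp: B_def l_distr)
  next
    fix a r assume "a \<in> B n" "r \<in> carrier R"
    then show "r \<otimes> a \<in> B n" using Pc A.I_l_closed by (auto simp: B_def m_assoc)
  qed (use Pc in \<open>auto simp: B_def\<close>)
  obtain K where K: "K \<in> range B" "\<And>H. H \<in> range B \<Longrightarrow> K \<subseteq> H \<Longrightarrow> H = K"
    by (rule ideal_maximal[OF R, of "range B"]) (use B in auto)
  then obtain n where n: "K = B n" by auto
  have "\<one> \<in> B n"
  proof (rule ccontr)
    assume "\<one> \<notin> B n"
    have sB: "submodule (B n) R (self_module R)" using B by (simp add: submodule_self_module_iff)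
    obtain w where w: "w \<in> carrier (self_module R)" "w \<notin> B n" "primeideal (colon R (self_module R) (B n) w) R"
      by (rule S.associated_prime[OF R sB, of \<one>]) (use \<open>\<one> \<notin> B n\<close> in \<open>auto simp: self_module_def\<close>)
    have wc: "w \<in> carrier R" using w(1) by (simp add: self_module_def)
    have Iw: "a \<otimes> w \<in> B n" if a: "a \<in> I" for a
    proof -
      have ac: "a \<in> carrier R" using I.Icarr[OF a] .
      obtain k :: nat where "a [^] k \<in> A" using rad[OF a] by auto
      then have "a [^] k \<in> colon R (self_module R) (B n) w"
        using ac wc Pc A.I_r_closed by (auto simp: colon_def B_def self_module_def)
      then have "a \<in> colon R (self_module R) (B n) w" by (rule primeideal.pow_mem_imp_mem[OF w(3) ac])
      then show ?thesis by (simp add: colon_def self_module_def)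
    qed
    have "w \<otimes> s \<in> A" if "s \<in> ideal_pow R I (Suc n)" for s
      using that unfolding ideal_pow_Suc
    proof induction
      case (prod i j)
      then have "(j \<otimes> w) \<otimes> i \<in> A" using Iw[of j] by (auto simp: B_def)
      moreover have "w \<otimes> (i \<otimes> j) = (j \<otimes> w) \<otimes> i" using wc Pc[OF prod(1)] I.Icarr[OF prod(2)] by (simp add: m_ac)
      ultimately show ?case by simp
    next
      case (sum s t)
      have "s \<in> carrier R" "t \<in> carrier R" using sum(1,2) Pc[of _ "Suc n"] by (auto simp: ideal_pow_Suc)
      then show ?case using sum wc by (simp add: r_distr)
    qed
    then have "w \<in> B (Suc n)" using wc by (simp add: B_def)
    moreover have "B n \<subseteq> B (Suc n)"
    proof -
      have "ideal_pow R I (Suc n) \<subseteq> ideal_pow R I n"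
        unfolding ideal_pow_Suc using ideal_prod_inter[OF ideal_ideal_pow[OF I] I] by auto
      then show ?thesis by (auto simp: B_def)
    qed
    ultimately show False using K(2)[of "B (Suc n)"] n w(2) by auto
  qed
  then have "ideal_pow R I n \<subseteq> A" using Pc by (auto simp: B_def)
  then show ?thesis by (rule that)
qed

text \<open>This weak form of the Artin-Rees lemma is the elementary part of Krull's intersection theorem:
  \<open>K\<close> is chosen maximal subject to \<open>K \<inter> N = L\<close>, and then some power of \<open>I\<close> maps \<open>M\<close> into \<open>K\<close>.\<close>

lemma (in module) weak_artin_rees:
  assumes R: "noetherian_ring R" and n: "noeth R M" and I: "ideal I R"
    and N: "submodule N R M" and L: "submodule L R M" and LN: "L \<subseteq> N"
    and c: "\<And>a u. a \<in> ideal_pow R I c \<Longrightarrow> u \<in> N \<Longrightarrow> a \<odot>\<^bsub>M\<^esub> u \<in> L"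
  obtains n where "pow_smult R I n M \<inter> N \<subseteq> L"
proof -
  interpret I: ideal I R by fact
  let ?\<F> = "{K. submodule K R M \<and> K \<inter> N = L}"
  have ne: "?\<F> \<noteq> {}" using L LN by auto
  obtain K where K': "K \<in> ?\<F>" "\<And>H. H \<in> ?\<F> \<Longrightarrow> K \<subseteq> H \<Longrightarrow> H = K"
    by (rule noeth_maximal[OF n ne]) auto
  then have K: "submodule K R M" "K \<inter> N = L" by auto
  define A where "A = {r \<in> carrier R. \<forall>u\<in>carrier M. r \<odot>\<^bsub>M\<^esub> u \<in> K}"
  have A: "ideal A R"
    using submodule_zero[OF K(1)] submoduleE(4,5)[OF K(1)]
    by (intro R.idealI_cring) (auto simp: A_def smult_l_distr smult_assoc1)
  have rad: "\<exists>k::nat. a [^] k \<in> A" if a: "a \<in> I" for a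
  proof -
    have ac: "a \<in> carrier R" using I.Icarr[OF a] .
    define C where "C k = {u \<in> carrier M. a [^] (k::nat) \<odot>\<^bsub>M\<^esub> u \<in> K}" for k
    have C: "submodule (C k) R M" for k
      unfolding C_def using ac by (intro submodule_vimage[OF module_axioms module_axioms _ K(1)]
          mhom_smult_fun[OF module_axioms mhom_ident]) auto
    obtain H where H: "H \<in> range C" "\<And>H'. H' \<in> range C \<Longrightarrow> H \<subseteq> H' \<Longrightarrow> H' = H"
      by (rule noeth_maximal[OF n, of "range C"]) (use C in auto)
    then obtain k where k: "H = C k" by auto
    have "C k \<subseteq> C (c + k)"
    proof
      fix u assume u: "u \<in> C k"
      then have "a [^] c \<odot>\<^bsub>M\<^esub> (a [^] k \<odot>\<^bsub>M\<^esub> u) \<in> K" using submoduleE(4)[OF K(1)] ac by (simp add: C_def)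
      then show "u \<in> C (c + k)" using u ac by (simp add: C_def R.nat_pow_mult flip: smult_assoc1)
    qed
    \<comment> \<open>The submodules (K : a^k) ascend and have stopped at \<open>k\<close>. The
      shift is by the given \<open>c\<close> since a^c carries \<open>N\<close> into
      \<open>L\<close>.\<close>
    then have Ck: "C (c + k) = C k" using H(2)[of "C (c + k)"] k by auto
    let ?aM = "(\<lambda>u. a [^] k \<odot>\<^bsub>M\<^esub> u) ` carrier M"
    have aM: "submodule ?aM R M" using ac by (intro submodule_smult_image) simp
    \<comment> \<open>If \<kappa> + a^k u lies in \<open>N\<close>, multiplying by a^c shows that
      a^(c+k) u lies in \<open>K\<close>, hence a^k u does by the choice of \<open>k\<close>, and
      the element lies in K \<inter> N = L. Maximality of \<open>K\<close> then forces a^k M into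
      \<open>K\<close>.\<close>
    have "(K <+>\<^bsub>M\<^esub> ?aM) \<inter> N \<subseteq> L"
    proof
      fix y assume y: "y \<in> (K <+>\<^bsub>M\<^esub> ?aM) \<inter> N"
      then obtain \<kappa> u where u: "\<kappa> \<in> K" "u \<in> carrier M" "y = \<kappa> \<oplus>\<^bsub>M\<^esub> a [^] k \<odot>\<^bsub>M\<^esub> u" by (auto simp: mem_set_add)
      have \<kappa>: "\<kappa> \<in> carrier M" by (rule submodule_subset[OF K(1) u(1)])
      have "a [^] c \<odot>\<^bsub>M\<^esub> y \<in> L" using c[OF R.pow_mem_ideal_pow[OF I a]] y by auto
      then have "a [^] c \<odot>\<^bsub>M\<^esub> y \<in> K" using K(2) by auto
      moreover have "a [^] c \<odot>\<^bsub>M\<^esub> \<kappa> \<in> K" using submoduleE(4)[OF K(1)] u(1) ac by simp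
      ultimately have "a [^] c \<odot>\<^bsub>M\<^esub> y \<ominus>\<^bsub>M\<^esub> a [^] c \<odot>\<^bsub>M\<^esub> \<kappa> \<in> K" by (rule submodule_diff[OF K(1)])
      moreover have "a [^] c \<odot>\<^bsub>M\<^esub> y = a [^] c \<odot>\<^bsub>M\<^esub> \<kappa> \<oplus>\<^bsub>M\<^esub> a [^] (c + k) \<odot>\<^bsub>M\<^esub> u"
        using u \<kappa> ac by (simp add: smult_r_distr smult_assoc1 flip: R.nat_pow_mult)
      ultimately have "a [^] (c + k) \<odot>\<^bsub>M\<^esub> u \<in> K" using u \<kappa> ac by (simp add: add_diff_cancel)
      then have "u \<in> C k" using u by (simp add: Ck[symmetric]) (simp add: C_def)
      then have "y \<in> K" using u submoduleE(5)[OF K(1)] by (simp add: C_def)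
      then show "y \<in> L" using y K(2) by auto
    qed
    moreover have "L \<subseteq> K <+>\<^bsub>M\<^esub> ?aM" using set_add_mono1[OF K(1) aM] K(2) by auto
    ultimately have "K <+>\<^bsub>M\<^esub> ?aM \<in> ?\<F>" using submodule_sum[OF K(1) aM] LN by auto
    then have "K <+>\<^bsub>M\<^esub> ?aM = K" using K'(2) set_add_mono1[OF K(1) aM] by auto
    then have "?aM \<subseteq> K" using set_add_mono2[OF K(1) aM] by auto
    then have "a [^] k \<in> A" using ac by (auto simp: A_def)
    then show ?thesis ..
  qed
  obtain n where n: "ideal_pow R I n \<subseteq> A" by (rule R.ideal_pow_subset_of_radical[OF R I A rad])
  have "pow_smult R I n M \<subseteq> K"
    by (rule ideal_smult_least[OF K(1)]) (use n in \<open>auto simp: A_def\<close>)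
  then have "pow_smult R I n M \<inter> N \<subseteq> L" using K(2) by auto
  then show ?thesis by (rule that)
qed

section \<open>Local rings: Nakayama's lemma and Krull's intersection theorem\<close>

context noetherian_local_ring
begin

text \<open>An ideal maximal among those that contain a nonunit \<open>a\<close> and omit 1 is a
  maximal ideal, hence \<mm>.\<close>

lemma unit_of_notin:
  assumes a: "a \<in> carrier R" "a \<notin> \<mm>" shows "a \<in> Units R"
proof (rule ccontr)
  assume nu: "a \<notin> Units R"
  let ?\<F> = "{J. ideal J R \<and> a \<in> J \<and> \<one> \<notin> J}"
  have "\<one> \<notin> PIdl a"
  proof
    assume "\<one> \<in> PIdl a"
    then obtain r where "r \<in> carrier R" "\<one> = r \<otimes> a" by (auto simp: cgenideal_def)
    then show False using nu a by (auto simp: Units_def m_comm)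
  qed
  then have "PIdl a \<in> ?\<F>" using cgenideal_ideal[OF a(1)] cgenideal_self[OF a(1)] by auto
  then have ne: "?\<F> \<noteq> {}" by auto
  obtain J where J: "J \<in> ?\<F>" "\<And>H. H \<in> ?\<F> \<Longrightarrow> J \<subseteq> H \<Longrightarrow> H = J"
    by (rule ideal_maximal[OF noetherian_ring_axioms ne]) auto
  have "maximalideal J R"
  proof (rule maximalidealI)
    show "ideal J R" using J by auto
    show "carrier R \<noteq> J" using J by auto
    fix H assume H: "ideal H R" "J \<subseteq> H" "H \<subseteq> carrier R"
    show "H = J \<or> H = carrier R"
      using J(2)[of H] H J(1) ideal.one_imp_carrier[OF H(1)] by auto
  qed
  then have "J = \<mm>" by (rule unique_maximal)
  then show False using J a by auto
qed

lemma ideal_\<mm>: "ideal \<mm> R"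
  using maximal by (rule maximalideal.axioms)

lemma one_notin_\<mm>: "\<one> \<notin> \<mm>"
  using maximal ideal.one_imp_carrier[OF ideal_\<mm>] maximalideal.I_notcarr by blast

lemma unit_one_minus:
  assumes "y \<in> \<mm>" shows "\<one> \<ominus> y \<in> Units R"
proof (rule unit_of_notin)
  interpret \<mm>: ideal \<mm> R by (rule ideal_\<mm>)
  have y: "y \<in> carrier R" using \<mm>.Icarr[OF assms] .
  then show "\<one> \<ominus> y \<in> carrier R" by simp
  have "(\<one> \<ominus> y) \<oplus> y = \<one>" using y by (simp add: minus_eq a_assoc l_neg)
  then show "\<one> \<ominus> y \<notin> \<mm>" using one_notin_\<mm> \<mm>.a_closed[OF _ assms] by metis
qed

text \<open>The last hypothesis says U = N + YU without forming the product. If \<open>K\<close> is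
  maximal among the proper submodules of \<open>U\<close> above \<open>N\<close> and y u lies
  outside it, then U = K + R y u, so u = k + r y u, and the unit 1 - r y puts u into
  \<open>K\<close>.\<close>

lemma nakayama:
  assumes M: "module R M" and n: "noeth R M" and U: "submodule U R M" and N: "submodule N R M"
    and NU: "N \<subseteq> U" and Y: "Y \<subseteq> \<mm>"
    and gen: "\<And>K. submodule K R M \<Longrightarrow> N \<subseteq> K \<Longrightarrow> (\<And>y u. y \<in> Y \<Longrightarrow> u \<in> U \<Longrightarrow> y \<odot>\<^bsub>M\<^esub> u \<in> K) \<Longrightarrow> U \<subseteq> K"
  shows "U = N"
proof (rule ccontr)
  interpret M: module R M by fact
  interpret \<mm>: ideal \<mm> R by (rule ideal_\<mm>)
  assume "U \<noteq> N"
  let ?\<F> = "{K. submodule K R M \<and> N \<subseteq> K \<and> K \<subset> U}"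
  have ne: "?\<F> \<noteq> {}" using N NU \<open>U \<noteq> N\<close> by auto
  obtain K where K': "K \<in> ?\<F>" "\<And>H. H \<in> ?\<F> \<Longrightarrow> K \<subseteq> H \<Longrightarrow> H = K"
    by (rule M.noeth_maximal[OF n ne]) auto
  then have K: "submodule K R M" "N \<subseteq> K" "K \<subset> U" by auto
  have "y \<odot>\<^bsub>M\<^esub> u \<in> K" if y: "y \<in> Y" and u: "u \<in> U" for y u
  proof (rule ccontr)
    assume nK: "y \<odot>\<^bsub>M\<^esub> u \<notin> K"
    have yc: "y \<in> carrier R" "y \<in> \<mm>" using y Y \<mm>.Icarr by auto
    have uc: "u \<in> carrier M" using M.submodule_subset[OF U u] .
    let ?C = "(\<lambda>r. r \<odot>\<^bsub>M\<^esub> (y \<odot>\<^bsub>M\<^esub> u)) ` carrier R"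
    have C: "submodule ?C R M" using yc uc by (intro M.submodule_cyclic) simp
    have yuU: "y \<odot>\<^bsub>M\<^esub> u \<in> U" using M.submoduleE(4)[OF U] yc u by simp
    have "?C \<subseteq> U" using M.submoduleE(4)[OF U _ yuU] by auto
    then have sU: "K <+>\<^bsub>M\<^esub> ?C \<subseteq> U" using M.set_add_least[OF U] K by auto
    have "\<one> \<odot>\<^bsub>M\<^esub> (y \<odot>\<^bsub>M\<^esub> u) \<in> ?C" by (rule imageI) simp
    then have "y \<odot>\<^bsub>M\<^esub> u \<in> ?C" using yc uc by simp
    then have yus: "y \<odot>\<^bsub>M\<^esub> u \<in> K <+>\<^bsub>M\<^esub> ?C" using M.set_add_mono2[OF K(1) C] by auto
    have "K <+>\<^bsub>M\<^esub> ?C \<notin> ?\<F>" using K'(2)[of "K <+>\<^bsub>M\<^esub> ?C"] M.set_add_mono1[OF K(1) C] yus nK by auto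
    then have "K <+>\<^bsub>M\<^esub> ?C = U"
      using sU M.submodule_sum[OF K(1) C] M.set_add_mono1[OF K(1) C] K(2) by auto
    then have "u \<in> K <+>\<^bsub>M\<^esub> ?C" using u by simp
    then obtain k r where kr: "k \<in> K" "r \<in> carrier R" "u = k \<oplus>\<^bsub>M\<^esub> r \<odot>\<^bsub>M\<^esub> (y \<odot>\<^bsub>M\<^esub> u)"
      unfolding mem_set_add by blast
    have kc: "k \<in> carrier M" by (rule M.submodule_subset[OF K(1) kr(1)])
    have "(\<one> \<ominus> r \<otimes> y) \<odot>\<^bsub>M\<^esub> u = u \<ominus>\<^bsub>M\<^esub> r \<odot>\<^bsub>M\<^esub> (y \<odot>\<^bsub>M\<^esub> u)"
      using kr(2) yc uc by (simp add: M.smult_diff_l M.smult_assoc1)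
    also have "\<dots> = k"
      using M.add_diff_cancel[of k "r \<odot>\<^bsub>M\<^esub> (y \<odot>\<^bsub>M\<^esub> u)"] kr(2,3) kc yc uc by (simp add: M.M.a_comm)
    finally have e: "(\<one> \<ominus> r \<otimes> y) \<odot>\<^bsub>M\<^esub> u = k" .
    have unit: "\<one> \<ominus> r \<otimes> y \<in> Units R"
      by (rule unit_one_minus) (use \<mm>.I_l_closed[OF yc(2) kr(2)] in simp)
    have "inv (\<one> \<ominus> r \<otimes> y) \<odot>\<^bsub>M\<^esub> k = u"
      using unit uc unfolding e[symmetric] by (simp add: Units_closed flip: M.smult_assoc1)
    then have "u \<in> K" using M.submoduleE(4)[OF K(1) _ kr(1)] unit by (metis Units_inv_closed)
    then show False using nK M.submoduleE(4)[OF K(1) yc(1)] by simp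
  qed
  then have "U \<subseteq> K" by (rule gen[OF K(1,2)])
  then show False using K by auto
qed

text \<open>For the intersection \<open>N\<close> of all I^n M, the weak Artin-Rees lemma with
  exponent 1 and L = IN gives N = IN, and Nakayama's lemma gives N = 0.\<close>

lemma krull_intersection:
  assumes M: "module R M" and n: "noeth R M" and I: "ideal I R" and Im: "I \<subseteq> \<mm>"
    and u: "\<And>n. n \<ge> c \<Longrightarrow> u \<in> pow_smult R I n M"
  shows "u = \<zero>\<^bsub>M\<^esub>"
proof -
  interpret M: module R M by fact
  let ?P = "\<lambda>n. pow_smult R I n M"
  have P: "submodule (?P n) R M" for n by (rule M.submodule_pow_smult[OF I])
  define N where "N = (\<Inter>n. ?P n)"
  have N: "submodule N R M" unfolding N_def by (rule M.submodule_Inter) (use P in auto)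
  let ?A = "{a \<odot>\<^bsub>M\<^esub> v |a v. a \<in> I \<and> v \<in> N}"
  define L where "L = mspan R M ?A"
  have AN: "?A \<subseteq> N" using M.submoduleE(4)[OF N] ideal.Icarr[OF I] by auto
  have Ac: "?A \<subseteq> carrier M" using AN M.submodule_subset[OF N] by blast
  have L: "submodule L R M" unfolding L_def by (rule M.submodule_mspan[OF Ac])
  have LN: "L \<subseteq> N" unfolding L_def by (rule mspan_least[OF N AN])
  have AL: "?A \<subseteq> L" unfolding L_def by (rule mspan_superset)
  have I1: "ideal_pow R I 1 \<subseteq> I"
    using ideal_prod_inter[OF oneideal I] ideal_pow_Suc[of R I 0] by (simp add: ideal_pow_0)
  obtain k where "?P k \<inter> N \<subseteq> L"
  proof (rule M.weak_artin_rees[OF noetherian_ring_axioms n I N L LN, of 1])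
    fix a v assume "a \<in> ideal_pow R I 1" "v \<in> N"
    then show "a \<odot>\<^bsub>M\<^esub> v \<in> L" using I1 AL by blast
  qed
  then have "N \<subseteq> L" by (auto simp: N_def)
  have "N = {\<zero>\<^bsub>M\<^esub>}"
  proof (rule nakayama[OF M n N M.submodule_zero_set _ Im])
    show "{\<zero>\<^bsub>M\<^esub>} \<subseteq> N" using M.submodule_zero[OF N] by simp
    fix K assume K: "submodule K R M" "{\<zero>\<^bsub>M\<^esub>} \<subseteq> K" "\<And>y u. y \<in> I \<Longrightarrow> u \<in> N \<Longrightarrow> y \<odot>\<^bsub>M\<^esub> u \<in> K"
    have "L \<subseteq> K" unfolding L_def by (rule mspan_least[OF K(1)]) (use K(3) in auto)
    then show "N \<subseteq> K" using \<open>N \<subseteq> L\<close> by auto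
  qed
  moreover have "u \<in> ?P n" for n
    using u[of "max n c"] M.pow_smult_antimono[OF I, of n "max n c"] by auto
  ultimately show ?thesis by (auto simp: N_def)
qed

end

section \<open>Regular elements\<close>

definition regular_on :: "('a, 'b, 'm) module_scheme \<Rightarrow> 'a \<Rightarrow> bool" where
  "regular_on M x \<longleftrightarrow> (\<forall>u\<in>carrier M. x \<odot>\<^bsub>M\<^esub> u = \<zero>\<^bsub>M\<^esub> \<longrightarrow> u = \<zero>\<^bsub>M\<^esub>)"

lemma (in module) regular_on_pow:
  assumes "y \<in> carrier R" "regular_on M y" shows "regular_on M (y [^] (k::nat))"
proof (induction k)
  case (Suc k)
  show ?case unfolding regular_on_def
  proof (intro ballI impI)
    fix u assume u: "u \<in> carrier M" "y [^] Suc k \<odot>\<^bsub>M\<^esub> u = \<zero>\<^bsub>M\<^esub>"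
    then have "y [^] k \<odot>\<^bsub>M\<^esub> (y \<odot>\<^bsub>M\<^esub> u) = \<zero>\<^bsub>M\<^esub>" using assms(1) by (simp add: smult_assoc1)
    then have "y \<odot>\<^bsub>M\<^esub> u = \<zero>\<^bsub>M\<^esub>" using Suc u(1) assms(1) unfolding regular_on_def by blast
    then show "u = \<zero>\<^bsub>M\<^esub>" using assms(2) u(1) unfolding regular_on_def by blast
  qed
qed (simp add: regular_on_def)

lemma (in module) regular_on_cancel:
  assumes "y \<in> carrier R" "regular_on M y" "u \<in> carrier M" "v \<in> carrier M" "y \<odot>\<^bsub>M\<^esub> u = y \<odot>\<^bsub>M\<^esub> v"
  shows "u = v"
proof -
  have "y \<odot>\<^bsub>M\<^esub> (u \<ominus>\<^bsub>M\<^esub> v) = \<zero>\<^bsub>M\<^esub>" using assms by (simp add: smult_diff_r diff_eq_zero_iff)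
  then have "u \<ominus>\<^bsub>M\<^esub> v = \<zero>\<^bsub>M\<^esub>" using assms(2-4) unfolding regular_on_def by simp
  then show ?thesis using assms(3,4) by (simp add: diff_eq_zero_iff)
qed

lemma (in module) ideal_smult_Idl_empty: "ideal_smult (Idl\<^bsub>R\<^esub> {}) M = {\<zero>\<^bsub>M\<^esub>}"
proof -
  have "Idl\<^bsub>R\<^esub> {} \<subseteq> {\<zero>}" by (rule R.genideal_minimal[OF R.zeroideal]) simp
  then have "ideal_smult (Idl\<^bsub>R\<^esub> {}) M \<subseteq> {\<zero>\<^bsub>M\<^esub>}"
    by (intro ideal_smult_least[OF submodule_zero_set]) auto
  then show ?thesis using submodule_zero[OF submodule_ideal_smult[OF R.genideal_ideal[of "{}"]]] by auto
qed

text \<open>A supremum over no sequences would be 0, so \<open>d \<ge> 1\<close> provides one. The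
  zero module shows the danger: for it even the empty sequence fails the properness clause.\<close>

lemma depth_attained:
  assumes "depth R \<mm> M = enat d" "d \<ge> 1"
  obtains xs where "length xs = d" "set xs \<subseteq> \<mm>" "regular_sequence R M xs"
proof -
  let ?A = "{enat (length xs) |xs. set xs \<subseteq> \<mm> \<and> regular_sequence R M xs}"
  have "?A \<noteq> {}"
  proof
    assume "?A = {}"
    then have "depth R \<mm> M = 0" by (simp only: depth_def \<open>?A = {}\<close> Sup_empty bot_enat_def)
    then show False using assms by (simp add: zero_enat_def)
  qed
  from Sup_enat_attained[OF this assms(1)[unfolded depth_def]] that show ?thesis by auto
qed

lemma (in module) regular_sequence_hd:
  assumes "regular_sequence R M xs" "0 < length xs" shows "regular_on M (xs ! 0)"
  using assms ideal_smult_Idl_empty unfolding regular_sequence_def regular_on_def by force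

context noetherian_local_ring
begin

text \<open>Along a regular sequence, an associated prime can be enlarged strictly at every step:
  \<open>\<pp> = (N : u)\<close> with \<open>N = (x\<^sub>1, \<dots>, x\<^sub>k)M\<close> is contained in an associated prime of
  \<open>M/(N + x\<^sub>k\<^sub>+\<^sub>1M)\<close>, because by Nakayama's lemma \<open>\<pp>\<close> kills an element outside \<open>N + x\<^sub>k\<^sub>+\<^sub>1M\<close>.\<close>

lemma prime_chain_of_regular_sequence:
  assumes M: "module R M" and n: "noeth R M" and xs: "regular_sequence R M xs" "set xs \<subseteq> \<mm>"
    and p: "primeideal p R" "p = colon R M {\<zero>\<^bsub>M\<^esub>} u" "u \<in> carrier M"
  shows "\<exists>P. P 0 = p \<and> (\<forall>i\<le>length xs. primeideal (P i) R) \<and> (\<forall>i<length xs. P i \<subset> P (Suc i))"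
proof -
  interpret M: module R M by fact
  interpret \<mm>: ideal \<mm> R by (rule ideal_\<mm>)
  define T where "T k = set (take k xs)" for k
  define N where "N k = ideal_smult (Idl (T k)) M" for k
  have Tc: "T k \<subseteq> carrier R" for k using xs(2) \<mm>.Icarr set_take_subset[of k xs] by (auto simp: T_def)
  have iT: "ideal (Idl (T k)) R" for k by (rule genideal_ideal[OF Tc])
  have N: "submodule (N k) R M" for k unfolding N_def by (rule M.submodule_ideal_smult[OF iT])
  \<comment> \<open>Besides the chain, an element whose annihilator modulo \<open>N k\<close> is the
    last prime is carried along; it changes at every step.\<close>
  have "\<exists>P u. P 0 = p \<and> (\<forall>i\<le>k. primeideal (P i) R) \<and> (\<forall>i<k. P i \<subset> P (Suc i)) \<and>
      u \<in> carrier M \<and> P k = colon R M (N k) u" if "k \<le> length xs" for k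
    using that
  proof (induction k)
    case 0
    have "N 0 = {\<zero>\<^bsub>M\<^esub>}" by (simp add: N_def T_def M.ideal_smult_Idl_empty)
    then show ?case using p by (intro exI[of _ "\<lambda>_. p"] exI[of _ u]) auto
  next
    case (Suc k)
    then obtain P u where P: "P 0 = p" "\<forall>i\<le>k. primeideal (P i) R" "\<forall>i<k. P i \<subset> P (Suc i)"
      "u \<in> carrier M" "P k = colon R M (N k) u" by auto
    define y where "y = xs ! k"
    have TS: "T (Suc k) = insert y (T k)"
      using Suc.prems by (simp add: T_def take_Suc_conv_app_nth y_def)
    have "y \<in> set xs" using Suc.prems by (simp add: y_def)
    then have y: "y \<in> \<mm>" "y \<in> carrier R" using xs(2) \<mm>.Icarr by auto
    have reg: "v \<in> N k" if "v \<in> carrier M" "y \<odot>\<^bsub>M\<^esub> v \<in> N k" for v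
      using xs(1) Suc.prems that unfolding regular_sequence_def N_def T_def y_def by auto
    have IdS: "Idl (T k) \<subseteq> Idl (T (Suc k))" "y \<in> Idl (T (Suc k))"
      using genideal_self[OF Tc[of "Suc k"]] genideal_minimal[OF iT[of "Suc k"], of "T k"] by (auto simp: TS)
    have NN: "N k \<subseteq> N (Suc k)" unfolding N_def[of k]
    proof (rule M.ideal_smult_least[OF N])
      fix a v assume "a \<in> Idl (T k)" "v \<in> carrier M"
      then show "a \<odot>\<^bsub>M\<^esub> v \<in> N (Suc k)" unfolding N_def using IdS by (intro ideal_smult.smult) auto
    qed
    have yN: "y \<odot>\<^bsub>M\<^esub> v \<in> N (Suc k)" if "v \<in> carrier M" for v
      unfolding N_def using IdS(2) that by (rule ideal_smult.smult)
    let ?yM = "(\<lambda>v. y \<odot>\<^bsub>M\<^esub> v) ` carrier M"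
    have yM: "submodule ?yM R M" by (rule M.submodule_smult_image[OF y(2)])
    note S = M.submodule_sum[OF N yM, of k]
    \<comment> \<open>The scalars that carry \<open>M\<close> into N k + yM form an ideal, and it
      contains the generators \<open>T (Suc k)\<close>.\<close>
    have Nsub: "N (Suc k) \<subseteq> N k <+>\<^bsub>M\<^esub> ?yM"
    proof -
      let ?A = "{a \<in> carrier R. \<forall>v\<in>carrier M. a \<odot>\<^bsub>M\<^esub> v \<in> N k <+>\<^bsub>M\<^esub> ?yM}"
      have "ideal ?A R"
        using M.submodule_zero[OF S] M.submoduleE(4,5)[OF S]
        by (intro idealI_cring) (auto simp: M.smult_l_distr M.smult_assoc1)
      moreover have "T (Suc k) \<subseteq> ?A"
      proof
        fix a assume a: "a \<in> T (Suc k)"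
        have ac: "a \<in> carrier R" using a Tc by auto
        have "a \<odot>\<^bsub>M\<^esub> v \<in> N k <+>\<^bsub>M\<^esub> ?yM" if v: "v \<in> carrier M" for v
        proof (cases "a = y")
          case True
          then show ?thesis using M.set_add_mono2[OF N yM, of k] v by auto
        next
          case False
          then have "a \<in> Idl (T k)" using a genideal_self[OF Tc[of k]] by (auto simp: TS)
          then have "a \<odot>\<^bsub>M\<^esub> v \<in> N k" unfolding N_def using v by (rule ideal_smult.smult)
          then show ?thesis using M.set_add_mono1[OF N yM, of k] by auto
        qed
        then show "a \<in> ?A" using ac by auto
      qed
      ultimately have "Idl (T (Suc k)) \<subseteq> ?A" by (rule genideal_minimal)
      then show ?thesis unfolding N_def[of "Suc k"] by (intro M.ideal_smult_least[OF S]) auto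
    qed
    interpret P: primeideal "P k" R using P(2) by simp
    \<comment> \<open>The elements killed by \<open>P k\<close> modulo \<open>N k\<close>;
      \<open>u\<close> is one of them and lies outside \<open>N k\<close>.\<close>
    define U where "U = {v \<in> carrier M. \<forall>a\<in>P k. a \<odot>\<^bsub>M\<^esub> v \<in> N k}"
    have U: "submodule U R M"
    proof (rule M.submoduleI')
      fix a v assume av: "a \<in> carrier R" "v \<in> U"
      have "b \<odot>\<^bsub>M\<^esub> (a \<odot>\<^bsub>M\<^esub> v) \<in> N k" if b: "b \<in> P k" for b
      proof -
        have "a \<odot>\<^bsub>M\<^esub> (b \<odot>\<^bsub>M\<^esub> v) \<in> N k" using av b M.submoduleE(4)[OF N] by (auto simp: U_def)
        then show ?thesis using av P.Icarr[OF b] by (simp add: U_def m_comm flip: M.smult_assoc1)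
      qed
      then show "a \<odot>\<^bsub>M\<^esub> v \<in> U" using av by (auto simp: U_def)
    qed (use P.Icarr M.submodule_zero[OF N] M.submoduleE(5)[OF N] in \<open>auto simp: U_def M.smult_r_distr\<close>)
    have NU: "N k \<subseteq> U"
    proof
      fix v assume "v \<in> N k"
      then show "v \<in> U"
        unfolding U_def using M.submodule_subset[OF N] M.submoduleE(4)[OF N P.Icarr] by blast
    qed
    have uU: "u \<in> U" unfolding U_def P(5) colon_def using P(4) by simp
    have uN: "u \<notin> N k"
    proof
      assume uk: "u \<in> N k"
      have "\<one> \<odot>\<^bsub>M\<^esub> u = u" by (rule M.smult_one[OF P(4)])
      then have "\<one> \<in> P k" unfolding P(5) colon_def using uk one_closed by simp
      from P.one_imp_carrier[OF this] show False using P.I_notcarr by blast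
    qed
    \<comment> \<open>Otherwise every v in \<open>U\<close> is m + y w with m in \<open>N k\<close>,
      and regularity of y modulo \<open>N k\<close> puts w into \<open>U\<close> again. Then U = N k
      + yU, and Nakayama's lemma yields U = N k, against \<open>u\<close>.\<close>
    have "\<not> U \<subseteq> N (Suc k)"
    proof
      assume sub: "U \<subseteq> N (Suc k)"
      have "U = N k"
      proof (rule nakayama[OF M n U N NU, of "{y}"])
        fix K assume K: "submodule K R M" "N k \<subseteq> K" "\<And>z v. z \<in> {y} \<Longrightarrow> v \<in> U \<Longrightarrow> z \<odot>\<^bsub>M\<^esub> v \<in> K"
        show "U \<subseteq> K"
        proof
          fix v assume v: "v \<in> U"
          then have "v \<in> N k <+>\<^bsub>M\<^esub> ?yM" using sub Nsub by blast
          then obtain m w where mw: "m \<in> N k" "w \<in> carrier M" "v = m \<oplus>\<^bsub>M\<^esub> y \<odot>\<^bsub>M\<^esub> w" by (auto simp: mem_set_add)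
          have mc: "m \<in> carrier M" by (rule M.submodule_subset[OF N mw(1)])
          have "a \<odot>\<^bsub>M\<^esub> w \<in> N k" if a: "a \<in> P k" for a
          proof (rule reg)
            have ac: "a \<in> carrier R" by (rule P.Icarr[OF a])
            show "a \<odot>\<^bsub>M\<^esub> w \<in> carrier M" using ac mw(2) by simp
            have "a \<odot>\<^bsub>M\<^esub> v \<in> N k" using v a by (auto simp: U_def)
            moreover have "a \<odot>\<^bsub>M\<^esub> m \<in> N k" using M.submoduleE(4)[OF N ac mw(1)] .
            ultimately have "a \<odot>\<^bsub>M\<^esub> v \<ominus>\<^bsub>M\<^esub> a \<odot>\<^bsub>M\<^esub> m \<in> N k" by (rule M.submodule_diff[OF N])
            moreover have "a \<odot>\<^bsub>M\<^esub> v \<ominus>\<^bsub>M\<^esub> a \<odot>\<^bsub>M\<^esub> m = a \<odot>\<^bsub>M\<^esub> (y \<odot>\<^bsub>M\<^esub> w)"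
              using ac mw mc y by (simp add: M.smult_r_distr M.add_diff_cancel)
            ultimately show "y \<odot>\<^bsub>M\<^esub> (a \<odot>\<^bsub>M\<^esub> w) \<in> N k"
              using ac y mw by (simp add: m_comm flip: M.smult_assoc1)
          qed
          then have "w \<in> U" using mw by (simp add: U_def)
          then show "v \<in> K" using K mw M.submoduleE(5)[OF K(1)] by auto
        qed
      qed (use y in auto)
      then show False using uU uN by simp
    qed
    then obtain v where v: "v \<in> U" "v \<notin> N (Suc k)" by auto
    have vc: "v \<in> carrier M" by (rule M.submodule_subset[OF U v(1)])
    obtain w where w: "w \<in> carrier M" "w \<notin> N (Suc k)" "primeideal (colon R M (N (Suc k)) w) R"
      "colon R M (N (Suc k)) v \<subseteq> colon R M (N (Suc k)) w"
      by (rule M.associated_prime[OF noetherian_ring_axioms N vc v(2)])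
    let ?q = "colon R M (N (Suc k)) w"
    have "P k \<subseteq> ?q"
    proof
      fix a assume a: "a \<in> P k"
      then have "a \<odot>\<^bsub>M\<^esub> v \<in> N (Suc k)" using v(1) NN unfolding U_def by blast
      then have "a \<in> colon R M (N (Suc k)) v" unfolding colon_def using P.Icarr[OF a] by blast
      then show "a \<in> ?q" using w(4) by blast
    qed
    \<comment> \<open>\<open>y\<close> witnesses strictness: it kills \<open>M\<close> modulo
      \<open>N (Suc k)\<close>, but it is regular modulo \<open>N k\<close> and so does not kill
      \<open>u\<close> there.\<close>
    moreover have "y \<in> ?q" unfolding colon_def using yN[OF w(1)] y(2) by simp
    moreover have "y \<notin> P k" unfolding P(5) colon_def using reg[OF P(4)] uN by blast
    ultimately have "P k \<subset> ?q" by blast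
    then show ?case using P(1-3) w(1,3)
      by (intro exI[of _ "P(Suc k := ?q)"] exI[of _ w]) (simp add: le_Suc_eq less_Suc_eq all_conj_distrib)
  qed
  from this[of "length xs"] show ?thesis by blast
qed

text \<open>An ideal maximal among those avoiding the products \<open>s x\<^sup>k\<close> with \<open>s \<notin> p\<close> is a prime strictly
  below \<open>p\<close>.\<close>

lemma prime_below:
  assumes p: "primeideal p R" and x: "x \<in> p"
    and reg: "\<And>r. r \<in> carrier R \<Longrightarrow> x \<otimes> r = \<zero> \<Longrightarrow> r = \<zero>"
  obtains q where "primeideal q R" "q \<subset> p"
proof -
  interpret p: primeideal p R by fact
  have xc: "x \<in> carrier R" by (rule p.Icarr[OF x])
  \<comment> \<open>This set is closed under products, avoids zero because \<open>x\<close> is no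
    zero divisor, and contains both the complement of \<open>p\<close> (exponent 0) and
    \<open>x\<close> itself (s = 1). The last two facts put \<open>q\<close> inside \<open>p\<close>
    and leave \<open>x\<close> outside \<open>q\<close>.\<close>
  define T where "T = {s \<otimes> x [^] (k::nat) |s k. s \<in> carrier R \<and> s \<notin> p}"
  have regk: "r = \<zero>" if "r \<in> carrier R" "r \<otimes> x [^] (k::nat) = \<zero>" for r k
    using that
  proof (induction k arbitrary: r)
    case (Suc k)
    have "x \<otimes> (r \<otimes> x [^] k) = r \<otimes> x [^] Suc k" using xc Suc.prems(1) by (simp add: m_ac)
    also have "\<dots> = \<zero>" by (rule Suc.prems(2))
    finally have "r \<otimes> x [^] k = \<zero>" by (rule reg[rotated]) (use xc Suc.prems(1) in simp)
    with Suc.prems(1) show ?case by (rule Suc.IH)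
  qed simp
  have T0: "\<zero> \<notin> T"
  proof
    assume "\<zero> \<in> T"
    then obtain s and k :: nat where s: "\<zero> = s \<otimes> x [^] k" "s \<in> carrier R" "s \<notin> p"
      unfolding T_def by blast
    then show False using regk[OF s(2) s(1)[symmetric]] p.zero_closed by blast
  qed
  have Tc: "t \<in> carrier R" if "t \<in> T" for t using that xc by (auto simp: T_def)
  have Tm: "s \<otimes> t \<in> T" if "s \<in> T" "t \<in> T" for s t
  proof -
    obtain a k b l where *: "s = a \<otimes> x [^] (k::nat)" "t = b \<otimes> x [^] (l::nat)" "a \<in> carrier R" "a \<notin> p" "b \<in> carrier R" "b \<notin> p"
      using \<open>s \<in> T\<close> \<open>t \<in> T\<close> unfolding T_def by blast
    have "s \<otimes> t = (a \<otimes> b) \<otimes> x [^] (k + l)" using * xc by (simp add: m_ac flip: nat_pow_mult)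
    moreover have "a \<otimes> b \<notin> p" using p.I_prime * by blast
    ultimately show ?thesis using * unfolding T_def by blast
  qed
  let ?\<F> = "{J. ideal J R \<and> J \<inter> T = {}}"
  have ne: "?\<F> \<noteq> {}" using zeroideal T0 by blast
  obtain q where q': "q \<in> ?\<F>" "\<And>H. H \<in> ?\<F> \<Longrightarrow> q \<subseteq> H \<Longrightarrow> H = q"
    by (rule ideal_maximal[OF noetherian_ring_axioms ne]) auto
  then have q: "ideal q R" "q \<inter> T = {}" by auto
  interpret q: ideal q R by (rule q(1))
  have one_p: "\<one> \<notin> p" using p.one_imp_carrier p.I_notcarr by blast
  have sT: "s \<in> T" if "s \<in> carrier R" "s \<notin> p" for s
    using that unfolding T_def by (intro CollectI exI[of _ s] exI[of _ "0::nat"]) auto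
  have xT: "x \<in> T" using xc one_p unfolding T_def by (intro CollectI exI[of _ \<one>] exI[of _ "1::nat"]) auto
  \<comment> \<open>By maximality every ideal strictly larger than \<open>q\<close> meets
    \<open>T\<close>.\<close>
  have meet: "\<exists>c\<in>q. \<exists>r\<in>carrier R. c \<oplus> r \<otimes> a \<in> T" if a: "a \<in> carrier R" "a \<notin> q" for a
  proof -
    have id: "ideal (q <+>\<^bsub>R\<^esub> PIdl a) R" by (rule add_ideals[OF q(1) cgenideal_ideal[OF a(1)]])
    have "c \<in> q <+>\<^bsub>R\<^esub> PIdl a" if "c \<in> q" for c
    proof -
      have "\<zero> \<in> PIdl a" using ideal.axioms(1)[OF cgenideal_ideal[OF a(1)]] by (rule additive_subgroup.zero_closed)
      then show ?thesis unfolding mem_set_add using that q.Icarr[OF that] by (metis r_zero)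
    qed
    moreover have "a \<in> q <+>\<^bsub>R\<^esub> PIdl a"
      unfolding mem_set_add using q.zero_closed cgenideal_self[OF a(1)] a(1) by (metis l_zero)
    ultimately have "q <+>\<^bsub>R\<^esub> PIdl a \<notin> ?\<F>" using q'(2)[of "q <+>\<^bsub>R\<^esub> PIdl a"] a(2) by blast
    then obtain t where "t \<in> q <+>\<^bsub>R\<^esub> PIdl a" "t \<in> T" using id by auto
    then show ?thesis unfolding mem_set_add cgenideal_def by blast
  qed
  have "primeideal q R"
  proof (rule primeidealI[OF q(1) cring_axioms])
    show "carrier R \<noteq> q" using q(2) sT[OF one_closed one_p] by blast
    fix a b assume ab: "a \<in> carrier R" "b \<in> carrier R" "a \<otimes> b \<in> q"
    show "a \<in> q \<or> b \<in> q"
    proof (rule ccontr)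
      assume "\<not> (a \<in> q \<or> b \<in> q)"
      then obtain c r c' r' where *: "c \<in> q" "r \<in> carrier R" "c \<oplus> r \<otimes> a \<in> T"
        "c' \<in> q" "r' \<in> carrier R" "c' \<oplus> r' \<otimes> b \<in> T" using meet[of a] meet[of b] ab by blast
      have cc: "c \<in> carrier R" "c' \<in> carrier R" using * q.Icarr by auto
      \<comment> \<open>Two such elements have their product in \<open>T\<close>, while this
        expansion puts the product into \<open>q\<close> as soon as ab is there.\<close>
      have "(c \<oplus> r \<otimes> a) \<otimes> (c' \<oplus> r' \<otimes> b) = (c' \<oplus> r' \<otimes> b) \<otimes> c \<oplus> ((r \<otimes> a) \<otimes> c' \<oplus> (r \<otimes> r') \<otimes> (a \<otimes> b))"
        using * cc ab by (simp add: l_distr r_distr m_ac a_ac)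
      moreover have "(c' \<oplus> r' \<otimes> b) \<otimes> c \<in> q" "(r \<otimes> a) \<otimes> c' \<in> q" "(r \<otimes> r') \<otimes> (a \<otimes> b) \<in> q"
        using * cc ab q.I_l_closed by auto
      ultimately have "(c \<oplus> r \<otimes> a) \<otimes> (c' \<oplus> r' \<otimes> b) \<in> q" by (simp add: q.a_closed)
      then show False using Tm[OF *(3) *(6)] q(2) by blast
    qed
  qed
  moreover have "q \<subseteq> p" using sT q(2) q.Icarr by blast
  moreover have "x \<notin> q" using xT q(2) by blast
  ultimately show ?thesis using that x by blast
qed

text \<open>An \<open>x\<close> that kills a nonzero element of \<open>M\<close> lies in an
  associated prime of \<open>M\<close>. Along a regular sequence of length d this prime starts a
  chain with d strict inclusions, and \<open>prime_below\<close> adds one more underneath, which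
  exceeds the dimension.\<close>

lemma regular_on_maximal_cohen_macaulay:
  assumes dim: "krull_dim R = enat d" and d: "d \<ge> 1" and M: "maximal_cohen_macaulay R \<mm> M"
    and x: "x \<in> carrier R" and reg: "\<And>r. r \<in> carrier R \<Longrightarrow> x \<otimes> r = \<zero> \<Longrightarrow> r = \<zero>"
  shows "regular_on M x"
proof (rule ccontr)
  have fg: "fin_gen_module R M" and dp: "depth R \<mm> M = enat d"
    using M dim by (auto simp: maximal_cohen_macaulay_def)
  interpret M: module R M using fg by (simp add: fin_gen_module_def)
  have n: "noeth R M" by (rule M.noeth_of_fin_gen[OF noetherian_ring_axioms fg])
  assume "\<not> regular_on M x"
  then obtain u where u: "u \<in> carrier M" "x \<odot>\<^bsub>M\<^esub> u = \<zero>\<^bsub>M\<^esub>" "u \<notin> {\<zero>\<^bsub>M\<^esub>}"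
    by (auto simp: regular_on_def)
  obtain w where w: "w \<in> carrier M" "w \<notin> {\<zero>\<^bsub>M\<^esub>}" "primeideal (colon R M {\<zero>\<^bsub>M\<^esub>} w) R"
    "colon R M {\<zero>\<^bsub>M\<^esub>} u \<subseteq> colon R M {\<zero>\<^bsub>M\<^esub>} w"
    by (rule M.associated_prime[OF noetherian_ring_axioms M.submodule_zero_set u(1,3)])
  have xw: "x \<in> colon R M {\<zero>\<^bsub>M\<^esub>} w" using w(4) u x by (auto simp: colon_def)
  obtain q where q: "primeideal q R" "q \<subset> colon R M {\<zero>\<^bsub>M\<^esub>} w" by (rule prime_below[OF w(3) xw reg])
  obtain xs where xs: "length xs = d" "set xs \<subseteq> \<mm>" "regular_sequence R M xs" by (rule depth_attained[OF dp d])
  obtain P where P: "P 0 = colon R M {\<zero>\<^bsub>M\<^esub>} w" "\<And>i. i \<le> d \<Longrightarrow> primeideal (P i) R" "\<And>i. i < d \<Longrightarrow> P i \<subset> P (Suc i)"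
    using prime_chain_of_regular_sequence[OF M.module_axioms n xs(3,2) w(3) refl w(1)] xs(1) by auto
  have "enat (Suc d) \<le> krull_dim R" unfolding krull_dim_def
  proof (rule Sup_upper, intro CollectI exI[of _ "Suc d"] conjI exI[of _ "case_nat q P"] allI impI refl)
    show "primeideal (case_nat q P i) R" if "i \<le> Suc d" for i
      using q P that by (cases i) auto
    show "case_nat q P i \<subset> case_nat q P (Suc i)" if "i < Suc d" for i
      using q P that by (cases i) auto
  qed
  then show False using dim by simp
qed

end

section \<open>Superficial elements\<close>

lemma ideal_smult_image:
  assumes M: "module R M" and f: "mhom R M N f" and A: "A \<subseteq> carrier R" and u: "u \<in> ideal_smult A M"
  shows "f u \<in> ideal_smult A N"
  using u
proof induction
  interpret module R M by fact
  case (smult a u)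
  then have "f (a \<odot>\<^bsub>M\<^esub> u) = a \<odot>\<^bsub>N\<^esub> f u" using A by (intro mhom_smult[OF f]) auto
  then show ?case using smult ideal_smult.smult[of a A "f u" N] mhom_closed[OF f] by simp
next
  interpret module R M by fact
  case (sum u v)
  then show ?case using ideal_smult_closed[OF A] by (simp add: mhom_add[OF f] ideal_smult.sum)
qed

text \<open>\<open>i\<close> and \<open>r\<close> respect the filtrations by powers of
  \<open>I\<close>, so the colon condition on \<open>E\<close> passes to its direct summand
  \<open>M\<close>. Of the equality in \<open>superficial\<close> the inclusion that carries
  information is extracted.\<close>

lemma superficial_retract:
  assumes E: "module R E" and M: "module R M" and i: "mhom R M E i" and r: "mhom R E M r"
    and ri: "\<And>u. u \<in> carrier M \<Longrightarrow> r (i u) = u" and I: "ideal I R"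
    and sup: "superficial R I E x"
  obtains c where "\<And>n u. n \<ge> c \<Longrightarrow> u \<in> pow_smult R I c M \<Longrightarrow> x \<odot>\<^bsub>M\<^esub> u \<in> pow_smult R I (Suc n) M
    \<Longrightarrow> u \<in> pow_smult R I n M"
proof -
  interpret E: module R E by fact
  interpret M: module R M by fact
  obtain c where c: "x \<in> I" "\<And>n. n \<ge> c \<Longrightarrow>
     {u \<in> carrier E. x \<odot>\<^bsub>E\<^esub> u \<in> pow_smult R I (n + 1) E} \<inter> pow_smult R I c E = pow_smult R I n E"
    using sup unfolding superficial_def by blast
  have x: "x \<in> carrier R" using ideal.Icarr[OF I c(1)] .
  have pc: "ideal_pow R I n \<subseteq> carrier R" for n
    using ideal.Icarr[OF E.R.ideal_ideal_pow[OF I]] by blast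
  show ?thesis
  proof (rule that[of c])
    fix n u assume n: "n \<ge> c" and u: "u \<in> pow_smult R I c M" "x \<odot>\<^bsub>M\<^esub> u \<in> pow_smult R I (Suc n) M"
    have uc: "u \<in> carrier M" by (rule M.ideal_smult_closed[OF pc u(1)])
    have "i u \<in> {u \<in> carrier E. x \<odot>\<^bsub>E\<^esub> u \<in> pow_smult R I (n + 1) E} \<inter> pow_smult R I c E"
      using ideal_smult_image[OF M i pc u(1)] mhom_closed[OF i uc]
        ideal_smult_image[OF M i pc u(2), unfolded mhom_smult[OF i x uc] Suc_eq_plus1] by blast
    then have "i u \<in> pow_smult R I n E" unfolding c(2)[OF n] .
    from ideal_smult_image[OF E r pc this] show "u \<in> pow_smult R I n M" by (simp add: ri[OF uc])
  qed
qed

context noetherian_local_ring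
begin

lemma primary_to_facts:
  assumes "primary_to R \<mm> I"
  shows "ideal I R" "I \<subseteq> \<mm>" "a \<in> \<mm> \<Longrightarrow> \<exists>k::nat. a [^] k \<in> I"
proof -
  have r: "{a \<in> carrier R. \<exists>n::nat. a [^] n \<in> I} = \<mm>" and I: "ideal I R"
    using assms by (auto simp: primary_to_def)
  show "ideal I R" by fact
  show "a \<in> \<mm> \<Longrightarrow> \<exists>k::nat. a [^] k \<in> I" using r by auto
  have "a \<in> \<mm>" if "a \<in> I" for a
  proof -
    have "a [^] (1::nat) \<in> I" using that ideal.Icarr[OF I] by simp
    then show ?thesis using r ideal.Icarr[OF I that] by blast
  qed
  then show "I \<subseteq> \<mm>" by auto
qed

text \<open>If x u = 0, take a power z of y that lies in I^c. Then z u lies in I^c M and x z u = 0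
  lies in every I^(n+1) M, so z u lies in I^n M for all n \<ge> c and vanishes by Krull's theorem.
  As z is regular along with y, u = 0.\<close>

lemma regular_on_of_superficial:
  assumes M: "module R M" and n: "noeth R M" and I: "primary_to R \<mm> I" and x: "x \<in> I"
    and sup: "\<And>n u. n \<ge> c \<Longrightarrow> u \<in> pow_smult R I c M \<Longrightarrow> x \<odot>\<^bsub>M\<^esub> u \<in> pow_smult R I (Suc n) M
      \<Longrightarrow> u \<in> pow_smult R I n M"
    and y: "y \<in> \<mm>" "regular_on M y"
  shows "regular_on M x"
  unfolding regular_on_def
proof (intro ballI impI)
  interpret M: module R M by fact
  note I' = primary_to_facts[OF I]
  have yc: "y \<in> carrier R" using ideal.Icarr[OF ideal_\<mm> y(1)] .
  have xc: "x \<in> carrier R" using ideal.Icarr[OF I'(1) x] .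
  fix u assume u: "u \<in> carrier M" "x \<odot>\<^bsub>M\<^esub> u = \<zero>\<^bsub>M\<^esub>"
  obtain k :: nat where k: "y [^] k \<in> I" using I'(3)[OF y(1)] by auto
  define z where "z = (y [^] k) [^] c"
  have z: "z \<in> ideal_pow R I c" unfolding z_def by (rule pow_mem_ideal_pow[OF I'(1) k])
  have zc: "z \<in> carrier R" unfolding z_def using yc by simp
  have zu: "z \<odot>\<^bsub>M\<^esub> u \<in> pow_smult R I c M" using z u(1) by (rule ideal_smult.smult)
  have "x \<odot>\<^bsub>M\<^esub> (z \<odot>\<^bsub>M\<^esub> u) = z \<odot>\<^bsub>M\<^esub> (x \<odot>\<^bsub>M\<^esub> u)" using zc xc u(1) by (simp add: m_comm flip: M.smult_assoc1)
  then have xzu: "x \<odot>\<^bsub>M\<^esub> (z \<odot>\<^bsub>M\<^esub> u) = \<zero>\<^bsub>M\<^esub>" using u zc by simp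
  have "z \<odot>\<^bsub>M\<^esub> u \<in> pow_smult R I n M" if "n \<ge> c" for n
    by (rule sup[OF that zu], subst xzu)
       (rule M.submodule_zero[OF M.submodule_pow_smult[OF I'(1)]])
  then have "z \<odot>\<^bsub>M\<^esub> u = \<zero>\<^bsub>M\<^esub>" by (rule krull_intersection[OF M n I'(1,2)])
  moreover have "regular_on M z" unfolding z_def
    using yc y(2) by (intro M.regular_on_pow) auto
  ultimately show "u = \<zero>\<^bsub>M\<^esub>" using u(1) by (simp add: regular_on_def)
qed

text \<open>Superficiality controls elements of I^c M only. The weak Artin-Rees lemma for xM and x
  I^c M removes this restriction: for large n, an x u in I^(n+1) M has the form x v with v in I^c M,
  and u = v by regularity.\<close>

lemma eventually_colon:
  assumes M: "module R M" and n: "noeth R M" and I: "ideal I R" and x: "x \<in> I" and reg: "regular_on M x"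
    and sup: "\<And>n u. n \<ge> c \<Longrightarrow> u \<in> pow_smult R I c M \<Longrightarrow> x \<odot>\<^bsub>M\<^esub> u \<in> pow_smult R I (Suc n) M
      \<Longrightarrow> u \<in> pow_smult R I n M"
  obtains n0 where "\<And>n u. n \<ge> n0 \<Longrightarrow> u \<in> carrier M \<Longrightarrow> x \<odot>\<^bsub>M\<^esub> u \<in> pow_smult R I (Suc n) M \<Longrightarrow> u \<in> pow_smult R I n M"
proof -
  interpret M: module R M by fact
  have xc: "x \<in> carrier R" using ideal.Icarr[OF I x] .
  let ?m = "\<lambda>u. x \<odot>\<^bsub>M\<^esub> u"
  have mh: "mhom R M M ?m" by (rule mhom_smult_fun[OF M mhom_ident xc])
  have Pc: "submodule (pow_smult R I c M) R M" by (rule M.submodule_pow_smult[OF I])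
  obtain k where k: "pow_smult R I k M \<inter> ?m ` carrier M \<subseteq> ?m ` pow_smult R I c M"
  proof (rule M.weak_artin_rees[OF noetherian_ring_axioms n I M.submodule_smult_image[OF xc]
        submodule_image[OF M M mh Pc], of c])
    show "?m ` pow_smult R I c M \<subseteq> ?m ` carrier M" using M.submodule_subset[OF Pc] by auto
    fix a u assume a: "a \<in> ideal_pow R I c" and "u \<in> ?m ` carrier M"
    then obtain v where v: "v \<in> carrier M" "u = ?m v" by auto
    have "a \<in> carrier R" using ideal.Icarr[OF ideal_ideal_pow[OF I] a] .
    then have "a \<odot>\<^bsub>M\<^esub> u = ?m (a \<odot>\<^bsub>M\<^esub> v)" using v xc by (simp add: m_comm flip: M.smult_assoc1)
    then show "a \<odot>\<^bsub>M\<^esub> u \<in> ?m ` pow_smult R I c M" using ideal_smult.smult[OF a v(1)] by auto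
  qed
  show ?thesis
  proof (rule that[of "max c k"])
    fix n u assume n: "max c k \<le> n" and u: "u \<in> carrier M" "?m u \<in> pow_smult R I (Suc n) M"
    have "?m u \<in> pow_smult R I k M" using M.pow_smult_antimono[OF I, of k "Suc n"] u(2) n by auto
    then obtain v where v: "v \<in> pow_smult R I c M" "?m u = ?m v" using k u(1) by auto
    have "u = v" by (rule M.regular_on_cancel[OF xc reg u(1) M.submodule_subset[OF Pc v(1)] v(2)])
    then show "u \<in> pow_smult R I n M" using sup[of n u] v(1) u(2) n by simp
  qed
qed

text \<open>Take \<open>H\<close> maximal such that H/I^n M has finite length. If H \<noteq> M, some
  associated prime (H : w) contains \<mm>, since every element of \<mm> has a power in I^n. Then H +
  Rw adds length at most one, against maximality.\<close>

lemma finite_mlen_pow_smult: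
  assumes M: "module R M" and n: "noeth R M" and I: "primary_to R \<mm> I"
  shows "mlen R M (pow_smult R I n M) (carrier M) \<noteq> \<infinity>"
proof -
  interpret M: module R M by fact
  note I' = primary_to_facts[OF I]
  let ?P = "pow_smult R I n M"
  have P: "submodule ?P R M" by (rule M.submodule_pow_smult[OF I'(1)])
  let ?\<F> = "{H. submodule H R M \<and> ?P \<subseteq> H \<and> mlen R M ?P H \<noteq> \<infinity>}"
  have "?P \<in> ?\<F>" using P by (simp add: M.mlen_refl del: not_infinity_eq)
  then have ne: "?\<F> \<noteq> {}" by blast
  obtain H where H': "H \<in> ?\<F>" "\<And>K. K \<in> ?\<F> \<Longrightarrow> H \<subseteq> K \<Longrightarrow> K = H"
    by (rule M.noeth_maximal[OF n ne]) auto
  then have H: "submodule H R M" "?P \<subseteq> H" "mlen R M ?P H \<noteq> \<infinity>" by auto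
  have "H = carrier M"
  proof (rule ccontr)
    assume "H \<noteq> carrier M"
    then obtain v where v: "v \<in> carrier M" "v \<notin> H" using M.submodule_subset[OF H(1)] by auto
    obtain w where w: "w \<in> carrier M" "w \<notin> H" "primeideal (colon R M H w) R" "colon R M H v \<subseteq> colon R M H w"
      by (rule M.associated_prime[OF noetherian_ring_axioms H(1) v])
    have mp: "\<mm> \<subseteq> colon R M H w"
    proof
      fix a assume a: "a \<in> \<mm>"
      have ac: "a \<in> carrier R" using ideal.Icarr[OF ideal_\<mm> a] .
      obtain k :: nat where k: "a [^] k \<in> I" using I'(3)[OF a] by auto
      have "(a [^] k) [^] n \<in> ideal_pow R I n" by (rule pow_mem_ideal_pow[OF I'(1) k])
      then have "(a [^] k) [^] n \<odot>\<^bsub>M\<^esub> w \<in> H" using ideal_smult.smult[OF _ w(1)] H(2) by blast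
      then have "(a [^] k) [^] n \<in> colon R M H w" using ac by (simp add: colon_def)
      then show "a \<in> colon R M H w"
        using primeideal.pow_mem_imp_mem[OF w(3)] ac by (metis nat_pow_closed)
    qed
    let ?C = "(\<lambda>r. r \<odot>\<^bsub>M\<^esub> w) ` carrier R"
    have C: "submodule ?C R M" by (rule M.submodule_cyclic[OF w(1)])
    let ?K = "H <+>\<^bsub>M\<^esub> ?C"
    have K: "submodule ?K R M" by (rule M.submodule_sum[OF H(1) C])
    have HK: "H \<subseteq> ?K" by (rule M.set_add_mono1[OF H(1) C])
    have "\<one> \<odot>\<^bsub>M\<^esub> w \<in> ?C" by (rule imageI) simp
    then have wC: "w \<in> ?C" using w(1) by simp
    then have wK: "w \<in> ?K" using M.set_add_mono2[OF H(1) C] by auto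
    \<comment> \<open>Modulo \<open>H\<close> the submodule Rw is simple: a coefficient outside
      \<mm> is a unit, so any element of H + Rw outside \<open>H\<close> gives back
      \<open>w\<close>.\<close>
    have big: "L = ?K" if L: "submodule L R M" "H \<subset> L" "L \<subseteq> ?K" for L
    proof -
      obtain k where k: "k \<in> L" "k \<notin> H" using L by auto
      then have "k \<in> ?K" using L(3) by blast
      then obtain h r where hr: "h \<in> H" "r \<in> carrier R" "k = h \<oplus>\<^bsub>M\<^esub> r \<odot>\<^bsub>M\<^esub> w" unfolding mem_set_add by blast
      have hc: "h \<in> carrier M" by (rule M.submodule_subset[OF H(1) hr(1)])
      have "r \<notin> \<mm>"
      proof
        assume "r \<in> \<mm>"
        then have "r \<odot>\<^bsub>M\<^esub> w \<in> H" using mp by (auto simp: colon_def)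
        then show False using k(2) hr M.submoduleE(5)[OF H(1)] by simp
      qed
      then have ru: "r \<in> Units R" by (rule unit_of_notin[OF hr(2)])
      have "k \<ominus>\<^bsub>M\<^esub> h \<in> L" using M.submodule_diff[OF L(1) k(1)] hr(1) L(2) by auto
      then have "r \<odot>\<^bsub>M\<^esub> w \<in> L" using hr hc w(1) by (simp add: M.add_diff_cancel)
      then have "inv r \<odot>\<^bsub>M\<^esub> (r \<odot>\<^bsub>M\<^esub> w) \<in> L" using M.submoduleE(4)[OF L(1)] ru by simp
      then have "w \<in> L" using ru hr(2) w(1) by (simp flip: M.smult_assoc1)
      then have "?C \<subseteq> L" using M.submoduleE(4)[OF L(1)] by auto
      then show ?thesis using M.set_add_least[OF L(1)] L by blast
    qed
    have "mlen R M H ?K \<le> enat 1" unfolding mlen_def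
    proof (rule chain_len_le)
      fix G k assume G: "set_chain {L. submodule L R M \<and> H \<subseteq> L \<and> L \<subseteq> ?K} G k"
      show "enat k \<le> enat 1"
      proof (rule ccontr)
        assume "\<not> enat k \<le> enat 1"
        then have k: "2 \<le> k" by simp
        have Gi: "G i \<in> {L. submodule L R M \<and> H \<subseteq> L \<and> L \<subseteq> ?K}" if "i \<le> 2" for i
          using G order_trans[OF that k] unfolding set_chain_def by simp
        have st: "G i \<subset> G (Suc i)" if "i < k" for i using G that unfolding set_chain_def by simp
        have G2: "G 0 \<subset> G (Suc 0)" "G (Suc 0) \<subset> G (Suc 1)" using st[of 0] st[of 1] k by simp_all
        have "G (Suc 0) = ?K"
        proof (rule big)
          show "submodule (G (Suc 0)) R M" "G (Suc 0) \<subseteq> ?K" using Gi[of "Suc 0"] by simp_all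
          show "H \<subset> G (Suc 0)" using Gi[of 0] G2(1) by blast
        qed
        moreover have "G (Suc 1) \<subseteq> ?K" using Gi[of "Suc 1"] by simp
        ultimately show False using G2(2) by blast
      qed
    qed
    then have "mlen R M H ?K \<noteq> \<infinity>" by (cases "mlen R M H ?K") auto
    then have "mlen R M ?P ?K \<noteq> \<infinity>"
      using M.mlen_additive[OF P H(1) K H(2) HK] H(3) by (simp add: plus_eq_infty_iff_enat)
    then have "?K = H" using H'(2)[of ?K] K HK H(2) by auto
    then show False using wK w(2) by simp
  qed
  then show ?thesis using H(3) by simp
qed

end

section \<open>Ext and short exact sequences\<close>

locale resolved = module R M for R (structure) and M (structure) +
  fixes \<pi>
  assumes res: "free_resolution R M (fst (chosen_resolution R M)) (snd (chosen_resolution R M)) \<pi>"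
begin

abbreviation "F \<equiv> res_module R M"
abbreviation "\<delta> \<equiv> res_diff R M"

lemma module_F: "module R (F i)"
  unfolding res_module_def by (rule R.module_free_module)

lemma mhom_\<delta>: "mhom R (F (Suc i)) (F i) (\<delta> i)"
  using res unfolding free_resolution_def res_module_def res_diff_def module_homs_iff by blast

lemma mhom_\<pi>: "mhom R (F 0) M \<pi>"
  using res unfolding free_resolution_def res_module_def module_homs_iff by blast

lemma \<pi>_surj: assumes "u \<in> carrier M" shows "\<exists>v\<in>carrier (F 0). \<pi> v = u"
proof -
  have "\<pi> ` carrier (F 0) = carrier M" using res unfolding free_resolution_def res_module_def by blast
  then have "u \<in> \<pi> ` carrier (F 0)" using assms by simp
  then show ?thesis by auto
qed

lemma image_\<delta>_0: "\<delta> 0 ` carrier (F (Suc 0)) = {v \<in> carrier (F 0). \<pi> v = \<zero>\<^bsub>M\<^esub>}"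
  using res unfolding free_resolution_def res_module_def res_diff_def One_nat_def by blast

lemma image_\<delta>_Suc: "\<delta> (Suc i) ` carrier (F (Suc (Suc i))) = {v \<in> carrier (F (Suc i)). \<delta> i v = \<zero>\<^bsub>F i\<^esub>}"
  using res unfolding free_resolution_def res_module_def res_diff_def by blast

lemma \<pi>_\<delta>: "w \<in> carrier (F (Suc 0)) \<Longrightarrow> \<pi> (\<delta> 0 w) = \<zero>\<^bsub>M\<^esub>"
  using image_\<delta>_0 by blast

lemma ker_\<pi>: "v \<in> carrier (F 0) \<Longrightarrow> \<pi> v = \<zero>\<^bsub>M\<^esub> \<Longrightarrow> \<exists>w\<in>carrier (F (Suc 0)). v = \<delta> 0 w"
  using image_\<delta>_0 by blast

lemma \<delta>_\<delta>: "w \<in> carrier (F (Suc (Suc i))) \<Longrightarrow> \<delta> i (\<delta> (Suc i) w) = \<zero>\<^bsub>F i\<^esub>"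
  using image_\<delta>_Suc by blast

lemma ker_\<delta>: "v \<in> carrier (F (Suc i)) \<Longrightarrow> \<delta> i v = \<zero>\<^bsub>F i\<^esub> \<Longrightarrow> \<exists>w\<in>carrier (F (Suc (Suc i))). v = \<delta> (Suc i) w"
  using image_\<delta>_Suc by blast

lemma F_projective:
  assumes "module R P" "module R Q" "mhom R P Q p" "mhom R (F i) Q f"
    and "\<And>v. v \<in> carrier (F i) \<Longrightarrow> f v \<in> p ` carrier P"
  obtains h where "mhom R (F i) P h" "\<And>v. v \<in> carrier (F i) \<Longrightarrow> p (h v) = f v"
  using free_projective[OF assms(1-3) assms(4)[unfolded res_module_def]] assms(5)
  unfolding res_module_def by metis

abbreviation "Coch i L \<equiv> cochains R i M L"
abbreviation "Zc i L \<equiv> cocycles R i M L"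
abbreviation "Bd i L \<equiv> coboundaries R i M L"

lemma carrier_Coch: "f \<in> carrier (Coch i L) \<longleftrightarrow> mhom R (F i) L f \<and> f \<in> extensional (carrier (F i))"
  by (simp add: cochains_def hom_module_def module_homs_iff)

lemma zero_Coch: "\<zero>\<^bsub>Coch i L\<^esub> = (\<lambda>u\<in>carrier (F i). \<zero>\<^bsub>L\<^esub>)"
  and add_Coch: "f \<oplus>\<^bsub>Coch i L\<^esub> g = (\<lambda>u\<in>carrier (F i). f u \<oplus>\<^bsub>L\<^esub> g u)"
  and smult_Coch: "a \<odot>\<^bsub>Coch i L\<^esub> f = (\<lambda>u\<in>carrier (F i). a \<odot>\<^bsub>L\<^esub> f u)"
  by (simp_all add: cochains_def hom_module_def)

lemma module_Coch: "module R L \<Longrightarrow> module R (Coch i L)"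
  unfolding cochains_def by (rule module_hom_module[OF module_F])

lemma restrict_in_Coch: "mhom R (F i) L f \<Longrightarrow> restrict f (carrier (F i)) \<in> carrier (Coch i L)"
  by (simp add: carrier_Coch mhom_restrict[OF module_F])

lemma Coch_eqI:
  "f \<in> carrier (Coch i L) \<Longrightarrow> g \<in> carrier (Coch i L) \<Longrightarrow> (\<And>v. v \<in> carrier (F i) \<Longrightarrow> f v = g v) \<Longrightarrow> f = g"
  by (auto simp: carrier_Coch intro: extensionalityI)

lemma diff_Coch:
  assumes L: "module R L" and f: "f \<in> carrier (Coch i L)" and g: "g \<in> carrier (Coch i L)"
    and v: "v \<in> carrier (F i)"
  shows "(f \<ominus>\<^bsub>Coch i L\<^esub> g) v = f v \<ominus>\<^bsub>L\<^esub> g v"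
proof -
  interpret L: module R L by fact
  interpret C: module R "Coch i L" by (rule module_Coch[OF L])
  have c: "f v \<in> carrier L" "g v \<in> carrier L" using f g v by (auto simp: carrier_Coch mhom_closed)
  have d: "f \<ominus>\<^bsub>Coch i L\<^esub> g \<in> carrier (Coch i L)" using f g by simp
  have dv: "(f \<ominus>\<^bsub>Coch i L\<^esub> g) v \<in> carrier L" using d v by (auto simp: carrier_Coch mhom_closed)
  have "(g \<oplus>\<^bsub>Coch i L\<^esub> (f \<ominus>\<^bsub>Coch i L\<^esub> g)) v = f v" using C.diff_add_cancel[OF f g] by simp
  then have "g v \<oplus>\<^bsub>L\<^esub> (f \<ominus>\<^bsub>Coch i L\<^esub> g) v = f v" using v by (simp add: add_Coch)
  then show ?thesis using L.add_diff_cancel[OF dv c(2)] by simp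
qed

lemma mhom_coboundary: "module R L \<Longrightarrow> mhom R (Coch i L) (Coch (Suc i) L) (coboundary R i M)"
proof (rule mhomI)
  fix f assume "f \<in> carrier (Coch i L)"
  then have "mhom R (F (Suc i)) L (\<lambda>v. f (\<delta> i v))"
    by (intro mhom_compose[OF mhom_\<delta>]) (simp add: carrier_Coch)
  then show "coboundary R i M f \<in> carrier (Coch (Suc i) L)"
    unfolding coboundary_def by (rule restrict_in_Coch)
qed (auto simp: coboundary_def add_Coch smult_Coch mhom_closed[OF mhom_\<delta>])

lemma coboundary_apply: "v \<in> carrier (F (Suc i)) \<Longrightarrow> coboundary R i M f v = f (\<delta> i v)"
  by (simp add: coboundary_def)

lemma submodule_Zc: "module R L \<Longrightarrow> submodule (Zc i L) R (Coch i L)"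
  unfolding cocycles_def by (intro mhom_kernel_submodule module_Coch mhom_coboundary)

lemma mem_Zc_iff:
  "f \<in> Zc i L \<longleftrightarrow> f \<in> carrier (Coch i L) \<and> (\<forall>v\<in>carrier (F (Suc i)). f (\<delta> i v) = \<zero>\<^bsub>L\<^esub>)"
proof -
  have "coboundary R i M f = \<zero>\<^bsub>Coch (Suc i) L\<^esub> \<longleftrightarrow> (\<forall>v\<in>carrier (F (Suc i)). f (\<delta> i v) = \<zero>\<^bsub>L\<^esub>)"
    by (auto simp: coboundary_def zero_Coch fun_eq_iff restrict_def)
  then show ?thesis by (auto simp: cocycles_def)
qed

lemma submodule_Bd: "module R L \<Longrightarrow> submodule (Bd i L) R (Coch i L)"
  by (cases i)
     (simp_all add: module.submodule_zero_set[OF module_Coch] submodule_image[OF module_Coch module_Coch mhom_coboundary]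
       module.carrier_is_submodule[OF module_Coch])

lemma Bd_subset_Zc:
  assumes L: "module R L" shows "Bd i L \<subseteq> Zc i L"
proof (cases i)
  case 0
  then show ?thesis using module.submodule_zero[OF module_Coch submodule_Zc, OF L L] by simp
next
  case (Suc j)
  have "coboundary R j M f \<in> Zc (Suc j) L" if f: "f \<in> carrier (Coch j L)" for f
  proof -
    have fh: "mhom R (F j) L f" using f by (simp add: carrier_Coch)
    show ?thesis unfolding mem_Zc_iff
      using mhom_closed[OF mhom_coboundary[OF L] f] mhom_closed[OF mhom_\<delta>]
      by (simp add: coboundary_apply \<delta>_\<delta> mhom_zero[OF module_F L fh])
  qed
  then show ?thesis unfolding Suc by auto
qed

lemma module_length_Ext: "module R L \<Longrightarrow> module_length R (Ext R i M L) = mlen R (Coch i L) (Bd i L) (Zc i L)"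
  unfolding Ext_def
  by (rule module.module_length_subquotient[OF module_Coch submodule_Zc submodule_Bd Bd_subset_Zc])

lemma module_length_Ext_finite:
  assumes L: "module R L" and fin: "module_length R L \<noteq> \<infinity>"
  shows "module_length R (Ext R i M L) \<noteq> \<infinity>"
proof -
  interpret C: module R "Coch i L" by (rule module_Coch[OF L])
  have "module_length R (Coch i L) \<noteq> \<infinity>"
    unfolding cochains_def res_module_def by (rule module_length_hom_free_finite[OF L fin])
  moreover have "mlen R (Coch i L) (Bd i L) (Zc i L) \<le> module_length R (Coch i L)"
    unfolding C.module_length_eq_mlen
    using C.submodule_zero[OF submodule_Bd[OF L]] C.submodule_subset[OF submodule_Zc[OF L]]
    by (intro mlen_mono) auto
  ultimately show ?thesis unfolding module_length_Ext[OF L]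
    using enat_ord_simps(5) by metis
qed

section \<open>Functoriality of Ext in its second argument\<close>

definition push :: "nat \<Rightarrow> ('p \<Rightarrow> 'q) \<Rightarrow> ((nat \<Rightarrow> 'a) \<Rightarrow> 'p) \<Rightarrow> (nat \<Rightarrow> 'a) \<Rightarrow> 'q" where
  "push i h f = (\<lambda>v\<in>carrier (F i). h (f v))"

lemma mhom_push:
  assumes L: "module R L" and L': "module R L'" and h: "mhom R L L' h"
  shows "mhom R (Coch i L) (Coch i L') (push i h)"
proof (rule mhomI)
  fix f assume "f \<in> carrier (Coch i L)"
  then have "mhom R (F i) L' (\<lambda>v. h (f v))" by (intro mhom_compose[OF _ h]) (simp add: carrier_Coch)
  then show "push i h f \<in> carrier (Coch i L')" unfolding push_def by (rule restrict_in_Coch)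
next
  fix f g assume "f \<in> carrier (Coch i L)" "g \<in> carrier (Coch i L)"
  then show "push i h (f \<oplus>\<^bsub>Coch i L\<^esub> g) = push i h f \<oplus>\<^bsub>Coch i L'\<^esub> push i h g"
    by (auto simp: push_def add_Coch carrier_Coch mhom_closed mhom_add[OF h])
next
  fix a f assume "a \<in> carrier R" "f \<in> carrier (Coch i L)"
  then show "push i h (a \<odot>\<^bsub>Coch i L\<^esub> f) = a \<odot>\<^bsub>Coch i L'\<^esub> push i h f"
    by (auto simp: push_def smult_Coch carrier_Coch mhom_closed mhom_smult[OF h])
qed

lemma push_apply: "v \<in> carrier (F i) \<Longrightarrow> push i h f v = h (f v)"
  by (simp add: push_def)

lemma push_Zc:
  assumes L: "module R L" and L': "module R L'" and h: "mhom R L L' h" and f: "f \<in> Zc i L"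
  shows "push i h f \<in> Zc i L'"
  using f mhom_closed[OF mhom_push[OF L L' h]] mhom_closed[OF mhom_\<delta>]
  by (auto simp: mem_Zc_iff push_apply mhom_zero[OF L L' h])

lemma push_coboundary:
  "push (Suc i) h (coboundary R i M f) = coboundary R i M (push i h f)"
  by (auto simp: push_def coboundary_def mhom_closed[OF mhom_\<delta>])

lemma push_Bd:
  assumes L: "module R L" and L': "module R L'" and h: "mhom R L L' h" and f: "f \<in> Bd i L"
  shows "push i h f \<in> Bd i L'"
proof (cases i)
  case 0
  then show ?thesis using f mhom_zero[OF module_Coch module_Coch mhom_push, OF L L' L L' h] by simp
next
  case (Suc j)
  then show ?thesis using f mhom_closed[OF mhom_push[OF L L' h]] by (auto simp: push_coboundary)
qed

text \<open>Injectivity of the induced map on Ext, phrased by representatives so that the diagram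
  chase stays among cochains. \<open>inj_on_ExtI\<close> derives it from injectivity of
  \<open>Ext_map\<close>.\<close>

definition inj_on_Ext :: "nat \<Rightarrow> ('a, 'p, 's) module_scheme \<Rightarrow> ('a, 'q, 't) module_scheme \<Rightarrow> ('p \<Rightarrow> 'q) \<Rightarrow> bool" where
  "inj_on_Ext i A L \<chi> \<longleftrightarrow> (\<forall>f\<in>Zc i A. push i \<chi> f \<in> Bd i L \<longrightarrow> f \<in> Bd i A)"

text \<open>\<open>push\<close> respects coboundaries, so the union that defines
  \<open>Ext_map\<close> collapses to the class of one pushed representative.\<close>

lemma Ext_map_coset:
  assumes A: "module R A" and L: "module R L" and h: "mhom R A L \<chi>" and z: "z \<in> Zc i A"
  shows "Ext_map R i M L \<chi> (Bd i A +>\<^bsub>Coch i A\<^esub> z) = Bd i L +>\<^bsub>Coch i L\<^esub> push i \<chi> z"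
proof -
  interpret CA: module R "Coch i A" by (rule module_Coch[OF A])
  interpret CL: module R "Coch i L" by (rule module_Coch[OF L])
  note ph = mhom_push[OF A L h, of i]
  have zc: "z \<in> carrier (Coch i A)" by (rule CA.submodule_subset[OF submodule_Zc[OF A] z])
  have "Bd i L +>\<^bsub>Coch i L\<^esub> push i \<chi> y = Bd i L +>\<^bsub>Coch i L\<^esub> push i \<chi> z"
    if y: "y \<in> carrier (Coch i A)" "y \<ominus>\<^bsub>Coch i A\<^esub> z \<in> Bd i A" for y
    using push_Bd[OF A L h y(2)]
    by (simp add: CL.coset_eq_iff[OF submodule_Bd[OF L]] mhom_closed[OF ph] y(1) zc
        mhom_diff[OF CA.module_axioms CL.module_axioms ph])
  from CA.Union_coset[OF submodule_Bd[OF A] zc, of "\<lambda>y. Bd i L +>\<^bsub>Coch i L\<^esub> push i \<chi> y", OF this]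
  show ?thesis unfolding Ext_map_def push_def by simp
qed

lemma coset_carrier_update: "K +>\<^bsub>P\<lparr>carrier := Z\<rparr>\<^esub> u = K +>\<^bsub>P\<^esub> u"
  by (simp add: a_r_coset_def')

lemma carrier_Ext: "carrier (Ext R i M L) = (\<lambda>z. Bd i L +>\<^bsub>Coch i L\<^esub> z) ` Zc i L"
  by (simp add: Ext_def carrier_fact_module coset_carrier_update)

lemma zero_Ext: "\<zero>\<^bsub>Ext R i M L\<^esub> = Bd i L"
  by (simp add: Ext_def zero_fact_module)

lemma module_Ext: "module R L \<Longrightarrow> module R (Ext R i M L)"
  unfolding Ext_def
  by (intro module.module_fact_module submodule.submodule_is_module[OF submodule_Zc module_Coch])
     (simp_all add: module.submodule_of_submodule_iff[OF module_Coch submodule_Zc] submodule_Bd Bd_subset_Zc)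

lemma Ext_map_zero:
  assumes A: "module R A" and L: "module R L" and h: "mhom R A L \<chi>"
  shows "Ext_map R i M L \<chi> \<zero>\<^bsub>Ext R i M A\<^esub> = \<zero>\<^bsub>Ext R i M L\<^esub>"
proof -
  interpret CA: module R "Coch i A" by (rule module_Coch[OF A])
  interpret CL: module R "Coch i L" by (rule module_Coch[OF L])
  have "Ext_map R i M L \<chi> (Bd i A +>\<^bsub>Coch i A\<^esub> \<zero>\<^bsub>Coch i A\<^esub>) = Bd i L +>\<^bsub>Coch i L\<^esub> push i \<chi> \<zero>\<^bsub>Coch i A\<^esub>"
    by (rule Ext_map_coset[OF A L h CA.submodule_zero[OF submodule_Zc[OF A]]])
  then show ?thesis
    by (simp add: zero_Ext CA.coset_zero[OF submodule_Bd[OF A]] CL.coset_zero[OF submodule_Bd[OF L]]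
        mhom_zero[OF CA.module_axioms CL.module_axioms mhom_push[OF A L h]])
qed

lemma inj_on_ExtI:
  assumes A: "module R A" and L: "module R L" and h: "mhom R A L \<chi>"
    and inj: "inj_on (Ext_map R i M L \<chi>) (carrier (Ext R i M A))"
  shows "inj_on_Ext i A L \<chi>"
  unfolding inj_on_Ext_def
proof (intro ballI impI)
  interpret CA: module R "Coch i A" by (rule module_Coch[OF A])
  interpret CL: module R "Coch i L" by (rule module_Coch[OF L])
  interpret E: module R "Ext R i M A" by (rule module_Ext[OF A])
  fix f assume f: "f \<in> Zc i A" "push i \<chi> f \<in> Bd i L"
  have fc: "f \<in> carrier (Coch i A)" by (rule CA.submodule_subset[OF submodule_Zc[OF A] f(1)])
  have pc: "push i \<chi> f \<in> carrier (Coch i L)" by (rule CL.submodule_subset[OF submodule_Bd[OF L] f(2)])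
  have "Ext_map R i M L \<chi> (Bd i A +>\<^bsub>Coch i A\<^esub> f) = \<zero>\<^bsub>Ext R i M L\<^esub>"
    using CL.coset_eq_zero_iff[OF submodule_Bd[OF L] pc] f(2) by (simp add: Ext_map_coset[OF A L h f(1)] zero_Ext)
  then have "Ext_map R i M L \<chi> (Bd i A +>\<^bsub>Coch i A\<^esub> f) = Ext_map R i M L \<chi> \<zero>\<^bsub>Ext R i M A\<^esub>"
    by (simp add: Ext_map_zero[OF A L h])
  then have "Bd i A +>\<^bsub>Coch i A\<^esub> f = \<zero>\<^bsub>Ext R i M A\<^esub>"
    by (rule inj_onD[OF inj]) (use f(1) E.M.zero_closed in \<open>auto simp: carrier_Ext[of i A] simp del: E.M.zero_closed\<close>)
  then show "f \<in> Bd i A" using CA.coset_eq_zero_iff[OF submodule_Bd[OF A] fc] by (simp add: zero_Ext)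
qed

text \<open>Left exactness of Hom: in degree 0 the only coboundary is the zero cochain.\<close>

lemma inj_on_Ext_0:
  assumes A: "module R A" and L: "module R L" and h: "mhom R A L \<chi>" and inj: "inj_on \<chi> (carrier A)"
  shows "inj_on_Ext 0 A L \<chi>"
  unfolding inj_on_Ext_def
proof (intro ballI impI)
  interpret A: module R A by fact
  fix f assume f: "f \<in> Zc 0 A" "push 0 \<chi> f \<in> Bd 0 L"
  have fc: "f \<in> carrier (Coch 0 A)" using f(1) by (simp add: mem_Zc_iff)
  have "f v = \<zero>\<^bsub>A\<^esub>" if v: "v \<in> carrier (F 0)" for v
  proof (rule inj_onD[OF inj])
    have "push 0 \<chi> f v = \<zero>\<^bsub>L\<^esub>" using f(2) v by (simp add: zero_Coch)
    then show "\<chi> (f v) = \<chi> \<zero>\<^bsub>A\<^esub>" using v by (simp add: push_apply mhom_zero[OF A L h])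
    show "f v \<in> carrier A" using fc v by (auto simp: carrier_Coch mhom_closed)
  qed simp
  then have "f = \<zero>\<^bsub>Coch 0 A\<^esub>"
    using fc module.submodule_zero[OF module_Coch[OF A] submodule_Bd[OF A], of 0]
    by (intro Coch_eqI) (auto simp: zero_Coch carrier_Coch mhom_restrict[OF module_F] mhom_const_zero[OF A])
  then show "f \<in> Bd 0 A" by simp
qed

text \<open>The long exact sequence with vanishing connecting maps: the submodule \<open>W\<close> of those cocycles of
  \<open>L\<close> that become coboundaries in \<open>Q\<close> splits \<open>[B(L), Z(L)]\<close> into the parts coming from \<open>A\<close> and \<open>Q\<close>.\<close>

lemma module_length_Ext_exact:
  assumes A: "module R A" and L: "module R L" and Q: "module R Q"
    and \<chi>: "mhom R A L \<chi>" and inj: "inj_on \<chi> (carrier A)"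
    and p: "mhom R L Q p" and surj: "p ` carrier L = carrier Q"
    and ex: "\<And>u. u \<in> carrier L \<Longrightarrow> p u = \<zero>\<^bsub>Q\<^esub> \<longleftrightarrow> u \<in> \<chi> ` carrier A"
    and i: "inj_on_Ext i A L \<chi>" and Si: "inj_on_Ext (Suc i) A L \<chi>"
  shows "module_length R (Ext R i M L) = module_length R (Ext R i M A) + module_length R (Ext R i M Q)"
proof -
  interpret A: module R A by fact
  interpret L: module R L by fact
  interpret Q: module R Q by fact
  interpret CA: module R "Coch i A" by (rule module_Coch[OF A])
  interpret CL: module R "Coch i L" by (rule module_Coch[OF L])
  interpret CQ: module R "Coch i Q" by (rule module_Coch[OF Q])
  note pi = mhom_push[OF L Q p] and ci = mhom_push[OF A L \<chi>]
  have Zcc: "f \<in> carrier (Coch i L)" if "f \<in> Zc i L" for f using that by (simp add: mem_Zc_iff)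
  have inj0: "a = \<zero>\<^bsub>A\<^esub>" if "a \<in> carrier A" "\<chi> a = \<zero>\<^bsub>L\<^esub>" for a
    using inj_onD[OF inj, of a "\<zero>\<^bsub>A\<^esub>"] that by (simp add: mhom_zero[OF A L \<chi>])
  have p\<chi>: "p (\<chi> a) = \<zero>\<^bsub>Q\<^esub>" if "a \<in> carrier A" for a using ex[OF mhom_closed[OF \<chi> that]] that by blast
  \<comment> \<open>\<open>A\<close> is the kernel of \<open>p\<close> and the terms of the
    resolution are free, so a cochain with values in this kernel lifts to \<open>A\<close>.\<close>
  have lift: "\<exists>g. g \<in> carrier (Coch j A) \<and> push j \<chi> g = f"
    if f: "f \<in> carrier (Coch j L)" "\<And>v. v \<in> carrier (F j) \<Longrightarrow> p (f v) = \<zero>\<^bsub>Q\<^esub>" for f j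
  proof -
    have fh: "mhom R (F j) L f" using f(1) by (simp add: carrier_Coch)
    have im: "f v \<in> \<chi> ` carrier A" if "v \<in> carrier (F j)" for v
      using ex[OF mhom_closed[OF fh that]] f(2)[OF that] by blast
    obtain g where g: "mhom R (F j) A g" "\<And>v. v \<in> carrier (F j) \<Longrightarrow> \<chi> (g v) = f v"
      by (rule F_projective[OF A L \<chi> fh], erule im, rule that)
    show ?thesis
    proof (intro exI conjI)
      show gc: "restrict g (carrier (F j)) \<in> carrier (Coch j A)" by (rule restrict_in_Coch[OF g(1)])
      show "push j \<chi> (restrict g (carrier (F j))) = f"
        by (rule Coch_eqI[OF mhom_closed[OF ci gc] f(1)]) (simp add: push_apply g(2))
    qed
  qed
  have liftQ: "\<exists>f. f \<in> carrier (Coch j L) \<and> push j p f = h" if h: "h \<in> carrier (Coch j Q)" for h j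
  proof -
    have hh: "mhom R (F j) Q h" using h by (simp add: carrier_Coch)
    have im: "h v \<in> p ` carrier L" if "v \<in> carrier (F j)" for v using mhom_closed[OF hh that] surj by simp
    obtain g where g: "mhom R (F j) L g" "\<And>v. v \<in> carrier (F j) \<Longrightarrow> p (g v) = h v"
      by (rule F_projective[OF L Q p hh], erule im, rule that)
    show ?thesis
    proof (intro exI conjI)
      show gc: "restrict g (carrier (F j)) \<in> carrier (Coch j L)" by (rule restrict_in_Coch[OF g(1)])
      show "push j p (restrict g (carrier (F j))) = h"
        by (rule Coch_eqI[OF mhom_closed[OF pi gc] h]) (simp add: push_apply g(2))
    qed
  qed
  have liftB: "\<exists>b. b \<in> Bd i L \<and> push i p b = h" if h: "h \<in> Bd i Q" for h
  proof (cases i)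
    case 0
    then show ?thesis using h mhom_zero[OF CL.module_axioms CQ.module_axioms pi] by auto
  next
    case (Suc j)
    then obtain k where k: "k \<in> carrier (Coch j Q)" "h = coboundary R j M k" using h by auto
    obtain g where "g \<in> carrier (Coch j L)" "push j p g = k" using liftQ[OF k(1)] by blast
    then show ?thesis unfolding Suc k(2)
      by (intro exI[of _ "coboundary R j M g"]) (auto simp: push_coboundary)
  qed
  define W where "W = {f \<in> carrier (Coch i L). push i p f \<in> Bd i Q} \<inter> Zc i L"
  have W: "submodule W R (Coch i L)" unfolding W_def
    by (intro CL.submodule_Int submodule_vimage[OF CL.module_axioms CQ.module_axioms pi submodule_Bd[OF Q]] submodule_Zc[OF L])
  have BW: "Bd i L \<subseteq> W"
    using push_Bd[OF L Q p] Bd_subset_Zc[OF L] Zcc unfolding W_def by blast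
  have WZ: "W \<subseteq> Zc i L" unfolding W_def by blast
  have "mlen R (Coch i A) (Bd i A) (Zc i A) = mlen R (Coch i L) (Bd i L) W"
  proof (rule mlen_eq_of_semilin[OF CA.module_axioms CL.module_axioms mhom_semilin[OF ci] submodule_Zc[OF A]
        Bd_subset_Zc[OF A] submodule_Bd[OF L] W BW])
    fix z assume z: "z \<in> Zc i A"
    have "push i p (push i \<chi> z) = \<zero>\<^bsub>Coch i Q\<^esub>"
      using z by (auto simp: push_def zero_Coch mem_Zc_iff carrier_Coch p\<chi> mhom_closed)
    then have "push i p (push i \<chi> z) \<in> Bd i Q" using CQ.submodule_zero[OF submodule_Bd[OF Q]] by simp
    then show "push i \<chi> z \<in> W" using push_Zc[OF A L \<chi> z] Zcc unfolding W_def by blast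
    \<comment> \<open>Here the vanishing of the connecting map into Ext^i(M, A) enters, as
      injectivity of the map on classes in degree i.\<close>
    show "(push i \<chi> z \<in> Bd i L) = (z \<in> Bd i A)"
      using i z push_Bd[OF A L \<chi>] unfolding inj_on_Ext_def by blast
  next
    fix w assume w: "w \<in> W"
    then have wZ: "w \<in> Zc i L" and wB: "push i p w \<in> Bd i Q" unfolding W_def by auto
    have wc: "w \<in> carrier (Coch i L)" by (rule Zcc[OF wZ])
    \<comment> \<open>Subtracting a coboundary of \<open>L\<close> with the same image in
      \<open>Q\<close> leaves a cocycle with values in the image of \<open>A\<close>.\<close>
    obtain b where b: "b \<in> Bd i L" "push i p b = push i p w" using liftB[OF wB] by blast
    have bZ: "b \<in> Zc i L" using b Bd_subset_Zc[OF L] by blast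
    have bc: "b \<in> carrier (Coch i L)" by (rule Zcc[OF bZ])
    let ?d = "w \<ominus>\<^bsub>Coch i L\<^esub> b"
    have dZ: "?d \<in> Zc i L" by (rule CL.submodule_diff[OF submodule_Zc[OF L] wZ bZ])
    have "p (?d v) = \<zero>\<^bsub>Q\<^esub>" if v: "v \<in> carrier (F i)" for v
    proof -
      have c: "w v \<in> carrier L" "b v \<in> carrier L" using wc bc v by (auto simp: carrier_Coch mhom_closed)
      have "p (b v) = p (w v)" using fun_cong[OF b(2), of v] v by (simp add: push_apply)
      then show ?thesis using c mhom_closed[OF p]
        by (simp add: diff_Coch[OF L wc bc v] mhom_diff[OF L Q p] Q.diff_eq_zero_iff)
    qed
    then obtain z where z: "z \<in> carrier (Coch i A)" "push i \<chi> z = ?d" using lift[OF Zcc[OF dZ]] by blast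
    have "z (\<delta> i v) = \<zero>\<^bsub>A\<^esub>" if v: "v \<in> carrier (F (Suc i))" for v
    proof (rule inj0)
      have \<delta>v: "\<delta> i v \<in> carrier (F i)" by (rule mhom_closed[OF mhom_\<delta> v])
      show "z (\<delta> i v) \<in> carrier A" using z(1) \<delta>v by (auto simp: carrier_Coch mhom_closed)
      have "?d (\<delta> i v) = \<zero>\<^bsub>L\<^esub>" using dZ v by (simp add: mem_Zc_iff)
      then show "\<chi> (z (\<delta> i v)) = \<zero>\<^bsub>L\<^esub>" using fun_cong[OF z(2), of "\<delta> i v"] \<delta>v by (simp add: push_apply)
    qed
    then have zZ: "z \<in> Zc i A" using z(1) by (simp add: mem_Zc_iff)
    have "w = push i \<chi> z \<oplus>\<^bsub>Coch i L\<^esub> b"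
      unfolding z(2) using CL.diff_add_cancel[OF wc bc] wc bc by (simp add: CL.M.a_comm)
    then show "\<exists>z\<in>Zc i A. \<exists>b\<in>Bd i L. w = push i \<chi> z \<oplus>\<^bsub>Coch i L\<^esub> b" using zZ b(1) by blast
  qed
  moreover have "mlen R (Coch i L) W (Zc i L) = mlen R (Coch i Q) (Bd i Q) (Zc i Q)"
  proof (rule mlen_eq_of_semilin[OF CL.module_axioms CQ.module_axioms mhom_semilin[OF pi] submodule_Zc[OF L] WZ
        submodule_Bd[OF Q] submodule_Zc[OF Q] Bd_subset_Zc[OF Q] push_Zc[OF L Q p]])
    fix z assume z: "z \<in> Zc i L"
    show "(push i p z \<in> Bd i Q) = (z \<in> W)" using z Zcc[OF z] unfolding W_def by blast
  next
    fix y assume y: "y \<in> Zc i Q"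
    then have yc: "y \<in> carrier (Coch i Q)" by (simp add: mem_Zc_iff)
    obtain g where g: "g \<in> carrier (Coch i L)" "push i p g = y" using liftQ[OF yc] by blast
    let ?dg = "coboundary R i M g"
    have dg: "?dg \<in> carrier (Coch (Suc i) L)" by (rule mhom_closed[OF mhom_coboundary[OF L] g(1)])
    have "p (?dg v) = \<zero>\<^bsub>Q\<^esub>" if v: "v \<in> carrier (F (Suc i))" for v
    proof -
      have "p (g (\<delta> i v)) = y (\<delta> i v)"
        using fun_cong[OF g(2), of "\<delta> i v"] mhom_closed[OF mhom_\<delta> v] by (simp add: push_apply)
      then show ?thesis using y v by (simp add: mem_Zc_iff coboundary_apply)
    qed
    then obtain s where s: "s \<in> carrier (Coch (Suc i) A)" "push (Suc i) \<chi> s = ?dg" using lift[OF dg] by blast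
    have dgB: "?dg \<in> Bd (Suc i) L" using g(1) by simp
    have "s (\<delta> (Suc i) v) = \<zero>\<^bsub>A\<^esub>" if v: "v \<in> carrier (F (Suc (Suc i)))" for v
    proof (rule inj0)
      have \<delta>v: "\<delta> (Suc i) v \<in> carrier (F (Suc i))" by (rule mhom_closed[OF mhom_\<delta> v])
      show "s (\<delta> (Suc i) v) \<in> carrier A" using s(1) \<delta>v by (auto simp: carrier_Coch mhom_closed)
      have "?dg \<in> Zc (Suc i) L" using dgB Bd_subset_Zc[OF L] by blast
      then have "?dg (\<delta> (Suc i) v) = \<zero>\<^bsub>L\<^esub>" using v by (simp add: mem_Zc_iff)
      then show "\<chi> (s (\<delta> (Suc i) v)) = \<zero>\<^bsub>L\<^esub>" using fun_cong[OF s(2), of "\<delta> (Suc i) v"] \<delta>v by (simp add: push_apply)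
    qed
    then have "s \<in> Zc (Suc i) A" using s(1) by (simp add: mem_Zc_iff)
    \<comment> \<open>The class of \<open>s\<close> is the image of the class of \<open>y\<close>
      under the connecting map. \<open>Si\<close> makes it zero, and then \<open>g\<close> corrected
      by \<open>t\<close> is a cocycle over \<open>y\<close>.\<close>
    then have "s \<in> Bd (Suc i) A" using Si dgB s(2) unfolding inj_on_Ext_def by simp
    then obtain t where t: "t \<in> carrier (Coch i A)" "s = coboundary R i M t" by auto
    have pt: "push i \<chi> t \<in> carrier (Coch i L)" by (rule mhom_closed[OF ci t(1)])
    let ?z = "g \<ominus>\<^bsub>Coch i L\<^esub> push i \<chi> t"
    have zc: "?z \<in> carrier (Coch i L)" using g(1) pt by simp
    have "?z (\<delta> i v) = \<zero>\<^bsub>L\<^esub>" if v: "v \<in> carrier (F (Suc i))" for v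
    proof -
      have \<delta>v: "\<delta> i v \<in> carrier (F i)" by (rule mhom_closed[OF mhom_\<delta> v])
      have "\<chi> (t (\<delta> i v)) = g (\<delta> i v)"
        using fun_cong[OF s(2), of v] v by (simp add: push_apply t(2) coboundary_apply)
      moreover have "g (\<delta> i v) \<in> carrier L" using g(1) \<delta>v by (auto simp: carrier_Coch mhom_closed)
      ultimately show ?thesis using \<delta>v
        by (simp add: diff_Coch[OF L g(1) pt \<delta>v] push_apply L.diff_eq_zero_iff)
    qed
    then have zZ: "?z \<in> Zc i L" using zc by (simp add: mem_Zc_iff)
    have "push i p (push i \<chi> t) = \<zero>\<^bsub>Coch i Q\<^esub>"
      using t(1) by (auto simp: push_def zero_Coch carrier_Coch p\<chi> mhom_closed)
    then have "push i p ?z = y \<ominus>\<^bsub>Coch i Q\<^esub> \<zero>\<^bsub>Coch i Q\<^esub>"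
      by (simp add: mhom_diff[OF CL.module_axioms CQ.module_axioms pi g(1) pt] g(2))
    then have "y = push i p ?z \<oplus>\<^bsub>Coch i Q\<^esub> \<zero>\<^bsub>Coch i Q\<^esub>"
      using CQ.diff_add_cancel[OF yc CQ.M.zero_closed] yc by (simp add: CQ.M.a_comm)
    then show "\<exists>z\<in>Zc i L. \<exists>b\<in>Bd i Q. y = push i p z \<oplus>\<^bsub>Coch i Q\<^esub> b"
      using zZ CQ.submodule_zero[OF submodule_Bd[OF Q]] by blast
  qed
  moreover have "mlen R (Coch i L) (Bd i L) (Zc i L) = mlen R (Coch i L) (Bd i L) W + mlen R (Coch i L) W (Zc i L)"
    by (rule CL.mlen_additive[OF submodule_Bd[OF L] W submodule_Zc[OF L] BW WZ])
  ultimately show ?thesis by (simp add: module_length_Ext A L Q)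
qed

end

section \<open>Ext over the quotient by a regular element\<close>

lemma carrier_restr [simp]: "carrier (restr \<rho> X) = carrier X"
  and add_restr [simp]: "add (restr \<rho> X) = add X"
  and zero_restr [simp]: "\<zero>\<^bsub>restr \<rho> X\<^esub> = \<zero>\<^bsub>X\<^esub>"
  and smult_restr [simp]: "a \<odot>\<^bsub>restr \<rho> X\<^esub> u = \<rho> a \<odot>\<^bsub>X\<^esub> u"
  by (simp_all add: restr_def)

lemma mhom_restr:
  assumes "mhom S X Y f" "\<And>a. a \<in> carrier R \<Longrightarrow> \<rho> a \<in> carrier S"
  shows "mhom R (restr \<rho> X) (restr \<rho> Y) f"
  using assms unfolding mhom_def by simp

lemma mhom_of_restr:
  assumes f: "mhom R (restr \<rho> X) (restr \<rho> Y) f" and S: "\<And>s. s \<in> carrier S \<Longrightarrow> \<exists>a\<in>carrier R. s = \<rho> a"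
  shows "mhom S X Y f"
proof (rule mhomI)
  fix s u assume "s \<in> carrier S" "u \<in> carrier X"
  then show "f (s \<odot>\<^bsub>X\<^esub> u) = s \<odot>\<^bsub>Y\<^esub> f u" using S f unfolding mhom_def by fastforce
qed (use f in \<open>simp_all add: mhom_def\<close>)

lemma mhom_fst: "mhom R (direct_sum M N) M fst"
  and mhom_snd: "mhom R (direct_sum M N) N snd"
  by (auto simp: mhom_def direct_sum_def)

locale change_of_rings = resolved R M \<pi> + module_mod_elt R M x +
  S: resolved "R Quot (PIdl\<^bsub>R\<^esub> x)" "mod_elt M x" \<pi>'
  for R (structure) and M (structure) and \<pi> x \<pi>' +
  assumes reg: "regular_on M x"
begin

abbreviation "S \<equiv> R Quot (PIdl x)"
abbreviation "\<rho> \<equiv> (+>) (PIdl x)"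
abbreviation "res X \<equiv> restr \<rho> X"

lemma \<rho>_hom: "\<rho> \<in> ring_hom R S"
  by (rule ideal.rcos_ring_hom[OF ideal_PIdl])

lemma \<rho>_closed: "a \<in> carrier R \<Longrightarrow> \<rho> a \<in> carrier S"
  by (rule ring_hom_closed[OF \<rho>_hom])

lemma \<rho>_surj: "s \<in> carrier S \<Longrightarrow> \<exists>a\<in>carrier R. s = \<rho> a"
  unfolding FactRing_def A_RCOSETS_def' by auto

lemma mhom_res: "mhom S X Y f \<Longrightarrow> mhom R (res X) (res Y) f"
  by (erule mhom_restr) (rule \<rho>_closed)

lemma mhom_of_res: "mhom R (res X) (res Y) f \<Longrightarrow> mhom S X Y f"
  by (erule mhom_of_restr) (rule \<rho>_surj)

lemma \<rho>_x: "\<rho> x = \<zero>\<^bsub>S\<^esub>"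
proof -
  interpret ideal "PIdl x" R by (rule ideal_PIdl)
  show ?thesis using a_rcos_const[OF R.cgenideal_self[OF x]] by (simp add: FactRing_def)
qed

lemma module_res: "module S X \<Longrightarrow> module R (res X)"
  by (rule module_restr[OF _ R.cring_axioms \<rho>_hom])

lemma x_kills: "module S X \<Longrightarrow> u \<in> carrier X \<Longrightarrow> \<rho> x \<odot>\<^bsub>X\<^esub> u = \<zero>\<^bsub>X\<^esub>"
  unfolding \<rho>_x by (rule module.smult_l_null)

lemma proj_x: "u \<in> carrier M \<Longrightarrow> proj (x \<odot>\<^bsub>M\<^esub> u) = \<zero>\<^bsub>mod_elt M x\<^esub>"
  using proj_eq_zero_iff[of "x \<odot>\<^bsub>M\<^esub> u"] x by auto

text \<open>The kernel of F 0 -> M -> M/xM is x F 0 plus the image of the first differential. A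
  0-cocycle with values in a module killed by \<open>x\<close> vanishes on both summands, so it
  descends to M/xM.\<close>

lemma decompose:
  assumes v: "v \<in> carrier (F 0)" and p: "proj (\<pi> v) = \<zero>\<^bsub>mod_elt M x\<^esub>"
  obtains w z where "w \<in> carrier (F 0)" "z \<in> carrier (F (Suc 0))" "v = x \<odot>\<^bsub>F 0\<^esub> w \<oplus>\<^bsub>F 0\<^esub> \<delta> 0 z"
proof -
  interpret F0: module R "F 0" by (rule module_F)
  have \<pi>v: "\<pi> v \<in> carrier M" by (rule mhom_closed[OF mhom_\<pi> v])
  obtain m where m: "m \<in> carrier M" "\<pi> v = x \<odot>\<^bsub>M\<^esub> m" using p proj_eq_zero_iff[OF \<pi>v] by blast
  obtain w where w: "w \<in> carrier (F 0)" "\<pi> w = m" using \<pi>_surj[OF m(1)] by blast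
  have xw: "x \<odot>\<^bsub>F 0\<^esub> w \<in> carrier (F 0)" using x w by simp
  have "\<pi> (v \<ominus>\<^bsub>F 0\<^esub> x \<odot>\<^bsub>F 0\<^esub> w) = \<zero>\<^bsub>M\<^esub>"
    using \<pi>v m w x by (simp add: mhom_diff[OF module_F module_axioms mhom_\<pi> v xw] mhom_smult[OF mhom_\<pi>] diff_eq_zero_iff)
  then obtain z where z: "z \<in> carrier (F (Suc 0))" "v \<ominus>\<^bsub>F 0\<^esub> x \<odot>\<^bsub>F 0\<^esub> w = \<delta> 0 z"
    using ker_\<pi>[of "v \<ominus>\<^bsub>F 0\<^esub> x \<odot>\<^bsub>F 0\<^esub> w"] v xw by auto
  have "v = x \<odot>\<^bsub>F 0\<^esub> w \<oplus>\<^bsub>F 0\<^esub> \<delta> 0 z" unfolding z(2)[symmetric] using F0.diff_add_cancel[OF v xw] by simp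
  then show ?thesis using that w z by blast
qed

text \<open>The only place where the regularity of \<open>x\<close> on \<open>M\<close> enters: \<open>ker \<pi> \<inter> x F 0 = x ker \<pi>\<close>.\<close>

lemma boundary_in_xF:
  assumes w: "w \<in> carrier (F (Suc 0))" and v: "v \<in> carrier (F 0)" and e: "\<delta> 0 w = x \<odot>\<^bsub>F 0\<^esub> v"
  obtains w' t where "w' \<in> carrier (F (Suc 0))" "t \<in> carrier (F (Suc (Suc 0)))"
    "w = x \<odot>\<^bsub>F (Suc 0)\<^esub> w' \<oplus>\<^bsub>F (Suc 0)\<^esub> \<delta> (Suc 0) t"
proof -
  interpret F0: module R "F 0" by (rule module_F)
  interpret F1: module R "F (Suc 0)" by (rule module_F)
  have "x \<odot>\<^bsub>M\<^esub> \<pi> v = \<zero>\<^bsub>M\<^esub>" using \<pi>_\<delta>[OF w] x v by (simp add: e mhom_smult[OF mhom_\<pi>])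
  then have "\<pi> v = \<zero>\<^bsub>M\<^esub>" using reg mhom_closed[OF mhom_\<pi> v] unfolding regular_on_def by blast
  then obtain w' where w': "w' \<in> carrier (F (Suc 0))" "v = \<delta> 0 w'" using ker_\<pi>[OF v] by blast
  have xw: "x \<odot>\<^bsub>F (Suc 0)\<^esub> w' \<in> carrier (F (Suc 0))" using x w' by simp
  have "\<delta> 0 (w \<ominus>\<^bsub>F (Suc 0)\<^esub> x \<odot>\<^bsub>F (Suc 0)\<^esub> w') = \<zero>\<^bsub>F 0\<^esub>"
    using x w' v by (simp add: mhom_diff[OF module_F module_F mhom_\<delta> w xw] mhom_smult[OF mhom_\<delta>] e F0.diff_eq_zero_iff)
  then obtain t where t: "t \<in> carrier (F (Suc (Suc 0)))" "w \<ominus>\<^bsub>F (Suc 0)\<^esub> x \<odot>\<^bsub>F (Suc 0)\<^esub> w' = \<delta> (Suc 0) t"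
    using ker_\<delta>[of "w \<ominus>\<^bsub>F (Suc 0)\<^esub> x \<odot>\<^bsub>F (Suc 0)\<^esub> w'" 0] w xw by auto
  have "w = x \<odot>\<^bsub>F (Suc 0)\<^esub> w' \<oplus>\<^bsub>F (Suc 0)\<^esub> \<delta> (Suc 0) t"
    unfolding t(2)[symmetric] using F1.diff_add_cancel[OF w xw] by simp
  then show ?thesis using that w'(1) t(1) by blast
qed

text \<open>The resolution over the quotient ring remains exact when read over \<open>R\<close>, and
  \<open>F 0\<close> and \<open>F (Suc 0)\<close> are free over \<open>R\<close>; so the projection
  M -> M/xM lifts through two steps.\<close>

lemma comparison:
  obtains \<phi>0 \<phi>1 where "mhom R (F 0) (res (S.F 0)) \<phi>0" "mhom R (F (Suc 0)) (res (S.F (Suc 0))) \<phi>1"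
    "\<And>v. v \<in> carrier (F 0) \<Longrightarrow> \<pi>' (\<phi>0 v) = proj (\<pi> v)"
    "\<And>w. w \<in> carrier (F (Suc 0)) \<Longrightarrow> S.\<delta> 0 (\<phi>1 w) = \<phi>0 (\<delta> 0 w)"
proof -
  have f: "mhom R (F 0) (res (mod_elt M x)) (\<lambda>v. proj (\<pi> v))" by (rule mhom_compose[OF mhom_\<pi> mhom_proj])
  have im: "proj (\<pi> v) \<in> \<pi>' ` carrier (res (S.F 0))" if "v \<in> carrier (F 0)" for v
    using S.\<pi>_surj[OF proj_closed[OF mhom_closed[OF mhom_\<pi> that]]] by auto
  obtain \<phi>0 where \<phi>0: "mhom R (F 0) (res (S.F 0)) \<phi>0" "\<And>v. v \<in> carrier (F 0) \<Longrightarrow> \<pi>' (\<phi>0 v) = proj (\<pi> v)"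
    by (rule F_projective[OF module_res[OF S.module_F] module_res[OF module_mod_elt]
          mhom_res[OF S.mhom_\<pi>] f], erule im, rule that)
  have im: "\<phi>0 (\<delta> 0 w) \<in> S.\<delta> 0 ` carrier (res (S.F (Suc 0)))" if w: "w \<in> carrier (F (Suc 0))" for w
  proof -
    have \<delta>w: "\<delta> 0 w \<in> carrier (F 0)" by (rule mhom_closed[OF mhom_\<delta> w])
    have "\<pi>' (\<phi>0 (\<delta> 0 w)) = proj \<zero>\<^bsub>M\<^esub>" by (simp add: \<phi>0(2)[OF \<delta>w] \<pi>_\<delta>[OF w])
    also have "\<dots> = \<zero>\<^bsub>mod_elt M x\<^esub>" using mhom_zero[OF module_axioms module_res[OF module_mod_elt] mhom_proj] by simp
    finally show ?thesis using S.ker_\<pi>[of "\<phi>0 (\<delta> 0 w)"] mhom_closed[OF \<phi>0(1) \<delta>w] by auto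
  qed
  obtain \<phi>1 where "mhom R (F (Suc 0)) (res (S.F (Suc 0))) \<phi>1"
    "\<And>w. w \<in> carrier (F (Suc 0)) \<Longrightarrow> S.\<delta> 0 (\<phi>1 w) = \<phi>0 (\<delta> 0 w)"
    by (rule F_projective[OF module_res[OF S.module_F] module_res[OF S.module_F]
          mhom_res[OF S.mhom_\<delta>] mhom_compose[OF mhom_\<delta> \<phi>0(1)]], erule im, rule that)
  with \<phi>0 show ?thesis using that by blast
qed

definition pull :: "nat \<Rightarrow> ((nat \<Rightarrow> 'a) \<Rightarrow> nat \<Rightarrow> 'a set) \<Rightarrow> ((nat \<Rightarrow> 'a set) \<Rightarrow> 'p) \<Rightarrow> (nat \<Rightarrow> 'a) \<Rightarrow> 'p" where
  "pull i \<phi> f = (\<lambda>v\<in>carrier (F i). f (\<phi> v))"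

lemma pull_apply: "v \<in> carrier (F i) \<Longrightarrow> pull i \<phi> f v = f (\<phi> v)"
  by (simp add: pull_def)

lemma pull_closed:
  assumes \<phi>: "mhom R (F i) (res (S.F i)) \<phi>" and f: "f \<in> carrier (S.Coch i Q)"
  shows "pull i \<phi> f \<in> carrier (Coch i (res Q))"
proof -
  have "mhom S (S.F i) Q f" using f by (simp add: S.carrier_Coch)
  then have "mhom R (F i) (res Q) (\<lambda>v. f (\<phi> v))" by (rule mhom_compose[OF \<phi> mhom_res])
  then show ?thesis unfolding pull_def by (rule restrict_in_Coch)
qed

lemma semilin_pull:
  assumes \<phi>: "mhom R (F i) (res (S.F i)) \<phi>"
  shows "semilin S R (S.Coch i Q) (Coch i (res Q)) (pull i \<phi>)"
proof -
  have \<phi>c: "\<phi> v \<in> carrier (S.F i)" if "v \<in> carrier (F i)" for v using mhom_closed[OF \<phi> that] by simp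
  have sm: "pull i \<phi> (\<rho> a \<odot>\<^bsub>S.Coch i Q\<^esub> f) = a \<odot>\<^bsub>Coch i (res Q)\<^esub> pull i \<phi> f" for a f
    by (auto simp: pull_def smult_Coch S.smult_Coch \<phi>c)
  show ?thesis unfolding semilin_def
  proof (intro conjI ballI)
    show "pull i \<phi> f \<in> carrier (Coch i (res Q))" if "f \<in> carrier (S.Coch i Q)" for f by (rule pull_closed[OF \<phi> that])
    show "pull i \<phi> (f \<oplus>\<^bsub>S.Coch i Q\<^esub> g) = pull i \<phi> f \<oplus>\<^bsub>Coch i (res Q)\<^esub> pull i \<phi> g" for f g
      by (auto simp: pull_def add_Coch S.add_Coch \<phi>c)
    show "\<exists>a\<in>carrier R. \<forall>f\<in>carrier (S.Coch i Q). pull i \<phi> (s \<odot>\<^bsub>S.Coch i Q\<^esub> f) = a \<odot>\<^bsub>Coch i (res Q)\<^esub> pull i \<phi> f"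
      if s: "s \<in> carrier S" for s
      using \<rho>_surj[OF s] sm by blast
    show "\<exists>s\<in>carrier S. \<forall>f\<in>carrier (S.Coch i Q). pull i \<phi> (s \<odot>\<^bsub>S.Coch i Q\<^esub> f) = a \<odot>\<^bsub>Coch i (res Q)\<^esub> pull i \<phi> f"
      if a: "a \<in> carrier R" for a
      using \<rho>_closed[OF a] sm by blast
  qed
qed

text \<open>Both sides are Hom(M/xM, Q). Pulling back along \<phi>0 is onto on cocycles because a
  cocycle on \<open>F 0\<close> factors through M/xM and so gives one on \<open>S.F 0\<close>. It is
  injective because \<phi>0 reaches all of \<open>S.F 0\<close> up to boundaries, on which cocycles
  vanish.\<close>

lemma module_length_Ext_0:
  assumes Q: "module S Q"
  shows "module_length S (Ext S 0 (mod_elt M x) Q) = module_length R (Ext R 0 M (res Q))"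
proof -
  have QR: "module R (res Q)" by (rule module_res[OF Q])
  interpret Q: module S Q by fact
  interpret QR: module R "res Q" by fact
  interpret C: module R "Coch 0 (res Q)" by (rule module_Coch[OF QR])
  interpret D: module S "S.Coch 0 Q" by (rule S.module_Coch[OF Q])
  obtain \<phi>0 \<phi>1 where \<phi>: "mhom R (F 0) (res (S.F 0)) \<phi>0" "mhom R (F (Suc 0)) (res (S.F (Suc 0))) \<phi>1"
    "\<And>v. v \<in> carrier (F 0) \<Longrightarrow> \<pi>' (\<phi>0 v) = proj (\<pi> v)"
    "\<And>w. w \<in> carrier (F (Suc 0)) \<Longrightarrow> S.\<delta> 0 (\<phi>1 w) = \<phi>0 (\<delta> 0 w)" by (rule comparison, rule that)
  have "mlen S (S.Coch 0 Q) (S.Bd 0 Q) (S.Zc 0 Q) = mlen R (Coch 0 (res Q)) (Bd 0 (res Q)) (Zc 0 (res Q))"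
  proof (rule mlen_eq_of_semilin[OF D.module_axioms C.module_axioms semilin_pull[OF \<phi>(1)] S.submodule_Zc[OF Q]
        S.Bd_subset_Zc[OF Q] submodule_Bd[OF QR] submodule_Zc[OF QR] Bd_subset_Zc[OF QR]])
    fix f assume f: "f \<in> S.Zc 0 Q"
    then have fc: "f \<in> carrier (S.Coch 0 Q)" by (simp add: S.mem_Zc_iff)
    have fh: "mhom S (S.F 0) Q f" using fc by (simp add: S.carrier_Coch)
    have "f (\<phi>0 (\<delta> 0 w)) = \<zero>\<^bsub>Q\<^esub>" if w: "w \<in> carrier (F (Suc 0))" for w
      using f mhom_closed[OF \<phi>(2) w] by (simp add: S.mem_Zc_iff flip: \<phi>(4)[OF w])
    then show "pull 0 \<phi>0 f \<in> Zc 0 (res Q)"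
      using pull_closed[OF \<phi>(1) fc] by (simp add: mem_Zc_iff pull_apply mhom_closed[OF mhom_\<delta>])
    show "(pull 0 \<phi>0 f \<in> Bd 0 (res Q)) = (f \<in> S.Bd 0 Q)"
    proof
      assume "f \<in> S.Bd 0 Q"
      then have "f = \<zero>\<^bsub>S.Coch 0 Q\<^esub>" by simp
      then show "pull 0 \<phi>0 f \<in> Bd 0 (res Q)"
        using semilin_zero[OF D.module_axioms C.module_axioms semilin_pull[OF \<phi>(1)]] by simp
    next
      assume "pull 0 \<phi>0 f \<in> Bd 0 (res Q)"
      then have p0: "f (\<phi>0 v) = \<zero>\<^bsub>Q\<^esub>" if "v \<in> carrier (F 0)" for v
        using that pull_apply[OF that, of \<phi>0 f] by (simp add: zero_Coch)
      have "f y = \<zero>\<^bsub>S.Coch 0 Q\<^esub> y" if y: "y \<in> carrier (S.F 0)" for y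
      proof -
        interpret G: module S "S.F 0" by (rule S.module_F)
        have "\<pi>' y \<in> carrier (mod_elt M x)" by (rule mhom_closed[OF S.mhom_\<pi> y])
        then obtain m where m: "m \<in> carrier M" "\<pi>' y = proj m" by (auto simp: carrier_mod_elt)
        obtain v where v: "v \<in> carrier (F 0)" "\<pi> v = m" using \<pi>_surj[OF m(1)] by blast
        have \<phi>v: "\<phi>0 v \<in> carrier (S.F 0)" using mhom_closed[OF \<phi>(1) v(1)] by simp
        have "\<pi>' (y \<ominus>\<^bsub>S.F 0\<^esub> \<phi>0 v) = \<zero>\<^bsub>mod_elt M x\<^esub>"
          using m v proj_closed[OF m(1)]
          by (simp add: mhom_diff[OF S.module_F module_mod_elt S.mhom_\<pi> y \<phi>v] \<phi>(3) S.diff_eq_zero_iff)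
        then obtain z where z: "z \<in> carrier (S.F (Suc 0))" "y \<ominus>\<^bsub>S.F 0\<^esub> \<phi>0 v = S.\<delta> 0 z"
          using S.ker_\<pi>[of "y \<ominus>\<^bsub>S.F 0\<^esub> \<phi>0 v"] y \<phi>v by auto
        have \<delta>z: "S.\<delta> 0 z \<in> carrier (S.F 0)" by (rule mhom_closed[OF S.mhom_\<delta> z(1)])
        have "y = \<phi>0 v \<oplus>\<^bsub>S.F 0\<^esub> S.\<delta> 0 z" unfolding z(2)[symmetric] using G.diff_add_cancel[OF y \<phi>v] by simp
        then have "f y = f (\<phi>0 v) \<oplus>\<^bsub>Q\<^esub> f (S.\<delta> 0 z)" by (simp add: mhom_add[OF fh \<phi>v \<delta>z])
        then show ?thesis using p0[OF v(1)] f z(1) y by (simp add: S.mem_Zc_iff S.zero_Coch)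
      qed
      then have "f = \<zero>\<^bsub>S.Coch 0 Q\<^esub>" by (intro S.Coch_eqI[OF fc]) auto
      then show "f \<in> S.Bd 0 Q" by simp
    qed
  next
    fix g assume g: "g \<in> Zc 0 (res Q)"
    then have gc: "g \<in> carrier (Coch 0 (res Q))" by (simp add: mem_Zc_iff)
    have gh: "mhom R (F 0) (res Q) g" using gc by (simp add: carrier_Coch)
    obtain f where f: "mhom R (res (S.F 0)) (res Q) f"
      "\<And>u w. u \<in> carrier (res (S.F 0)) \<Longrightarrow> w \<in> carrier (F 0) \<Longrightarrow> proj (\<pi> w) = \<pi>' u \<Longrightarrow> f u = g w"
    proof (rule mhom_factor[OF module_res[OF S.module_F] module_F module_res[OF module_mod_elt] QR
          mhom_res[OF S.mhom_\<pi>] mhom_compose[OF mhom_\<pi> mhom_proj] gh])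
      fix u assume "u \<in> carrier (res (S.F 0))"
      then have "\<pi>' u \<in> carrier (mod_elt M x)" using mhom_closed[OF S.mhom_\<pi>] by simp
      then obtain m where m: "m \<in> carrier M" "\<pi>' u = proj m" by (auto simp: carrier_mod_elt)
      then show "\<pi>' u \<in> (\<lambda>w. proj (\<pi> w)) ` carrier (F 0)" using \<pi>_surj[OF m(1)] by auto
    next
      fix v assume v: "v \<in> carrier (F 0)" "proj (\<pi> v) = \<zero>\<^bsub>res (mod_elt M x)\<^esub>"
      have v2: "proj (\<pi> v) = \<zero>\<^bsub>mod_elt M x\<^esub>" using v(2) by simp
      obtain w z where w: "w \<in> carrier (F 0)" "z \<in> carrier (F (Suc 0))" "v = x \<odot>\<^bsub>F 0\<^esub> w \<oplus>\<^bsub>F 0\<^esub> \<delta> 0 z"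
        by (rule decompose[OF v(1) v2])
      interpret F0: module R "F 0" by (rule module_F)
      have xw: "x \<odot>\<^bsub>F 0\<^esub> w \<in> carrier (F 0)" using x w(1) by simp
      have "g w \<in> carrier Q" using mhom_closed[OF gh w(1)] by simp
      then have "g (x \<odot>\<^bsub>F 0\<^esub> w) = \<zero>\<^bsub>Q\<^esub>" using mhom_smult[OF gh x w(1)] by (simp add: x_kills[OF Q])
      moreover have "g (\<delta> 0 z) = \<zero>\<^bsub>Q\<^esub>" using g w(2) by (simp add: mem_Zc_iff)
      ultimately show "g v = \<zero>\<^bsub>res Q\<^esub>" unfolding w(3)
        by (simp add: mhom_add[OF gh xw mhom_closed[OF mhom_\<delta> w(2)]])
    qed (rule that)
    let ?f = "restrict f (carrier (S.F 0))"
    have "mhom S (S.F 0) Q f" by (rule mhom_of_res[OF f(1)])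
    then have fc: "?f \<in> carrier (S.Coch 0 Q)" by (rule S.restrict_in_Coch)
    have "f (S.\<delta> 0 y) = \<zero>\<^bsub>Q\<^esub>" if y: "y \<in> carrier (S.F (Suc 0))" for y
    proof -
      interpret F0: module R "F 0" by (rule module_F)
      \<comment> \<open>Zero is an admissible preimage, as \<open>S.\<delta> 0 y\<close> goes to
        zero in M/xM.\<close>
      have "f (S.\<delta> 0 y) = g \<zero>\<^bsub>F 0\<^esub>"
      proof (rule f(2))
        show "proj (\<pi> \<zero>\<^bsub>F 0\<^esub>) = \<pi>' (S.\<delta> 0 y)"
          using mhom_zero[OF module_F module_res[OF module_mod_elt] mhom_compose[OF mhom_\<pi> mhom_proj]]
          by (simp add: S.\<pi>_\<delta>[OF y])
      qed (use mhom_closed[OF S.mhom_\<delta> y] in simp_all)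
      then show ?thesis using mhom_zero[OF module_F QR gh] by simp
    qed
    then have fZ: "?f \<in> S.Zc 0 Q" using fc mhom_closed[OF S.mhom_\<delta>] by (simp add: S.mem_Zc_iff)
    have "g = pull 0 \<phi>0 ?f"
    proof (rule Coch_eqI[OF gc pull_closed[OF \<phi>(1) fc]])
      fix v assume v: "v \<in> carrier (F 0)"
      then show "g v = pull 0 \<phi>0 ?f v"
        using mhom_closed[OF \<phi>(1) v] f(2)[of "\<phi>0 v" v] \<phi>(3)[OF v] by (simp add: pull_apply)
    qed
    then have "g = pull 0 \<phi>0 ?f \<oplus>\<^bsub>Coch 0 (res Q)\<^esub> \<zero>\<^bsub>Coch 0 (res Q)\<^esub>" using gc by simp
    then show "\<exists>z\<in>S.Zc 0 Q. \<exists>b\<in>Bd 0 (res Q). g = pull 0 \<phi>0 z \<oplus>\<^bsub>Coch 0 (res Q)\<^esub> b"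
      using fZ by auto
  qed
  then show ?thesis by (simp add: module_length_Ext[OF QR] S.module_length_Ext[OF Q])
qed

text \<open>Pulling back along \<phi>1 is bijective on classes. For surjectivity a map in the other
  direction is built: with E = F 0/xF 0, the map \<psi> from \<open>S.F 0\<close> to E lifts \<pi>',
  a 1-cocycle g on \<open>F (Suc 0)\<close> descends to the kernel of E -> M/xM by
  \<open>boundary_in_xF\<close>, and composing with \<psi> gives a cocycle f over the quotient ring.
  The projection F 0 -> E and \<psi> after \<phi>0 agree over M/xM; their difference \<theta> yields
  a cochain h such that g is the pullback of f plus the coboundary of h.\<close>

lemma module_length_Ext_1:
  assumes Q: "module S Q"
  shows "module_length S (Ext S 1 (mod_elt M x) Q) = module_length R (Ext R 1 M (res Q))"
proof -
  have QR: "module R (res Q)" by (rule module_res[OF Q])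
  interpret Q: module S Q by fact
  interpret QR: module R "res Q" by fact
  interpret C: module R "Coch (Suc 0) (res Q)" by (rule module_Coch[OF QR])
  interpret D: module S "S.Coch (Suc 0) Q" by (rule S.module_Coch[OF Q])
  interpret F0: module R "F 0" by (rule module_F)
  interpret F1: module R "F (Suc 0)" by (rule module_F)
  interpret G0: module R "res (S.F 0)" by (rule module_res[OF S.module_F])
  interpret G1: module R "res (S.F (Suc 0))" by (rule module_res[OF S.module_F])
  obtain \<phi>0 \<phi>1 where \<phi>: "mhom R (F 0) (res (S.F 0)) \<phi>0" "mhom R (F (Suc 0)) (res (S.F (Suc 0))) \<phi>1"
    "\<And>v. v \<in> carrier (F 0) \<Longrightarrow> \<pi>' (\<phi>0 v) = proj (\<pi> v)"
    "\<And>w. w \<in> carrier (F (Suc 0)) \<Longrightarrow> S.\<delta> 0 (\<phi>1 w) = \<phi>0 (\<delta> 0 w)" by (rule comparison, rule that)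
  have \<phi>0c: "\<phi>0 v \<in> carrier (S.F 0)" if "v \<in> carrier (F 0)" for v using mhom_closed[OF \<phi>(1) that] by simp
  have \<phi>1c: "\<phi>1 v \<in> carrier (S.F (Suc 0))" if "v \<in> carrier (F (Suc 0))" for v using mhom_closed[OF \<phi>(2) that] by simp
  have \<delta>'R: "mhom R (res (S.F (Suc i))) (res (S.F i)) (S.\<delta> i)" for i by (rule mhom_res[OF S.mhom_\<delta>])
  have \<pi>'R: "mhom R (res (S.F 0)) (res (mod_elt M x)) \<pi>'" by (rule mhom_res[OF S.mhom_\<pi>])
  have NR: "module R (res (mod_elt M x))" by (rule module_res[OF module_mod_elt])
  interpret NR: module R "res (mod_elt M x)" by (rule NR)
  have "mlen S (S.Coch (Suc 0) Q) (S.Bd (Suc 0) Q) (S.Zc (Suc 0) Q)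
      = mlen R (Coch (Suc 0) (res Q)) (Bd (Suc 0) (res Q)) (Zc (Suc 0) (res Q))"
  proof (rule mlen_eq_of_semilin[OF D.module_axioms C.module_axioms semilin_pull[OF \<phi>(2)] S.submodule_Zc[OF Q]
        S.Bd_subset_Zc[OF Q] submodule_Bd[OF QR] submodule_Zc[OF QR] Bd_subset_Zc[OF QR]])
    fix f assume f: "f \<in> S.Zc (Suc 0) Q"
    then have fc: "f \<in> carrier (S.Coch (Suc 0) Q)" by (simp add: S.mem_Zc_iff)
    have fh: "mhom R (res (S.F (Suc 0))) (res Q) f"
      using fc by (intro mhom_res) (simp add: S.carrier_Coch)
    have f\<delta>: "f (S.\<delta> (Suc 0) t) = \<zero>\<^bsub>Q\<^esub>" if "t \<in> carrier (S.F (Suc (Suc 0)))" for t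
      using f that by (simp add: S.mem_Zc_iff)
    \<comment> \<open>By exactness a cocycle vanishes on the whole kernel of
      \<open>S.\<delta> 0\<close>; this takes the place of a comparison map in degree 2.\<close>
    have f_ker: "f y = \<zero>\<^bsub>Q\<^esub>" if "y \<in> carrier (S.F (Suc 0))" "S.\<delta> 0 y = \<zero>\<^bsub>S.F 0\<^esub>" for y
      using S.ker_\<delta>[OF that] f\<delta> by blast
    have "f (\<phi>1 (\<delta> (Suc 0) t)) = \<zero>\<^bsub>Q\<^esub>" if t: "t \<in> carrier (F (Suc (Suc 0)))" for t
    proof (rule f_ker)
      have \<delta>t: "\<delta> (Suc 0) t \<in> carrier (F (Suc 0))" by (rule mhom_closed[OF mhom_\<delta> t])
      show "\<phi>1 (\<delta> (Suc 0) t) \<in> carrier (S.F (Suc 0))" by (rule \<phi>1c[OF \<delta>t])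
      show "S.\<delta> 0 (\<phi>1 (\<delta> (Suc 0) t)) = \<zero>\<^bsub>S.F 0\<^esub>"
        using mhom_zero[OF module_F G0.module_axioms \<phi>(1)] by (simp add: \<phi>(4)[OF \<delta>t] \<delta>_\<delta>[OF t])
    qed
    then show "pull (Suc 0) \<phi>1 f \<in> Zc (Suc 0) (res Q)"
      using pull_closed[OF \<phi>(2) fc] by (simp add: mem_Zc_iff pull_apply mhom_closed[OF mhom_\<delta>])
    show "(pull (Suc 0) \<phi>1 f \<in> Bd (Suc 0) (res Q)) = (f \<in> S.Bd (Suc 0) Q)"
    proof
      assume "f \<in> S.Bd (Suc 0) Q"
      then obtain h where h: "h \<in> carrier (S.Coch 0 Q)" "f = coboundary S 0 (mod_elt M x) h" by auto
      have "pull (Suc 0) \<phi>1 f = coboundary R 0 M (pull 0 \<phi>0 h)"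
      proof (rule Coch_eqI[OF pull_closed[OF \<phi>(2) fc] mhom_closed[OF mhom_coboundary[OF QR] pull_closed[OF \<phi>(1) h(1)]]])
        fix v assume v: "v \<in> carrier (F (Suc 0))"
        then show "pull (Suc 0) \<phi>1 f v = coboundary R 0 M (pull 0 \<phi>0 h) v"
          using \<phi>1c[OF v] by (simp add: pull_apply coboundary_apply mhom_closed[OF mhom_\<delta>] h(2) S.coboundary_apply \<phi>(4))
      qed
      then show "pull (Suc 0) \<phi>1 f \<in> Bd (Suc 0) (res Q)" using pull_closed[OF \<phi>(1) h(1)] by simp
    next
      assume "pull (Suc 0) \<phi>1 f \<in> Bd (Suc 0) (res Q)"
      then obtain h where h: "h \<in> carrier (Coch 0 (res Q))" "pull (Suc 0) \<phi>1 f = coboundary R 0 M h" by auto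
      have hh: "mhom R (F 0) (res Q) h" using h by (simp add: carrier_Coch)
      have h\<delta>: "h (\<delta> 0 z) = f (\<phi>1 z)" if "z \<in> carrier (F (Suc 0))" for z
        using fun_cong[OF h(2), of z] that by (simp add: pull_apply coboundary_apply)
      let ?W = "direct_sum (F 0) (res (S.F (Suc 0)))"
      have W: "module R ?W" by (rule module_direct_sum[OF module_F G1.module_axioms])
      \<comment> \<open>\<open>S.F 0\<close> is the sum of the images of \<phi>0 and
        \<open>S.\<delta> 0\<close>. A cochain k with coboundary f is defined by h on the first and
        by f on the second; \<open>mhom_factor\<close> turns their consistency into the kernel
        condition.\<close>
      let ?\<beta> = "\<lambda>w. \<phi>0 (fst w) \<oplus>\<^bsub>res (S.F 0)\<^esub> S.\<delta> 0 (snd w)"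
      let ?g = "\<lambda>w. h (fst w) \<oplus>\<^bsub>res Q\<^esub> f (snd w)"
      have \<beta>: "mhom R ?W (res (S.F 0)) ?\<beta>"
        by (rule mhom_add_fun[OF G0.module_axioms mhom_compose[OF mhom_fst \<phi>(1)] mhom_compose[OF mhom_snd \<delta>'R]])
      have g: "mhom R ?W (res Q) ?g"
        by (rule mhom_add_fun[OF QR mhom_compose[OF mhom_fst hh] mhom_compose[OF mhom_snd fh]])
      have Wc: "(v, y) \<in> carrier ?W \<longleftrightarrow> v \<in> carrier (F 0) \<and> y \<in> carrier (S.F (Suc 0))" for v y
        by (simp add: direct_sum_def)
      obtain k where k: "mhom R (res (S.F 0)) (res Q) k"
        "\<And>u w. u \<in> carrier (res (S.F 0)) \<Longrightarrow> w \<in> carrier ?W \<Longrightarrow> ?\<beta> w = u \<Longrightarrow> k u = ?g w"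
      proof (rule mhom_factor[OF G0.module_axioms W G0.module_axioms QR mhom_ident \<beta> g])
        fix u assume u: "u \<in> carrier (res (S.F 0))"
        then have "\<pi>' u \<in> carrier (mod_elt M x)" using mhom_closed[OF S.mhom_\<pi>] by simp
        then obtain m where m: "m \<in> carrier M" "\<pi>' u = proj m" by (auto simp: carrier_mod_elt)
        obtain v where v: "v \<in> carrier (F 0)" "\<pi> v = m" using \<pi>_surj[OF m(1)] by blast
        have \<phi>v: "\<phi>0 v \<in> carrier (res (S.F 0))" using \<phi>0c[OF v(1)] by simp
        have "\<pi>' (u \<ominus>\<^bsub>res (S.F 0)\<^esub> \<phi>0 v) = \<zero>\<^bsub>mod_elt M x\<^esub>"
          using m v proj_closed[OF m(1)] NR.diff_eq_zero_iff[of "proj m" "proj m"]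
          by (simp add: mhom_diff[OF G0.module_axioms NR \<pi>'R u \<phi>v] \<phi>(3))
        then obtain z where z: "z \<in> carrier (S.F (Suc 0))" "u \<ominus>\<^bsub>res (S.F 0)\<^esub> \<phi>0 v = S.\<delta> 0 z"
          using S.ker_\<pi>[of "u \<ominus>\<^bsub>res (S.F 0)\<^esub> \<phi>0 v"] G0.M.minus_closed[OF u \<phi>v] by auto
        have "u = ?\<beta> (v, z)" using G0.diff_add_cancel[OF u \<phi>v] by (simp add: z(2))
        moreover have "(v, z) \<in> carrier ?W" using v(1) z(1) by (simp add: Wc)
        ultimately show "u \<in> ?\<beta> ` carrier ?W" by (rule image_eqI)
      next
        fix w assume w: "w \<in> carrier ?W" "?\<beta> w = \<zero>\<^bsub>res (S.F 0)\<^esub>"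
        obtain v y where vy: "w = (v, y)" by (cases w)
        have v: "v \<in> carrier (F 0)" and y: "y \<in> carrier (S.F (Suc 0))" using w(1) unfolding vy Wc by auto
        have \<phi>v: "\<phi>0 v \<in> carrier (res (S.F 0))" and \<delta>y: "S.\<delta> 0 y \<in> carrier (res (S.F 0))"
          using \<phi>0c[OF v] mhom_closed[OF S.mhom_\<delta> y] by simp_all
        have e: "\<phi>0 v \<oplus>\<^bsub>S.F 0\<^esub> S.\<delta> 0 y = \<zero>\<^bsub>S.F 0\<^esub>" using w(2) by (simp add: vy)
        have "\<pi>' (\<phi>0 v) \<oplus>\<^bsub>res (mod_elt M x)\<^esub> \<pi>' (S.\<delta> 0 y) = \<pi>' \<zero>\<^bsub>S.F 0\<^esub>"
          using mhom_add[OF \<pi>'R \<phi>v \<delta>y] e by simp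
        moreover have "\<pi>' \<zero>\<^bsub>S.F 0\<^esub> = \<zero>\<^bsub>res (mod_elt M x)\<^esub>" using mhom_zero[OF G0.module_axioms NR \<pi>'R] by simp
        moreover have "\<pi>' (S.\<delta> 0 y) = \<zero>\<^bsub>res (mod_elt M x)\<^esub>" by (simp add: S.\<pi>_\<delta>[OF y])
        moreover have "\<pi>' (\<phi>0 v) \<in> carrier (res (mod_elt M x))" by (rule mhom_closed[OF \<pi>'R \<phi>v])
        ultimately have "\<pi>' (\<phi>0 v) = \<zero>\<^bsub>res (mod_elt M x)\<^esub>" by (metis NR.M.r_zero)
        \<comment> \<open>Now v = x u + \<delta> 0 z. Both \<phi>0 and h kill x u, so \<phi>1 z + y
          is a cycle, f vanishes on it, and h v + f y = f (\<phi>1 z) + f y = 0.\<close>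
        then have pv: "proj (\<pi> v) = \<zero>\<^bsub>mod_elt M x\<^esub>" by (simp add: \<phi>(3)[OF v])
        obtain u z where uz: "u \<in> carrier (F 0)" "z \<in> carrier (F (Suc 0))" "v = x \<odot>\<^bsub>F 0\<^esub> u \<oplus>\<^bsub>F 0\<^esub> \<delta> 0 z"
          by (rule decompose[OF v pv])
        have xu: "x \<odot>\<^bsub>F 0\<^esub> u \<in> carrier (F 0)" using x uz(1) by simp
        have \<delta>z: "\<delta> 0 z \<in> carrier (F 0)" by (rule mhom_closed[OF mhom_\<delta> uz(2)])
        have "\<phi>0 (x \<odot>\<^bsub>F 0\<^esub> u) = \<zero>\<^bsub>S.F 0\<^esub>"
          using mhom_smult[OF \<phi>(1) x uz(1)] x_kills[OF S.module_F \<phi>0c[OF uz(1)]] by simp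
        then have "\<phi>0 v = \<zero>\<^bsub>res (S.F 0)\<^esub> \<oplus>\<^bsub>res (S.F 0)\<^esub> S.\<delta> 0 (\<phi>1 z)"
          unfolding uz(3) mhom_add[OF \<phi>(1) xu \<delta>z] by (simp add: \<phi>(4)[OF uz(2)])
        then have "\<phi>0 v = S.\<delta> 0 (\<phi>1 z)"
          using G0.M.l_zero[OF mhom_closed[OF \<delta>'R, of "\<phi>1 z" 0]] \<phi>1c[OF uz(2)] by simp
        then have "S.\<delta> 0 (\<phi>1 z \<oplus>\<^bsub>S.F (Suc 0)\<^esub> y) = \<zero>\<^bsub>S.F 0\<^esub>"
          using e by (simp add: mhom_add[OF S.mhom_\<delta> \<phi>1c[OF uz(2)] y])
        moreover have "\<phi>1 z \<oplus>\<^bsub>S.F (Suc 0)\<^esub> y \<in> carrier (S.F (Suc 0))"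
          using G1.M.a_closed[of "\<phi>1 z" y] \<phi>1c[OF uz(2)] y by simp
        ultimately have "f (\<phi>1 z \<oplus>\<^bsub>S.F (Suc 0)\<^esub> y) = \<zero>\<^bsub>Q\<^esub>" by (intro f_ker)
        then have "f (\<phi>1 z) \<oplus>\<^bsub>Q\<^esub> f y = \<zero>\<^bsub>Q\<^esub>"
          using mhom_add[OF fh, of "\<phi>1 z" y] \<phi>1c[OF uz(2)] y by simp
        moreover have "h v = f (\<phi>1 z)"
        proof -
          have "h (x \<odot>\<^bsub>F 0\<^esub> u) = \<zero>\<^bsub>Q\<^esub>"
            using mhom_smult[OF hh x uz(1)] mhom_closed[OF hh uz(1)] by (simp add: x_kills[OF Q])
          moreover have "f (\<phi>1 z) \<in> carrier Q" using mhom_closed[OF fh, of "\<phi>1 z"] \<phi>1c[OF uz(2)] by simp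
          ultimately show ?thesis unfolding uz(3) mhom_add[OF hh xu \<delta>z] by (simp add: h\<delta>[OF uz(2)])
        qed
        ultimately show "?g w = \<zero>\<^bsub>res Q\<^esub>" by (simp add: vy)
      qed (rule that)
      have "mhom S (S.F 0) Q k" by (rule mhom_of_res[OF k(1)])
      then have kc: "restrict k (carrier (S.F 0)) \<in> carrier (S.Coch 0 Q)" by (rule S.restrict_in_Coch)
      have "f = coboundary S 0 (mod_elt M x) (restrict k (carrier (S.F 0)))"
      proof (rule S.Coch_eqI[OF fc mhom_closed[OF S.mhom_coboundary[OF Q] kc]])
        fix y assume y: "y \<in> carrier (S.F (Suc 0))"
        have \<delta>y: "S.\<delta> 0 y \<in> carrier (S.F 0)" by (rule mhom_closed[OF S.mhom_\<delta> y])
        have z: "\<phi>0 \<zero>\<^bsub>F 0\<^esub> = \<zero>\<^bsub>res (S.F 0)\<^esub>" by (rule mhom_zero[OF module_F G0.module_axioms \<phi>(1)])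
        have "k (S.\<delta> 0 y) = ?g (\<zero>\<^bsub>F 0\<^esub>, y)"
        proof (rule k(2))
          show "(\<zero>\<^bsub>F 0\<^esub>, y) \<in> carrier ?W" using y by (simp add: Wc)
          show "?\<beta> (\<zero>\<^bsub>F 0\<^esub>, y) = S.\<delta> 0 y" using G0.M.l_zero[of "S.\<delta> 0 y"] \<delta>y z by simp
        qed (use \<delta>y in simp)
        also have "\<dots> = f y"
          using mhom_zero[OF module_F QR hh] mhom_closed[OF fh, of y] y by simp
        finally show "f y = coboundary S 0 (mod_elt M x) (restrict k (carrier (S.F 0))) y"
          using y \<delta>y by (simp add: S.coboundary_apply)
      qed
      then show "f \<in> S.Bd (Suc 0) Q" using kc by simp
    qed
  next
    fix g assume g: "g \<in> Zc (Suc 0) (res Q)"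
    then have gc: "g \<in> carrier (Coch (Suc 0) (res Q))" by (simp add: mem_Zc_iff)
    have gh: "mhom R (F (Suc 0)) (res Q) g" using gc by (simp add: carrier_Coch)
    have g\<delta>: "g (\<delta> (Suc 0) t) = \<zero>\<^bsub>Q\<^esub>" if "t \<in> carrier (F (Suc (Suc 0)))" for t
      using g that by (simp add: mem_Zc_iff)
    interpret E: module_mod_elt R "F 0" x by (intro module_mod_elt.intro module_F module_mod_elt_axioms.intro x)
    let ?E = "mod_elt (F 0) x"
    have ER: "module R (res ?E)" by (rule module_res[OF E.module_mod_elt])
    interpret ER: module R "res ?E" by (rule ER)
    have Ep: "mhom R (F 0) (res ?E) E.proj" by (rule E.mhom_proj)
    obtain \<tau> where \<tau>: "mhom R (res ?E) (res (mod_elt M x)) \<tau>"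
      "\<And>u w. u \<in> carrier (res ?E) \<Longrightarrow> w \<in> carrier (F 0) \<Longrightarrow> E.proj w = u \<Longrightarrow> \<tau> u = proj (\<pi> w)"
    proof (rule mhom_factor[OF ER module_F ER NR mhom_ident Ep mhom_compose[OF mhom_\<pi> mhom_proj]])
      fix u assume "u \<in> carrier (res ?E)"
      then show "u \<in> E.proj ` carrier (F 0)" by (simp add: E.carrier_mod_elt)
    next
      fix w assume w: "w \<in> carrier (F 0)" "E.proj w = \<zero>\<^bsub>res ?E\<^esub>"
      then obtain v where v: "v \<in> carrier (F 0)" "w = x \<odot>\<^bsub>F 0\<^esub> v" using E.proj_eq_zero_iff[OF w(1)] by auto
      show "proj (\<pi> w) = \<zero>\<^bsub>res (mod_elt M x)\<^esub>"
        using proj_x[OF mhom_closed[OF mhom_\<pi> v(1)]] by (simp add: v(2) mhom_smult[OF mhom_\<pi> x v(1)])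
    qed (rule that)
    have \<tau>p: "\<tau> (E.proj w) = proj (\<pi> w)" if "w \<in> carrier (F 0)" for w
      using \<tau>(2)[of "E.proj w" w] E.proj_closed[OF that] that by simp
    have im: "\<pi>' y \<in> \<tau> ` carrier ?E" if y: "y \<in> carrier (S.F 0)" for y
    proof -
      have "\<pi>' y \<in> carrier (mod_elt M x)" by (rule mhom_closed[OF S.mhom_\<pi> y])
      then obtain m where m: "m \<in> carrier M" "\<pi>' y = proj m" by (auto simp: carrier_mod_elt)
      obtain v where v: "v \<in> carrier (F 0)" "\<pi> v = m" using \<pi>_surj[OF m(1)] by blast
      then have "\<pi>' y = \<tau> (E.proj v)" using m by (simp add: \<tau>p)
      then show ?thesis using E.proj_closed[OF v(1)] by blast
    qed
    \<comment> \<open>The reason for E: \<open>S.F 0\<close> is free over the quotient ring and can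
      be lifted only into modules over that ring, so the target is F 0/xF 0 instead of
      \<open>F 0\<close>.\<close>
    obtain \<psi> where \<psi>: "mhom S (S.F 0) ?E \<psi>" "\<And>y. y \<in> carrier (S.F 0) \<Longrightarrow> \<tau> (\<psi> y) = \<pi>' y"
      by (rule S.F_projective[OF E.module_mod_elt module_mod_elt mhom_of_res[OF \<tau>(1)] S.mhom_\<pi>],
          erule im, rule that)
    have \<psi>R: "mhom R (res (S.F 0)) (res ?E) \<psi>" by (rule mhom_res[OF \<psi>(1)])
    let ?\<beta> = "\<lambda>w. E.proj (\<delta> 0 w)"
    have \<beta>: "mhom R (F (Suc 0)) (res ?E) ?\<beta>" by (rule mhom_compose[OF mhom_\<delta> Ep])
    have image: "u \<in> ?\<beta> ` carrier (F (Suc 0))" if u: "u \<in> carrier ?E" "\<tau> u = \<zero>\<^bsub>mod_elt M x\<^esub>" for u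
    proof -
      obtain v where v: "v \<in> carrier (F 0)" "u = E.proj v" using u(1) by (auto simp: E.carrier_mod_elt)
      have pv: "proj (\<pi> v) = \<zero>\<^bsub>mod_elt M x\<^esub>" using u(2) by (simp add: v(2) \<tau>p[OF v(1)])
      obtain w z where w: "w \<in> carrier (F 0)" "z \<in> carrier (F (Suc 0))" "v = x \<odot>\<^bsub>F 0\<^esub> w \<oplus>\<^bsub>F 0\<^esub> \<delta> 0 z"
        by (rule decompose[OF v(1) pv])
      have xw: "x \<odot>\<^bsub>F 0\<^esub> w \<in> carrier (F 0)" using x w(1) by simp
      have \<delta>z: "\<delta> 0 z \<in> carrier (F 0)" by (rule mhom_closed[OF mhom_\<delta> w(2)])
      have "E.proj (x \<odot>\<^bsub>F 0\<^esub> w) = \<zero>\<^bsub>res ?E\<^esub>" using E.proj_eq_zero_iff[OF xw] w(1) by auto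
      then have "u = E.proj (\<delta> 0 z)"
        unfolding v(2) w(3) mhom_add[OF Ep xw \<delta>z] using ER.M.l_zero[OF mhom_closed[OF Ep \<delta>z]] by simp
      then show ?thesis using w(2) by (rule image_eqI)
    qed
    \<comment> \<open>\<open>boundary_in_xF\<close> makes g factor through \<beta>: in the resulting
      expression for w, the multiple of x is killed since \<open>Q\<close> is killed by x, and the
      boundary since g is a cocycle.\<close>
    have ker: "g w = \<zero>\<^bsub>res Q\<^esub>" if w: "w \<in> carrier (F (Suc 0))" "?\<beta> w = \<zero>\<^bsub>res ?E\<^esub>" for w
    proof -
      have "E.proj (\<delta> 0 w) = \<zero>\<^bsub>?E\<^esub>" using w(2) by simp
      then obtain v where v: "v \<in> carrier (F 0)" "\<delta> 0 w = x \<odot>\<^bsub>F 0\<^esub> v"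
        using E.proj_eq_zero_iff[OF mhom_closed[OF mhom_\<delta> w(1)]] by auto
      obtain w' t where w': "w' \<in> carrier (F (Suc 0))" "t \<in> carrier (F (Suc (Suc 0)))"
        "w = x \<odot>\<^bsub>F (Suc 0)\<^esub> w' \<oplus>\<^bsub>F (Suc 0)\<^esub> \<delta> (Suc 0) t" by (rule boundary_in_xF[OF w(1) v])
      have xw: "x \<odot>\<^bsub>F (Suc 0)\<^esub> w' \<in> carrier (F (Suc 0))" using x w'(1) by simp
      have "g (x \<odot>\<^bsub>F (Suc 0)\<^esub> w') = \<zero>\<^bsub>Q\<^esub>"
        using mhom_smult[OF gh x w'(1)] mhom_closed[OF gh w'(1)] by (simp add: x_kills[OF Q])
      then show ?thesis
        unfolding w'(3) mhom_add[OF gh xw mhom_closed[OF mhom_\<delta> w'(2)]] by (simp add: g\<delta>[OF w'(2)])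
    qed
    obtain f where f: "mhom R (res (S.F (Suc 0))) (res Q) f"
      "\<And>y w. y \<in> carrier (res (S.F (Suc 0))) \<Longrightarrow> w \<in> carrier (F (Suc 0)) \<Longrightarrow> ?\<beta> w = \<psi> (S.\<delta> 0 y) \<Longrightarrow> f y = g w"
    proof (rule mhom_factor[OF G1.module_axioms module_F ER QR mhom_compose[OF \<delta>'R \<psi>R] \<beta> gh])
      fix y assume "y \<in> carrier (res (S.F (Suc 0)))"
      then have y: "y \<in> carrier (S.F (Suc 0))" by simp
      have \<delta>y: "S.\<delta> 0 y \<in> carrier (S.F 0)" by (rule mhom_closed[OF S.mhom_\<delta> y])
      show "\<psi> (S.\<delta> 0 y) \<in> ?\<beta> ` carrier (F (Suc 0))"
        by (rule image[OF mhom_closed[OF \<psi>(1) \<delta>y]]) (simp add: \<psi>(2)[OF \<delta>y] S.\<pi>_\<delta>[OF y])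
    qed (erule ker, assumption, rule that)
    \<comment> \<open>Both terms lie over the same element of M/xM, so \<theta> takes its values in
      the kernel of \<tau>, which is the image of \<beta>.\<close>
    let ?\<theta> = "\<lambda>v. E.proj v \<ominus>\<^bsub>res ?E\<^esub> \<psi> (\<phi>0 v)"
    have \<theta>: "mhom R (F 0) (res ?E) ?\<theta>" by (rule mhom_diff_fun[OF ER Ep mhom_compose[OF \<phi>(1) \<psi>R]])
    obtain h where h: "mhom R (F 0) (res Q) h"
      "\<And>v w. v \<in> carrier (F 0) \<Longrightarrow> w \<in> carrier (F (Suc 0)) \<Longrightarrow> ?\<beta> w = ?\<theta> v \<Longrightarrow> h v = g w"
    proof (rule mhom_factor[OF module_F module_F ER QR \<theta> \<beta> gh])
      fix v assume v: "v \<in> carrier (F 0)"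
      have c: "E.proj v \<in> carrier (res ?E)" "\<psi> (\<phi>0 v) \<in> carrier (res ?E)"
        using E.proj_closed[OF v] mhom_closed[OF \<psi>(1) \<phi>0c[OF v]] by simp_all
      have "\<tau> (?\<theta> v) = proj (\<pi> v) \<ominus>\<^bsub>res (mod_elt M x)\<^esub> proj (\<pi> v)"
        by (simp add: mhom_diff[OF ER NR \<tau>(1) c] \<tau>p[OF v] \<psi>(2)[OF \<phi>0c[OF v]] \<phi>(3)[OF v])
      also have "\<dots> = \<zero>\<^bsub>mod_elt M x\<^esub>"
        using NR.diff_eq_zero_iff[of "proj (\<pi> v)" "proj (\<pi> v)"] proj_closed[OF mhom_closed[OF mhom_\<pi> v]] by simp
      finally show "?\<theta> v \<in> ?\<beta> ` carrier (F (Suc 0))"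
        by (intro image) (use mhom_closed[OF \<theta> v] in simp_all)
    qed (erule ker, assumption, rule that)
    have \<beta>0: "?\<beta> \<zero>\<^bsub>F (Suc 0)\<^esub> = \<zero>\<^bsub>?E\<^esub>" using mhom_zero[OF module_F ER \<beta>] by simp
    let ?f = "restrict f (carrier (S.F (Suc 0)))" and ?h = "restrict h (carrier (F 0))"
    have "mhom S (S.F (Suc 0)) Q f" by (rule mhom_of_res[OF f(1)])
    then have fc: "?f \<in> carrier (S.Coch (Suc 0) Q)" by (rule S.restrict_in_Coch)
    have "f (S.\<delta> (Suc 0) t) = \<zero>\<^bsub>Q\<^esub>" if t: "t \<in> carrier (S.F (Suc (Suc 0)))" for t
    proof -
      have "f (S.\<delta> (Suc 0) t) = g \<zero>\<^bsub>F (Suc 0)\<^esub>"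
      proof (rule f(2))
        show "?\<beta> \<zero>\<^bsub>F (Suc 0)\<^esub> = \<psi> (S.\<delta> 0 (S.\<delta> (Suc 0) t))"
          using mhom_zero[OF S.module_F E.module_mod_elt \<psi>(1)] by (simp add: \<beta>0 S.\<delta>_\<delta>[OF t])
      qed (use mhom_closed[OF S.mhom_\<delta> t] in simp_all)
      then show ?thesis using mhom_zero[OF module_F QR gh] by simp
    qed
    then have fZ: "?f \<in> S.Zc (Suc 0) Q" using fc mhom_closed[OF S.mhom_\<delta>] by (simp add: S.mem_Zc_iff)
    have hc: "?h \<in> carrier (Coch 0 (res Q))" by (rule restrict_in_Coch[OF h(1)])
    have dh: "coboundary R 0 M ?h \<in> carrier (Coch (Suc 0) (res Q))" by (rule mhom_closed[OF mhom_coboundary[OF QR] hc])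
    have "g = pull (Suc 0) \<phi>1 ?f \<oplus>\<^bsub>Coch (Suc 0) (res Q)\<^esub> coboundary R 0 M ?h"
    proof (rule Coch_eqI[OF gc C.M.a_closed[OF pull_closed[OF \<phi>(2) fc] dh]])
      fix w assume w: "w \<in> carrier (F (Suc 0))"
      have \<delta>w: "\<delta> 0 w \<in> carrier (F 0)" by (rule mhom_closed[OF mhom_\<delta> w])
      have y: "\<phi>1 w \<in> carrier (S.F (Suc 0))" by (rule \<phi>1c[OF w])
      have \<delta>y: "S.\<delta> 0 (\<phi>1 w) \<in> carrier (S.F 0)" by (rule mhom_closed[OF S.mhom_\<delta> y])
      have "\<psi> (S.\<delta> 0 (\<phi>1 w)) \<in> ?\<beta> ` carrier (F (Suc 0))"
        by (rule image[OF mhom_closed[OF \<psi>(1) \<delta>y]]) (simp add: \<psi>(2)[OF \<delta>y] S.\<pi>_\<delta>[OF y])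
      then obtain w1 where w1: "w1 \<in> carrier (F (Suc 0))" "?\<beta> w1 = \<psi> (S.\<delta> 0 (\<phi>1 w))" by auto
      have fg: "f (\<phi>1 w) = g w1" using f(2)[of "\<phi>1 w" w1] y w1 by simp
      have wd: "w \<ominus>\<^bsub>F (Suc 0)\<^esub> w1 \<in> carrier (F (Suc 0))" using w w1 by simp
      \<comment> \<open>\<open>w1\<close> is the preimage through which f (\<phi>1 w) is computed;
        so w - w1 serves for h at \<delta> 0 w, and the two values add up to g w.\<close>
      have "?\<beta> (w \<ominus>\<^bsub>F (Suc 0)\<^esub> w1) = ?\<theta> (\<delta> 0 w)"
        unfolding mhom_diff[OF module_F ER \<beta> w w1(1)] w1(2) \<phi>(4)[OF w] ..
      then have "h (\<delta> 0 w) = g (w \<ominus>\<^bsub>F (Suc 0)\<^esub> w1)" by (rule h(2)[OF \<delta>w wd])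
      also have "\<dots> = g w \<ominus>\<^bsub>res Q\<^esub> g w1" by (rule mhom_diff[OF module_F QR gh w w1(1)])
      finally have "f (\<phi>1 w) \<oplus>\<^bsub>res Q\<^esub> h (\<delta> 0 w) = g w"
        unfolding fg by (simp only: QR.diff_add_cancel[OF mhom_closed[OF gh w] mhom_closed[OF gh w1(1)]])
      then show "g w = (pull (Suc 0) \<phi>1 ?f \<oplus>\<^bsub>Coch (Suc 0) (res Q)\<^esub> coboundary R 0 M ?h) w"
        using w y \<delta>w by (simp add: add_Coch pull_apply coboundary_apply)
    qed
    then show "\<exists>z\<in>S.Zc (Suc 0) Q. \<exists>b\<in>Bd (Suc 0) (res Q). g = pull (Suc 0) \<phi>1 z \<oplus>\<^bsub>Coch (Suc 0) (res Q)\<^esub> b"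
      using fZ hc by auto
  qed
  then show ?thesis by (simp add: module_length_Ext[OF QR] S.module_length_Ext[OF Q] One_nat_def)
qed

end

section \<open>Reduction modulo \<open>x\<close>\<close>

lemma (in cring) noetherian_Quot:
  assumes R: "noetherian_ring R" and A: "ideal A R"
  shows "noetherian_ring (R Quot A)"
proof -
  interpret A: ideal A R by fact
  interpret Q: cring "R Quot A" by (rule A.quotient_is_cring[OF cring_axioms])
  interpret h: ring_hom_ring R "R Quot A" "(+>) A" by (rule A.rcos_ring_hom_ring)
  show ?thesis
  proof (rule Q.noetherian_ringI)
    fix B assume B: "ideal B (R Quot A)"
    have pre: "ideal {r \<in> carrier R. A +> r \<in> K} R" if "ideal K (R Quot A)" for K
      by (rule h.ideal_vimage[OF that])
    obtain T where T: "T \<subseteq> carrier R" "finite T" "{r \<in> carrier R. A +> r \<in> B} = Idl T"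
      using noetherian_ring.finetely_gen[OF R pre[OF B]] by auto
    let ?T = "(+>) A ` T"
    have Tc: "?T \<subseteq> carrier (R Quot A)" using T(1) h.hom_closed by auto
    have "T \<subseteq> {r \<in> carrier R. A +> r \<in> B}" unfolding T(3) by (rule genideal_self[OF T(1)])
    then have "?T \<subseteq> B" by auto
    then have 1: "Idl\<^bsub>R Quot A\<^esub> ?T \<subseteq> B" by (rule Q.genideal_minimal[OF B])
    have "T \<subseteq> {r \<in> carrier R. A +> r \<in> Idl\<^bsub>R Quot A\<^esub> ?T}" using T(1) Q.genideal_self[OF Tc] by auto
    then have 2: "Idl T \<subseteq> {r \<in> carrier R. A +> r \<in> Idl\<^bsub>R Quot A\<^esub> ?T}"
      by (rule genideal_minimal[OF pre[OF Q.genideal_ideal[OF Tc]]])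
    have "B \<subseteq> Idl\<^bsub>R Quot A\<^esub> ?T"
    proof
      fix b assume b: "b \<in> B"
      then have "b \<in> carrier (R Quot A)" using ideal.Icarr[OF B] by simp
      then obtain r where "r \<in> carrier R" "b = A +> r" unfolding FactRing_def A_RCOSETS_def' by auto
      then show "b \<in> Idl\<^bsub>R Quot A\<^esub> ?T" using b 2 T(3) by auto
    qed
    then show "\<exists>C\<subseteq>carrier (R Quot A). finite C \<and> B = Idl\<^bsub>R Quot A\<^esub> C"
      using 1 Tc T(2) by (intro exI[of _ ?T]) auto
  qed
qed

lemma ideal_prod_hom_image:
  assumes h: "h \<in> ring_hom R S" and R: "ring R" and A: "A \<subseteq> carrier R" and B: "B \<subseteq> carrier R"
  shows "ideal_prod S (h ` A) (h ` B) = h ` ideal_prod R A B"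
proof -
  interpret ring R by fact
  have c: "s \<in> carrier R" if "s \<in> ideal_prod R A B" for s
    using that by induction (use A B in auto)
  show ?thesis
  proof (intro equalityI subsetI)
    fix s assume "s \<in> ideal_prod S (h ` A) (h ` B)"
    then show "s \<in> h ` ideal_prod R A B"
    proof induction
      case (prod i j)
      then obtain a b where ab: "a \<in> A" "b \<in> B" "i = h a" "j = h b" by auto
      then have "a \<in> carrier R" "b \<in> carrier R" using A B by blast+
      then have "i \<otimes>\<^bsub>S\<^esub> j = h (a \<otimes>\<^bsub>R\<^esub> b)" using ab by (simp add: ring_hom_mult[OF h])
      then show ?case using ideal_prod.prod[of a A b B R] ab by auto
    next
      case (sum s t)
      then obtain a b where ab: "a \<in> ideal_prod R A B" "b \<in> ideal_prod R A B" "s = h a" "t = h b" by auto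
      then have "s \<oplus>\<^bsub>S\<^esub> t = h (a \<oplus>\<^bsub>R\<^esub> b)" using ring_hom_add[OF h c c] by auto
      then show ?case using ideal_prod.sum[of a R A B b] ab by auto
    qed
  next
    fix s assume "s \<in> h ` ideal_prod R A B"
    then obtain a where a: "a \<in> ideal_prod R A B" "s = h a" by auto
    have "h a \<in> ideal_prod S (h ` A) (h ` B)" using a(1)
    proof induction
      case (prod i j)
      then have "h (i \<otimes>\<^bsub>R\<^esub> j) = h i \<otimes>\<^bsub>S\<^esub> h j" using ring_hom_mult[OF h, of i j] A B by auto
      then show ?case using prod by (auto intro: ideal_prod.prod)
    next
      case (sum s t)
      then show ?case using ring_hom_add[OF h c c, of s t] by (auto intro: ideal_prod.sum)
    qed
    then show "s \<in> ideal_prod S (h ` A) (h ` B)" using a by simp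
  qed
qed

context module_mod_elt
begin

abbreviation "Sx \<equiv> R Quot (PIdl x)"
abbreviation "rx \<equiv> (+>) (PIdl x)"

lemma carrier_Sx: "carrier Sx = rx ` carrier R"
  unfolding FactRing_def A_RCOSETS_def' by auto

lemma semilin_proj: "semilin R Sx M (mod_elt M x) proj"
  unfolding semilin_def
proof (intro conjI ballI)
  show "\<exists>s\<in>carrier Sx. \<forall>u\<in>carrier M. proj (a \<odot>\<^bsub>M\<^esub> u) = s \<odot>\<^bsub>mod_elt M x\<^esub> proj u" if "a \<in> carrier R" for a
    using proj_smult[OF that] that unfolding carrier_Sx by blast
  show "\<exists>a\<in>carrier R. \<forall>u\<in>carrier M. proj (a \<odot>\<^bsub>M\<^esub> u) = s \<odot>\<^bsub>mod_elt M x\<^esub> proj u" if "s \<in> carrier Sx" for s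
    using that proj_smult unfolding carrier_Sx by blast
qed (auto simp: proj_closed proj_add)

lemma fin_gen_mod_elt:
  assumes "fin_gen_module R M" shows "fin_gen_module Sx (mod_elt M x)"
proof -
  interpret N: module Sx "mod_elt M x" by (rule module_mod_elt)
  obtain A where A: "finite A" "A \<subseteq> carrier M" "\<And>H. submodule H R M \<Longrightarrow> A \<subseteq> H \<Longrightarrow> H = carrier M"
    using assms unfolding fin_gen_module_def by blast
  have "H = carrier (mod_elt M x)" if H: "submodule H Sx (mod_elt M x)" "proj ` A \<subseteq> H" for H
  proof -
    have "{u \<in> carrier M. proj u \<in> H} = carrier M"
      using A(2) H(2) by (intro A(3) semilin_vimage[OF module_axioms module_mod_elt semilin_proj H(1)]) auto
    then have "carrier (mod_elt M x) \<subseteq> H" unfolding carrier_mod_elt by auto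
    then show ?thesis using N.submodule_subset[OF H(1)] by blast
  qed
  moreover have "finite (proj ` A)" "proj ` A \<subseteq> carrier (mod_elt M x)" using A proj_closed by auto
  ultimately show ?thesis unfolding fin_gen_module_def using module_mod_elt by blast
qed

lemma ideal_pow_image:
  assumes I: "ideal I R"
  shows "ideal_pow Sx (rx ` I) n = rx ` ideal_pow R I n"
proof (induction n)
  case 0
  show ?case unfolding ideal_pow_0 by (rule carrier_Sx)
next
  case (Suc n)
  have "I \<subseteq> carrier R" "ideal_pow R I n \<subseteq> carrier R"
    using ideal.Icarr[OF I] ideal.Icarr[OF R.ideal_ideal_pow[OF I]] by auto
  then show ?case unfolding ideal_pow_Suc Suc
    by (intro ideal_prod_hom_image[OF ideal.rcos_ring_hom[OF ideal_PIdl] R.ring_axioms])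
qed

lemma ideal_smult_image_proj:
  assumes A: "A \<subseteq> carrier R"
  shows "ideal_smult (rx ` A) (mod_elt M x) = proj ` ideal_smult A M"
proof (intro equalityI subsetI)
  fix X assume "X \<in> ideal_smult (rx ` A) (mod_elt M x)"
  then show "X \<in> proj ` ideal_smult A M"
  proof induction
    case (smult s Y)
    then obtain a u where au: "a \<in> A" "s = rx a" "u \<in> carrier M" "Y = proj u" by (auto simp: carrier_mod_elt)
    then have "s \<odot>\<^bsub>mod_elt M x\<^esub> Y = proj (a \<odot>\<^bsub>M\<^esub> u)" using A proj_smult[of a u] by auto
    moreover have "a \<odot>\<^bsub>M\<^esub> u \<in> ideal_smult A M" using au by (intro ideal_smult.smult)
    ultimately show ?case by (rule image_eqI)
  next
    case (sum Y Z)
    then obtain u v where uv: "u \<in> ideal_smult A M" "v \<in> ideal_smult A M" "Y = proj u" "Z = proj v" by auto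
    then have "Y \<oplus>\<^bsub>mod_elt M x\<^esub> Z = proj (u \<oplus>\<^bsub>M\<^esub> v)"
      using proj_add[OF ideal_smult_closed[OF A uv(1)] ideal_smult_closed[OF A uv(2)]] by simp
    moreover have "u \<oplus>\<^bsub>M\<^esub> v \<in> ideal_smult A M" using uv by (intro ideal_smult.sum)
    ultimately show ?case by (rule image_eqI)
  qed
next
  fix X assume "X \<in> proj ` ideal_smult A M"
  then obtain u where u: "u \<in> ideal_smult A M" "X = proj u" by auto
  have "proj u \<in> ideal_smult (rx ` A) (mod_elt M x)" using u(1)
  proof induction
    case (smult a u)
    then have "proj (a \<odot>\<^bsub>M\<^esub> u) = rx a \<odot>\<^bsub>mod_elt M x\<^esub> proj u" using A by (intro proj_smult) auto
    then show ?case using smult proj_closed by (auto intro!: ideal_smult.smult)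
  next
    case (sum u v)
    then show ?case
      by (simp add: proj_add[OF ideal_smult_closed[OF A sum.hyps(1)] ideal_smult_closed[OF A sum.hyps(2)]] ideal_smult.sum)
  qed
  then show "X \<in> ideal_smult (rx ` A) (mod_elt M x)" using u(2) by simp
qed

lemma pow_smult_mod_elt:
  assumes I: "ideal I R"
  shows "pow_smult Sx (rx ` I) n (mod_elt M x) = proj ` pow_smult R I n M"
proof -
  have "ideal_pow R I n \<subseteq> carrier R" using ideal.Icarr[OF R.ideal_ideal_pow[OF I]] by auto
  then show ?thesis unfolding ideal_pow_image[OF I] by (rule ideal_smult_image_proj)
qed

lemma ideal_image:
  assumes I: "ideal I R" shows "ideal (rx ` I) Sx"
  by (rule R.ring_ideal_imp_quot_ideal[OF ideal_PIdl I])

lemma module_pow_quot_mod_elt: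
  assumes I: "ideal I R" shows "module Sx (pow_quot Sx (rx ` I) n (mod_elt M x))"
  by (intro module.module_fact_module module.submodule_pow_smult module_mod_elt ideal_image[OF I])

text \<open>The target, M/xM modulo the n-th power of the image of \<open>I\<close>, is M/(I^n M +
  xM) in disguise. Its kernel is described by elements because it is to be matched with the image of
  multiplication by \<open>x\<close>.\<close>

lemma reduction_map:
  assumes I: "ideal I R"
  obtains p where "mhom R (pow_quot R I n M) (restr rx (pow_quot Sx (rx ` I) n (mod_elt M x))) p"
    "p ` carrier (pow_quot R I n M) = carrier (pow_quot Sx (rx ` I) n (mod_elt M x))"
    "\<And>u. u \<in> carrier M \<Longrightarrow>
      p (pow_smult R I n M +>\<^bsub>M\<^esub> u) = \<zero>\<^bsub>pow_quot Sx (rx ` I) n (mod_elt M x)\<^esub> \<longleftrightarrow>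
      (\<exists>w\<in>pow_smult R I n M. \<exists>v\<in>carrier M. u = w \<oplus>\<^bsub>M\<^esub> x \<odot>\<^bsub>M\<^esub> v)"
proof -
  let ?N = "mod_elt M x" and ?P = "pow_smult R I n M" and ?P' = "pow_smult Sx (rx ` I) n (mod_elt M x)"
  let ?L = "pow_quot R I n M" and ?L' = "pow_quot Sx (rx ` I) n (mod_elt M x)"
  interpret N: module Sx ?N by (rule module_mod_elt)
  have P: "submodule ?P R M" by (rule submodule_pow_smult[OF I])
  have P': "submodule ?P' Sx ?N" by (rule N.submodule_pow_smult[OF ideal_image[OF I]])
  have L: "module R ?L" by (rule module_fact_module[OF P])
  have L': "module Sx ?L'" by (rule N.module_fact_module[OF P'])
  have rxh: "rx \<in> ring_hom R Sx" by (rule ideal.rcos_ring_hom[OF ideal_PIdl])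
  have LR: "module R (restr rx ?L')" by (rule module_restr[OF L' R.cring_axioms rxh])
  let ?\<eta> = "\<lambda>u. ?P' +>\<^bsub>?N\<^esub> proj u"
  have "mhom R (restr rx ?N) (restr rx ?L') (\<lambda>X. ?P' +>\<^bsub>?N\<^esub> X)"
    by (rule mhom_restr[OF N.mhom_coset[OF P']]) (rule ring_hom_closed[OF rxh])
  then have \<eta>: "mhom R M (restr rx ?L') ?\<eta>" by (rule mhom_compose[OF mhom_proj])
  have \<eta>0: "?\<eta> u = \<zero>\<^bsub>?L'\<^esub> \<longleftrightarrow> (\<exists>w\<in>?P. \<exists>v\<in>carrier M. u = w \<oplus>\<^bsub>M\<^esub> x \<odot>\<^bsub>M\<^esub> v)" if u: "u \<in> carrier M" for u
  proof -
    have "?\<eta> u = \<zero>\<^bsub>?L'\<^esub> \<longleftrightarrow> proj u \<in> ?P'"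
      unfolding zero_fact_module by (rule N.coset_eq_zero_iff[OF P' proj_closed[OF u]])
    also have "\<dots> \<longleftrightarrow> proj u \<in> proj ` ?P" by (simp only: pow_smult_mod_elt[OF I])
    also have "\<dots> \<longleftrightarrow> (\<exists>w\<in>?P. u \<ominus>\<^bsub>M\<^esub> w \<in> xM)"
      using coset_eq_iff[OF submodule_xM u] submodule_subset[OF P] by (auto simp: proj_def image_iff)
    also have "\<dots> \<longleftrightarrow> (\<exists>w\<in>?P. \<exists>v\<in>carrier M. u = w \<oplus>\<^bsub>M\<^esub> x \<odot>\<^bsub>M\<^esub> v)"
    proof (intro bex_cong refl)
      fix w assume "w \<in> ?P"
      then have w: "w \<in> carrier M" by (rule submodule_subset[OF P])
      show "u \<ominus>\<^bsub>M\<^esub> w \<in> xM \<longleftrightarrow> (\<exists>v\<in>carrier M. u = w \<oplus>\<^bsub>M\<^esub> x \<odot>\<^bsub>M\<^esub> v)"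
      proof
        assume "u \<ominus>\<^bsub>M\<^esub> w \<in> xM"
        then obtain v where "v \<in> carrier M" "u \<ominus>\<^bsub>M\<^esub> w = x \<odot>\<^bsub>M\<^esub> v" by (auto simp: xM_def)
        then show "\<exists>v\<in>carrier M. u = w \<oplus>\<^bsub>M\<^esub> x \<odot>\<^bsub>M\<^esub> v" using diff_add_cancel[OF u w] by metis
      next
        assume "\<exists>v\<in>carrier M. u = w \<oplus>\<^bsub>M\<^esub> x \<odot>\<^bsub>M\<^esub> v"
        then show "u \<ominus>\<^bsub>M\<^esub> w \<in> xM" using w x add_diff_cancel by (auto simp: xM_def)
      qed
    qed
    finally show ?thesis .
  qed
  obtain p where p: "mhom R ?L (restr rx ?L') p"
    "\<And>X u. X \<in> carrier ?L \<Longrightarrow> u \<in> carrier M \<Longrightarrow> ?P +>\<^bsub>M\<^esub> u = X \<Longrightarrow> p X = ?\<eta> u"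
  proof (rule mhom_factor[OF L module_axioms L LR mhom_ident mhom_coset[OF P] \<eta>])
    show "X \<in> (\<lambda>u. ?P +>\<^bsub>M\<^esub> u) ` carrier M" if "X \<in> carrier ?L" for X using that by (simp add: carrier_fact_module)
    fix u assume u: "u \<in> carrier M" "?P +>\<^bsub>M\<^esub> u = \<zero>\<^bsub>?L\<^esub>"
    then have "u \<in> ?P" by (simp add: zero_fact_module coset_eq_zero_iff[OF P])
    moreover have "u = u \<oplus>\<^bsub>M\<^esub> x \<odot>\<^bsub>M\<^esub> \<zero>\<^bsub>M\<^esub>" using u x by simp
    ultimately show "?\<eta> u = \<zero>\<^bsub>restr rx ?L'\<^esub>" using \<eta>0[OF u(1)] M.zero_closed unfolding zero_restr by blast
  qed (rule that)
  have p\<eta>: "p (?P +>\<^bsub>M\<^esub> u) = ?\<eta> u" if "u \<in> carrier M" for u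
    using p(2)[of "?P +>\<^bsub>M\<^esub> u" u] that by (simp add: carrier_fact_module)
  have "p ` carrier ?L = carrier ?L'"
    unfolding carrier_fact_module[of M] carrier_fact_module[of ?N] carrier_mod_elt image_image
    by (rule image_cong[OF refl p\<eta>])
  then show ?thesis using that p(1) p\<eta> \<eta>0 by metis
qed

end

section \<open>Multiplication maps and filter regularity\<close>

context module
begin

lemma mult_map_coset:
  assumes I: "ideal I R" and a: "a \<in> carrier R"
    and aP: "\<And>u. u \<in> pow_smult R I k M \<Longrightarrow> a \<odot>\<^bsub>M\<^esub> u \<in> pow_smult R I n M" and u: "u \<in> carrier M"
  shows "mult_map R I M n a (pow_smult R I k M +>\<^bsub>M\<^esub> u) = pow_smult R I n M +>\<^bsub>M\<^esub> (a \<odot>\<^bsub>M\<^esub> u)"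
proof -
  have "pow_smult R I n M +>\<^bsub>M\<^esub> a \<odot>\<^bsub>M\<^esub> v = pow_smult R I n M +>\<^bsub>M\<^esub> a \<odot>\<^bsub>M\<^esub> u"
    if "v \<in> carrier M" "v \<ominus>\<^bsub>M\<^esub> u \<in> pow_smult R I k M" for v
    using that a u aP[OF that(2)] by (simp add: coset_eq_iff[OF submodule_pow_smult[OF I]] flip: smult_diff_r)
  from Union_coset[OF submodule_pow_smult[OF I, of k] u, of "\<lambda>v. pow_smult R I n M +>\<^bsub>M\<^esub> a \<odot>\<^bsub>M\<^esub> v", OF this]
  show ?thesis by (simp add: mult_map_def)
qed

lemma mhom_mult_map:
  assumes I: "ideal I R" and a: "a \<in> carrier R"
    and aP: "\<And>u. u \<in> pow_smult R I k M \<Longrightarrow> a \<odot>\<^bsub>M\<^esub> u \<in> pow_smult R I n M"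
  shows "mhom R (pow_quot R I k M) (pow_quot R I n M) (mult_map R I M n a)"
proof -
  note P = submodule_pow_smult[OF I]
  note mc = mult_map_coset[OF I a aP]
  show ?thesis
  proof (rule mhomI)
    show "mult_map R I M n a X \<in> carrier (pow_quot R I n M)" if "X \<in> carrier (pow_quot R I k M)" for X
      using that a mc by (auto simp: carrier_fact_module)
    show "mult_map R I M n a (X \<oplus>\<^bsub>pow_quot R I k M\<^esub> Y) = mult_map R I M n a X \<oplus>\<^bsub>pow_quot R I n M\<^esub> mult_map R I M n a Y"
      if XY: "X \<in> carrier (pow_quot R I k M)" "Y \<in> carrier (pow_quot R I k M)" for X Y
    proof -
      obtain u where u: "u \<in> carrier M" "X = pow_smult R I k M +>\<^bsub>M\<^esub> u"
        using XY(1) by (auto simp: carrier_fact_module)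
      obtain v where v: "v \<in> carrier M" "Y = pow_smult R I k M +>\<^bsub>M\<^esub> v"
        using XY(2) by (auto simp: carrier_fact_module)
      from u v show ?thesis using a by (simp add: mc add_fact_module[OF P] smult_r_distr)
    qed
    show "mult_map R I M n a (r \<odot>\<^bsub>pow_quot R I k M\<^esub> X) = r \<odot>\<^bsub>pow_quot R I n M\<^esub> mult_map R I M n a X"
      if r: "r \<in> carrier R" and X: "X \<in> carrier (pow_quot R I k M)" for r X
    proof -
      obtain u where "u \<in> carrier M" "X = pow_smult R I k M +>\<^bsub>M\<^esub> u"
        using X by (auto simp: carrier_fact_module)
      then show ?thesis using a r by (simp add: mc smult_fact_module[OF P] R.m_comm flip: smult_assoc1)
    qed
  qed
qed

end

text \<open>An element of one summand is tested together with a fixed element of the other. This is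
  where nonemptiness enters: a product with an empty factor would carry no information.\<close>

lemma filter_regular_graded_direct_sum:
  assumes fr: "filter_regular A (graded_direct_sum E F) r"
    and E: "\<And>n. homogeneous E n \<noteq> {}" and F: "\<And>n. homogeneous F n \<noteq> {}"
  shows "filter_regular A E r" "filter_regular A F r"
proof -
  obtain c where c: "r \<in> carrier A"
    "\<And>n. n \<ge> c \<Longrightarrow> inj_on (\<lambda>w. r \<odot>\<^bsub>graded_direct_sum E F\<^esub> w) (homogeneous E n \<times> homogeneous F n)"
    using fr by (auto simp: filter_regular_def graded_direct_sum_def module.extend_def)
  have sm: "r \<odot>\<^bsub>graded_direct_sum E F\<^esub> (u, v) = (r \<odot>\<^bsub>E\<^esub> u, r \<odot>\<^bsub>F\<^esub> v)" for u v
    by (simp add: graded_direct_sum_def module.extend_def direct_sum_def)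
  have "inj_on (\<lambda>u. r \<odot>\<^bsub>E\<^esub> u) (homogeneous E n) \<and> inj_on (\<lambda>u. r \<odot>\<^bsub>F\<^esub> u) (homogeneous F n)" if n: "n \<ge> c" for n
  proof -
    obtain e f where ef: "e \<in> homogeneous E n" "f \<in> homogeneous F n" using E F by blast
    have "u = u'" if "u \<in> homogeneous E n" "u' \<in> homogeneous E n" "r \<odot>\<^bsub>E\<^esub> u = r \<odot>\<^bsub>E\<^esub> u'" for u u'
      using inj_onD[OF c(2)[OF n], of "(u, f)" "(u', f)"] that ef by (simp add: sm)
    moreover have "v = v'" if "v \<in> homogeneous F n" "v' \<in> homogeneous F n" "r \<odot>\<^bsub>F\<^esub> v = r \<odot>\<^bsub>F\<^esub> v'" for v v'
      using inj_onD[OF c(2)[OF n], of "(e, v)" "(e, v')"] that ef by (simp add: sm)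
    ultimately show ?thesis by (auto intro: inj_onI)
  qed
  then show "filter_regular A E r" "filter_regular A F r" using c(1) unfolding filter_regular_def by blast+
qed

lemma homogeneous_D_module_nonempty:
  assumes "\<And>n. \<zero>\<^bsub>Ext R i M (pow_quot R I n W)\<^esub> \<in> carrier (Ext R i M (pow_quot R I n W))"
  shows "homogeneous (D_module R W I i M) n \<noteq> {}"
proof -
  have "(\<lambda>n. \<zero>\<^bsub>Ext R i M (pow_quot R I n W)\<^esub>) \<in> homogeneous (D_module R W I i M) n"
    using assms by (simp add: D_module_def Let_def)
  then show ?thesis by blast
qed

context resolved
begin

lemma Ext_map_const_zero:
  assumes A: "module R A" and L: "module R L" and X: "X \<in> carrier (Ext R i M A)"
    and h: "mhom R A L h" and h0: "\<And>a. a \<in> carrier A \<Longrightarrow> h a = \<zero>\<^bsub>L\<^esub>"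
  shows "Ext_map R i M L h X = \<zero>\<^bsub>Ext R i M L\<^esub>"
proof -
  interpret CL: module R "Coch i L" by (rule module_Coch[OF L])
  obtain z where z: "z \<in> Zc i A" "X = Bd i A +>\<^bsub>Coch i A\<^esub> z" using X by (auto simp: carrier_Ext)
  have "z v \<in> carrier A" if "v \<in> carrier (F i)" for v
    using z(1) that by (auto simp: mem_Zc_iff carrier_Coch mhom_closed)
  then have "push i h z = \<zero>\<^bsub>Coch i L\<^esub>" by (auto simp: push_def zero_Coch h0)
  then show ?thesis
    by (simp add: z(2) Ext_map_coset[OF A L h z(1)] zero_Ext CL.coset_zero[OF submodule_Bd[OF L]])
qed

text \<open>A class over W/I^n W is viewed as a family concentrated in degree n, and
  \<open>xt\<close> moves it by \<open>x\<close> to degree n + 1. All other terms of the product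
  formula agree for any two classes, being images of zero or induced by the zero map.\<close>

lemma inj_on_Ext_map_of_filter_regular:
  assumes W: "module R W" and I: "ideal I R" and x: "x \<in> I"
    and fr: "filter_regular (rees_algebra R I) (D_module R W I i M) (monom (rees_algebra R I) x 1)"
  obtains c where "\<And>n. n \<ge> c \<Longrightarrow>
    inj_on (Ext_map R i M (pow_quot R I (Suc n) W) (mult_map R I W (Suc n) x)) (carrier (Ext R i M (pow_quot R I n W)))"
proof -
  interpret W: module R W by fact
  let ?r = "monom (rees_algebra R I) x 1"
  let ?L = "\<lambda>n. pow_quot R I n W" and ?D = "D_module R W I i M"
  let ?E = "\<lambda>n. Ext R i M (?L n)"
  have xc: "x \<in> carrier R" by (rule ideal.Icarr[OF I x])
  have L: "module R (?L n)" for n by (rule W.module_fact_module[OF W.submodule_pow_smult[OF I]])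
  have E: "module R (?E n)" for n by (rule module_Ext[OF L])
  have zE: "\<zero>\<^bsub>?E n\<^esub> \<in> carrier (?E n)" for n
    using abelian_group.axioms(1)[OF module.axioms(2)[OF E]] by (rule abelian_monoid.zero_closed)
  have cr: "coeff (rees_algebra R I) ?r j = (if j = 1 then x else \<zero>)" for j
    using xc by (simp add: rees_algebra_def UP_def up_def bound_def)
       (metis One_nat_def R.zero_closed bound.intro nat_neq_iff not_less_eq)
  obtain c where c: "\<And>n. n \<ge> c \<Longrightarrow> inj_on (\<lambda>f. ?r \<odot>\<^bsub>?D\<^esub> f) (homogeneous ?D n)"
    using fr unfolding filter_regular_def by blast
  show ?thesis
  \<comment> \<open>\<open>Suc c\<close> makes n positive, so that \<open>k - 1 = n\<close> in
    truncated subtraction forces k = n + 1.\<close>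
  proof (rule that[of "Suc c"], rule inj_onI)
    fix n X Y assume n: "Suc c \<le> n" and X: "X \<in> carrier (?E n)" and Y: "Y \<in> carrier (?E n)"
      and eq: "Ext_map R i M (?L (Suc n)) (mult_map R I W (Suc n) x) X = Ext_map R i M (?L (Suc n)) (mult_map R I W (Suc n) x) Y"
    define f where "f Z k = (if k = n then Z else \<zero>\<^bsub>?E k\<^esub>)" for Z k
    have hom: "f Z \<in> homogeneous ?D n" if "Z \<in> carrier (?E n)" for Z
    proof -
      have "finite {k. f Z k \<noteq> \<zero>\<^bsub>?E k\<^esub>}" by (rule finite_subset[of _ "{n}"]) (auto simp: f_def)
      then show ?thesis using that zE by (auto simp: D_module_def Let_def f_def)
    qed
    have "Ext_map R i M (?L k) (mult_map R I W k (if j = 1 then x else \<zero>)) (f X (k - j))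
        = Ext_map R i M (?L k) (mult_map R I W k (if j = 1 then x else \<zero>)) (f Y (k - j))" for k j
    proof (cases "k - j = n")
      case False
      then show ?thesis by (simp add: f_def)
    next
      case True
      show ?thesis
      proof (cases "j = 1")
        case True
        then have "k = Suc n" using \<open>k - j = n\<close> n by simp
        then show ?thesis using True eq by (simp add: f_def)
      next
        case False
        have P0: "\<zero> \<odot>\<^bsub>W\<^esub> u \<in> pow_smult R I k W" if "u \<in> pow_smult R I n W" for u
          using W.submodule_subset[OF W.submodule_pow_smult[OF I] that] W.submodule_zero[OF W.submodule_pow_smult[OF I]] by simp
        have h: "mhom R (?L n) (?L k) (mult_map R I W k \<zero>)" by (rule W.mhom_mult_map[OF I R.zero_closed P0])
        have h0: "mult_map R I W k \<zero> a = \<zero>\<^bsub>?L k\<^esub>" if a: "a \<in> carrier (?L n)" for a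
        proof -
          obtain u where u: "u \<in> carrier W" "a = pow_smult R I n W +>\<^bsub>W\<^esub> u" using a by (auto simp: carrier_fact_module)
          have "mult_map R I W k \<zero> a = pow_smult R I k W +>\<^bsub>W\<^esub> (\<zero> \<odot>\<^bsub>W\<^esub> u)"
            unfolding u(2) by (rule W.mult_map_coset[OF I R.zero_closed _ u(1)]) (rule P0)
          then show ?thesis
            using W.coset_zero[OF W.submodule_pow_smult[OF I, of k]] u(1) by (simp add: zero_fact_module)
        qed
        show ?thesis using False True Ext_map_const_zero[OF L L X h h0] Ext_map_const_zero[OF L L Y h h0]
          by (simp add: f_def)
      qed
    qed
    then have "?r \<odot>\<^bsub>?D\<^esub> f X = ?r \<odot>\<^bsub>?D\<^esub> f Y" by (simp only: D_module_def Let_def module.simps cr)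
    then have "f X = f Y" using inj_onD[OF c[of n]] hom[OF X] hom[OF Y] n by auto
    from fun_cong[OF this, of n] show "X = Y" by (simp add: f_def)
  qed
qed

end

section \<open>Polynomials and lengths\<close>

text \<open>Strong induction: t^(k+1) - (t - 1)^(k+1) is (k + 1) t^k plus lower powers of t, with
  coefficients \<open>c i\<close>, and the lower powers already have preimages.\<close>

lemma power_difference_preimage:
  "\<exists>p :: rat poly. \<forall>t. poly p t - poly p (t - 1) = t ^ k"
proof (induction k rule: less_induct)
  case (less k)
  then have "\<exists>p. \<forall>i<k. \<forall>t. poly (p i :: rat poly) t - poly (p i) (t - 1) = t ^ i" by metis
  then obtain p :: "nat \<Rightarrow> rat poly" where p: "\<And>i t. i < k \<Longrightarrow> poly (p i) t - poly (p i) (t - 1) = t ^ i" by blast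
  define c :: "nat \<Rightarrow> rat" where "c i = - of_nat (Suc k choose i) * (- 1) ^ (Suc k - i)" for i
  let ?q = "Polynomial.smult (1 / of_nat (Suc k)) (Polynomial.monom 1 (Suc k) - (\<Sum>i<k. Polynomial.smult (c i) (p i)))"
  have "poly ?q t - poly ?q (t - 1) = t ^ k" for t
  proof -
    have "(t - 1) ^ Suc k = (\<Sum>i\<le>Suc k. of_nat (Suc k choose i) * t ^ i * (- 1) ^ (Suc k - i))"
      using binomial_ring[of t "- 1" "Suc k"] by simp
    also have "\<dots> = t ^ Suc k + (\<Sum>i\<le>k. of_nat (Suc k choose i) * t ^ i * (- 1) ^ (Suc k - i))" by simp
    also have "(\<Sum>i\<le>k. of_nat (Suc k choose i) * t ^ i * (- 1) ^ (Suc k - i)) =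
        (\<Sum>i<k. of_nat (Suc k choose i) * t ^ i * (- 1) ^ (Suc k - i)) - of_nat (Suc k) * t ^ k"
      by (simp flip: lessThan_Suc_atMost)
    also have "(\<Sum>i<k. of_nat (Suc k choose i) * t ^ i * (- 1) ^ (Suc k - i)) = - (\<Sum>i<k. c i * t ^ i)"
      unfolding sum_negf[symmetric] by (intro sum.cong refl) (simp add: c_def)
    finally have A: "t ^ Suc k - (t - 1) ^ Suc k = of_nat (Suc k) * t ^ k + (\<Sum>i<k. c i * t ^ i)" by simp
    have B: "(\<Sum>i<k. c i * t ^ i) = (\<Sum>i<k. c i * poly (p i) t) - (\<Sum>i<k. c i * poly (p i) (t - 1))"
      unfolding sum_subtractf[symmetric] right_diff_distrib[symmetric] by (intro sum.cong refl) (simp add: p)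
    have "poly ?q t - poly ?q (t - 1) = (1 / of_nat (Suc k)) *
        ((t ^ Suc k - (t - 1) ^ Suc k) - ((\<Sum>i<k. c i * poly (p i) t) - (\<Sum>i<k. c i * poly (p i) (t - 1))))"
      by (simp only: poly_smult poly_diff poly_monom poly_sum) (simp add: algebra_simps)
    also have "\<dots> = (1 / of_nat (Suc k)) * (of_nat (Suc k) * t ^ k)" unfolding A B by simp
    also have "\<dots> = t ^ k" by (simp del: of_nat_Suc)
    finally show ?thesis .
  qed
  then show ?case by blast
qed

lemma poly_difference_preimage:
  fixes q :: "rat poly"
  obtains p where "\<And>t. poly p t - poly p (t - 1) = poly q t"
proof -
  obtain r :: "nat \<Rightarrow> rat poly" where r: "\<And>k t. poly (r k) t - poly (r k) (t - 1) = t ^ k"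
    using power_difference_preimage by metis
  let ?p = "\<Sum>i\<le>degree q. Polynomial.smult (Polynomial.coeff q i) (r i)"
  have "poly ?p t - poly ?p (t - 1) = poly q t" for t
    unfolding poly_sum poly_smult poly_altdef[of q] sum_subtractf[symmetric] right_diff_distrib[symmetric] r ..
  then show ?thesis by (rule that)
qed

text \<open>The identity is one of polynomials, hence holds at every n and not just for large n.
  \<open>a n\<close> is the length that belongs to I^n while the polynomial at n refers to I^(n+1),
  hence the shift to \<open>a (Suc n)\<close>. The existence of a polynomial for either side becomes
  a statement about the numbers \<open>a n\<close> alone.\<close>

lemma eps_poly_difference:
  assumes rel: "\<forall>\<^sub>F n in sequentially.
      module_length R (Ext R i M (pow_quot R I (Suc n) W)) =
        module_length R (Ext R i M (pow_quot R I n W)) + module_length S (Ext S i N (pow_quot S J (Suc n) V))"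
    and fin: "\<And>n. module_length R (Ext R i M (pow_quot R I n W)) \<noteq> \<infinity>"
  shows "poly (eps_poly R W I i M) (of_nat n) - poly (eps_poly R W I i M) (of_nat n - 1)
      = poly (eps_poly S V J i N) (of_nat n)"
proof -
  define a where "a n = the_enat (module_length R (Ext R i M (pow_quot R I n W)))" for n
  have a: "module_length R (Ext R i M (pow_quot R I n W)) = enat (a n)" for n
    unfolding a_def using fin[of n] by auto
  define g where "g n = module_length S (Ext S i N (pow_quot S J (Suc n) V))" for n
  obtain n0 where n0: "\<And>n. n \<ge> n0 \<Longrightarrow> enat (a (Suc n)) = enat (a n) + g n"
    using rel unfolding eventually_sequentially a g_def by blast
  have g: "a n \<le> a (Suc n) \<and> g n = enat (a (Suc n) - a n)" if n: "n \<ge> n0" for n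
    using n0[OF n] by (cases "g n") auto
  have eps_f: "is_eps_poly R W I i M p \<longleftrightarrow> (\<forall>\<^sub>F n in sequentially. poly p (of_nat n) = of_nat (a (Suc n)))" for p
    unfolding is_eps_poly_def Suc_eq_plus1[symmetric] a by simp
  have "is_eps_poly S V J i N q \<longleftrightarrow> (\<forall>\<^sub>F n in sequentially. \<exists>l. g n = enat l \<and> poly q (of_nat n) = of_nat l)" for q
    unfolding is_eps_poly_def Suc_eq_plus1[symmetric] g_def ..
  moreover have "\<forall>\<^sub>F n in sequentially. (\<exists>l. g n = enat l \<and> poly q (of_nat n) = of_nat l)
      \<longleftrightarrow> poly q (of_nat n) = of_nat (a (Suc n)) - of_nat (a n)" for q :: "rat poly"
    using eventually_ge_at_top[of n0] by eventually_elim (use g in \<open>auto simp: of_nat_diff\<close>)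
  ultimately have eps_g: "is_eps_poly S V J i N q \<longleftrightarrow>
      (\<forall>\<^sub>F n in sequentially. poly q (of_nat n) = of_nat (a (Suc n)) - of_nat (a n))" for q
    by (simp add: eventually_subst)
  have A: ?thesis if p: "is_eps_poly R W I i M p" for p
  proof -
    let ?q = "p - pcompose p [:- 1, 1:]"
    have "\<forall>\<^sub>F n in sequentially. poly p (of_nat n) = of_nat (a (Suc n))" using p unfolding eps_f .
    then obtain k where k: "\<And>n. n \<ge> k \<Longrightarrow> poly p (of_nat n) = of_nat (a (Suc n))"
      unfolding eventually_sequentially by blast
    \<comment> \<open>One index is lost because the difference also uses the value of
      \<open>p\<close> at n - 1.\<close>
    have "poly ?q (of_nat n) = of_nat (a (Suc n)) - of_nat (a n)" if n: "n \<ge> Suc k" for n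
    proof -
      obtain m where m: "n = Suc m" "m \<ge> k" using n by (cases n) auto
      have "poly ?q (of_nat n) = poly p (of_nat n) - poly p (of_nat m)"
        by (simp add: poly_pcompose m(1))
      then show ?thesis using k[of n] k[of m] m by simp
    qed
    then have "is_eps_poly S V J i N ?q" unfolding eps_g eventually_sequentially by blast
    then have "eps_poly S V J i N = ?q" by (rule eps_poly_eqI)
    moreover have "eps_poly R W I i M = p" by (rule eps_poly_eqI[OF p])
    ultimately show ?thesis by (simp add: poly_pcompose)
  qed
  have B: "\<exists>p. is_eps_poly R W I i M p" if q: "is_eps_poly S V J i N q" for q
  proof -
    obtain P where P: "\<And>t. poly P t - poly P (t - 1) = poly q t" using poly_difference_preimage[of q] by blast
    obtain k where k: "\<And>n. n \<ge> k \<Longrightarrow> poly q (of_nat n) = of_nat (a (Suc n)) - of_nat (a n)"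
      using q unfolding eps_g eventually_sequentially by blast
    \<comment> \<open>Summation determines the polynomial up to a constant; \<open>C\<close> fits it
      at \<open>n = k\<close>.\<close>
    define C where "C = of_nat (a (Suc k)) - poly P (of_nat k)"
    have "poly (P + [:C:]) (of_nat n) = of_nat (a (Suc n))" if "n \<ge> k" for n
      using that
    proof (induction n rule: dec_induct)
      case (step n)
      have "poly P (of_nat (Suc n)) - poly P (of_nat n) = of_nat (a (Suc (Suc n))) - of_nat (a (Suc n))"
        using P[of "of_nat (Suc n)"] k[of "Suc n"] step by simp
      then show ?case using step.IH by simp
    qed (simp add: C_def)
    then have "is_eps_poly R W I i M (P + [:C:])" unfolding eps_f eventually_sequentially by blast
    then show ?thesis by blast
  qed
  show ?thesis
  proof (cases "\<exists>p. is_eps_poly R W I i M p")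
    case True
    then show ?thesis using A by blast
  next
    case False
    then have "\<not> (\<exists>q. is_eps_poly S V J i N q)" using B by blast
    with False show ?thesis by (simp add: eps_poly_def)
  qed
qed

section \<open>The exact sequence for large n and the recurrence for the lengths\<close>

context noetherian_local_ring
begin

text \<open>To be applied to R and \<omega>. Positive depth provides the regular element of \<mm>
  that \<open>regular_on_of_superficial\<close> asks for, namely the first member of a regular
  sequence.\<close>

lemma superficial_direct_sum_regular:
  assumes M: "fin_gen_module R M" and N: "fin_gen_module R N"
    and I: "primary_to R \<mm> I" and sup: "superficial R I (direct_sum M N) x"
    and d: "d \<ge> 1" and dM: "depth R \<mm> M = enat d" and dN: "depth R \<mm> N = enat d"
  shows "regular_on M x" "regular_on N x"
    and "\<exists>n0. \<forall>n\<ge>n0. \<forall>u\<in>carrier N. x \<odot>\<^bsub>N\<^esub> u \<in> pow_smult R I (Suc n) N \<longrightarrow> u \<in> pow_smult R I n N"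
proof -
  interpret M: module R M using M by (simp add: fin_gen_module_def)
  interpret N: module R N using N by (simp add: fin_gen_module_def)
  note I' = primary_to_facts[OF I]
  have x: "x \<in> I" using sup by (simp add: superficial_def)
  have nM: "noeth R M" and nN: "noeth R N"
    using M.noeth_of_fin_gen[OF noetherian_ring_axioms M] N.noeth_of_fin_gen[OF noetherian_ring_axioms N] by auto
  have E: "module R (direct_sum M N)" by (rule module_direct_sum[OF M.module_axioms N.module_axioms])
  have hd: "\<exists>y\<in>\<mm>. regular_on L y" if L: "module R L" "depth R \<mm> L = enat d" for L :: "('a, 'z, 'y) module_scheme"
  proof -
    obtain xs where xs: "length xs = d" "set xs \<subseteq> \<mm>" "regular_sequence R L xs" by (rule depth_attained[OF L(2) d])
    have "xs ! 0 \<in> set xs" using xs(1) d by (intro nth_mem) simp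
    then have "xs ! 0 \<in> \<mm>" using xs(2) by blast
    then show ?thesis using module.regular_sequence_hd[OF L(1) xs(3)] xs d by auto
  qed
  have iM: "mhom R M (direct_sum M N) (\<lambda>u. (u, \<zero>\<^bsub>N\<^esub>))" and iN: "mhom R N (direct_sum M N) (\<lambda>u. (\<zero>\<^bsub>M\<^esub>, u))"
    by (auto simp: mhom_def direct_sum_def)
  obtain c where c: "\<And>n u. n \<ge> c \<Longrightarrow> u \<in> pow_smult R I c M \<Longrightarrow> x \<odot>\<^bsub>M\<^esub> u \<in> pow_smult R I (Suc n) M \<Longrightarrow> u \<in> pow_smult R I n M"
    by (rule superficial_retract[OF E M.module_axioms iM mhom_fst _ I'(1) sup]) (simp, rule that)
  obtain y where y: "y \<in> \<mm>" "regular_on M y" using hd[OF M.module_axioms dM] by blast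
  show "regular_on M x" by (rule regular_on_of_superficial[OF M.module_axioms nM I x c y])
  obtain c' where c': "\<And>n u. n \<ge> c' \<Longrightarrow> u \<in> pow_smult R I c' N \<Longrightarrow> x \<odot>\<^bsub>N\<^esub> u \<in> pow_smult R I (Suc n) N \<Longrightarrow> u \<in> pow_smult R I n N"
    by (rule superficial_retract[OF E N.module_axioms iN mhom_snd _ I'(1) sup]) (simp, rule that)
  obtain y' where y': "y' \<in> \<mm>" "regular_on N y'" using hd[OF N.module_axioms dN] by blast
  show rN: "regular_on N x" by (rule regular_on_of_superficial[OF N.module_axioms nN I x c' y'])
  obtain n0 where "\<And>n u. n \<ge> n0 \<Longrightarrow> u \<in> carrier N \<Longrightarrow> x \<odot>\<^bsub>N\<^esub> u \<in> pow_smult R I (Suc n) N \<Longrightarrow> u \<in> pow_smult R I n N"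
    by (rule eventually_colon[OF N.module_axioms nN I'(1) x rN c'], assumption+, rule that)
  then show "\<exists>n0. \<forall>n\<ge>n0. \<forall>u\<in>carrier N. x \<odot>\<^bsub>N\<^esub> u \<in> pow_smult R I (Suc n) N \<longrightarrow> u \<in> pow_smult R I n N"
    by blast
qed

text \<open>Finiteness is what allows the recurrence to be solved for its last term.\<close>

lemma module_length_Ext_pow_quot_finite:
  assumes rM: "resolved R M \<pi>" and W: "fin_gen_module R W" and I: "primary_to R \<mm> I"
  shows "module_length R (Ext R i M (pow_quot R I n W)) \<noteq> \<infinity>"
proof (rule resolved.module_length_Ext_finite[OF rM])
  interpret W: module R W using W by (simp add: fin_gen_module_def)
  note P = W.submodule_pow_smult[OF primary_to_facts(1)[OF I], of n]
  show "module R (pow_quot R I n W)" by (rule W.module_fact_module[OF P])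
  have "module_length R (pow_quot R I n W) = mlen R W (pow_smult R I n W) (carrier W)"
    using W.module_length_subquotient[OF W.carrier_is_submodule P W.submoduleE(1)[OF P]] by simp
  then show "module_length R (pow_quot R I n W) \<noteq> \<infinity>"
    using finite_mlen_pow_smult[OF W.module_axioms W.noeth_of_fin_gen[OF noetherian_ring_axioms W] I] by simp
qed

text \<open>For i = 0 injectivity is needed in degrees 0 and 1, for i = 1 in degrees 1 and 2.
  Degrees 1 and 2 come from filter regularity, degree 0 from the colon condition \<open>col\<close>,
  which makes multiplication by \<open>x\<close> injective on the modules themselves.\<close>

lemma module_length_Ext_recurrence:
  assumes M: "fin_gen_module R M" and W: "fin_gen_module R W" and I: "primary_to R \<mm> I" and x: "x \<in> I"
    and rM: "resolved R M \<pi>" and regM: "regular_on M x" and regW: "regular_on W x"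
    and col: "\<And>n u. n \<ge> n0 \<Longrightarrow> u \<in> carrier W \<Longrightarrow> x \<odot>\<^bsub>W\<^esub> u \<in> pow_smult R I (Suc n) W \<Longrightarrow> u \<in> pow_smult R I n W"
    and fr1: "filter_regular (rees_algebra R I) (D_module R W I 1 M) (monom (rees_algebra R I) x 1)"
    and fr2: "filter_regular (rees_algebra R I) (D_module R W I 2 M) (monom (rees_algebra R I) x 1)"
    and i: "i = 0 \<or> i = 1"
  shows "\<forall>\<^sub>F n in sequentially.
      module_length R (Ext R i M (pow_quot R I (Suc n) W)) =
        module_length R (Ext R i M (pow_quot R I n W)) +
        module_length (R Quot PIdl x) (Ext (R Quot PIdl x) i (mod_elt M x)
          (pow_quot (R Quot PIdl x) ((+>) (PIdl x) ` I) (Suc n) (mod_elt W x)))"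
proof -
  note I' = primary_to_facts[OF I]
  have xc: "x \<in> carrier R" using ideal.Icarr[OF I'(1) x] .
  interpret W: module R W using W by (simp add: fin_gen_module_def)
  interpret M: module R M using M by (simp add: fin_gen_module_def)
  interpret XM: module_mod_elt R M x
    by (intro module_mod_elt.intro M.module_axioms module_mod_elt_axioms.intro xc)
  interpret XW: module_mod_elt R W x
    by (intro module_mod_elt.intro W.module_axioms module_mod_elt_axioms.intro xc)
  let ?S = "R Quot PIdl x" and ?\<rho> = "(+>) (PIdl x)"
  have nS: "noetherian_ring ?S" by (rule noetherian_Quot[OF noetherian_ring_axioms XM.ideal_PIdl])
  obtain \<pi>' where \<pi>': "free_resolution ?S (mod_elt M x) (fst (chosen_resolution ?S (mod_elt M x)))
      (snd (chosen_resolution ?S (mod_elt M x))) \<pi>'"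
    by (rule chosen_resolution_is_resolution[OF nS XM.fin_gen_mod_elt[OF M]])
  have rS: "resolved ?S (mod_elt M x) \<pi>'"
    by (intro resolved.intro XM.module_mod_elt resolved_axioms.intro \<pi>')
  interpret C: change_of_rings R M \<pi> x \<pi>'
    by (intro change_of_rings.intro rM rS XM.module_mod_elt_axioms change_of_rings_axioms.intro regM)
  let ?L = "\<lambda>n. pow_quot R I n W" and ?Q = "\<lambda>n. pow_quot ?S (?\<rho> ` I) n (mod_elt W x)"
  let ?\<chi> = "\<lambda>n. mult_map R I W (Suc n) x"
  note P = W.submodule_pow_smult[OF I'(1)]
  have L: "module R (?L n)" for n by (rule W.module_fact_module[OF P])
  have Q: "module ?S (?Q n)" for n by (rule XW.module_pow_quot_mod_elt[OF I'(1)])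
  have xP: "x \<odot>\<^bsub>W\<^esub> u \<in> pow_smult R I (Suc n) W" if "u \<in> pow_smult R I n W" for u n
    by (rule W.pow_smult_step[OF I'(1) x that])
  have \<chi>: "mhom R (?L n) (?L (Suc n)) (?\<chi> n)" for n by (rule W.mhom_mult_map[OF I'(1) xc]) (rule xP)
  have \<chi>c: "?\<chi> n (pow_smult R I n W +>\<^bsub>W\<^esub> u) = pow_smult R I (Suc n) W +>\<^bsub>W\<^esub> (x \<odot>\<^bsub>W\<^esub> u)"
    if "u \<in> carrier W" for n u
    by (rule W.mult_map_coset[OF I'(1) xc _ that]) (rule xP)
  obtain c1 where c1: "\<And>n. n \<ge> c1 \<Longrightarrow> inj_on (Ext_map R 1 M (?L (Suc n)) (?\<chi> n)) (carrier (Ext R 1 M (?L n)))"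
    using C.inj_on_Ext_map_of_filter_regular[OF W.module_axioms I'(1) x fr1] by blast
  obtain c2 where c2: "\<And>n. n \<ge> c2 \<Longrightarrow> inj_on (Ext_map R 2 M (?L (Suc n)) (?\<chi> n)) (carrier (Ext R 2 M (?L n)))"
    using C.inj_on_Ext_map_of_filter_regular[OF W.module_axioms I'(1) x fr2] by blast
  have "module_length R (Ext R i M (?L (Suc n))) = module_length R (Ext R i M (?L n)) + module_length ?S (Ext ?S i (mod_elt M x) (?Q (Suc n)))"
    if n: "n \<ge> max n0 (max c1 c2)" for n
  proof -
    have inj: "inj_on (?\<chi> n) (carrier (?L n))"
    proof (rule inj_onI)
      fix X Y assume "X \<in> carrier (?L n)" and "Y \<in> carrier (?L n)" and eq: "?\<chi> n X = ?\<chi> n Y"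
      then obtain u v where u: "u \<in> carrier W" "X = pow_smult R I n W +>\<^bsub>W\<^esub> u"
        and v: "v \<in> carrier W" "Y = pow_smult R I n W +>\<^bsub>W\<^esub> v" unfolding carrier_fact_module by blast
      have "x \<odot>\<^bsub>W\<^esub> (u \<ominus>\<^bsub>W\<^esub> v) \<in> pow_smult R I (Suc n) W"
        using eq unfolding u(2) v(2) \<chi>c[OF u(1)] \<chi>c[OF v(1)]
        using W.coset_eq_iff[OF P, of "x \<odot>\<^bsub>W\<^esub> u" "x \<odot>\<^bsub>W\<^esub> v" "Suc n"] u(1) v(1) xc
        by (simp only: W.smult_closed W.smult_diff_r)
      then have "u \<ominus>\<^bsub>W\<^esub> v \<in> pow_smult R I n W" using col[of n "u \<ominus>\<^bsub>W\<^esub> v"] n u(1) v(1) by simp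
      then show "X = Y" unfolding u(2) v(2) using W.coset_eq_iff[OF P u(1) v(1)] by simp
    qed
    have i0: "C.inj_on_Ext 0 (?L n) (?L (Suc n)) (?\<chi> n)" by (rule C.inj_on_Ext_0[OF L L \<chi> inj])
    have i1: "C.inj_on_Ext 1 (?L n) (?L (Suc n)) (?\<chi> n)" by (rule C.inj_on_ExtI[OF L L \<chi> c1]) (use n in simp)
    have i2: "C.inj_on_Ext 2 (?L n) (?L (Suc n)) (?\<chi> n)" by (rule C.inj_on_ExtI[OF L L \<chi> c2]) (use n in simp)
    have ii: "C.inj_on_Ext i (?L n) (?L (Suc n)) (?\<chi> n)" "C.inj_on_Ext (Suc i) (?L n) (?L (Suc n)) (?\<chi> n)"
      using i i0 i1 i2 by (auto simp: numeral_2_eq_2)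
    obtain p where p: "mhom R (?L (Suc n)) (restr ?\<rho> (?Q (Suc n))) p" "p ` carrier (?L (Suc n)) = carrier (?Q (Suc n))"
      "\<And>u. u \<in> carrier W \<Longrightarrow> p (pow_smult R I (Suc n) W +>\<^bsub>W\<^esub> u) = \<zero>\<^bsub>?Q (Suc n)\<^esub> \<longleftrightarrow>
        (\<exists>w\<in>pow_smult R I (Suc n) W. \<exists>v\<in>carrier W. u = w \<oplus>\<^bsub>W\<^esub> x \<odot>\<^bsub>W\<^esub> v)"
      by (rule XW.reduction_map[OF I'(1), of "Suc n"], rule that)
    have p2: "p ` carrier (?L (Suc n)) = carrier (restr ?\<rho> (?Q (Suc n)))" using p(2) by simp
    \<comment> \<open>Exactness in the middle: both sides say that a representative \<open>u\<close>
      of \<open>X\<close> lies in I^(n+1) W + xW.\<close>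
    have ex: "p X = \<zero>\<^bsub>restr ?\<rho> (?Q (Suc n))\<^esub> \<longleftrightarrow> X \<in> ?\<chi> n ` carrier (?L n)" if X: "X \<in> carrier (?L (Suc n))" for X
    proof -
      obtain u where u: "u \<in> carrier W" "X = pow_smult R I (Suc n) W +>\<^bsub>W\<^esub> u" using X unfolding carrier_fact_module by blast
      have "p X = \<zero>\<^bsub>?Q (Suc n)\<^esub> \<longleftrightarrow> (\<exists>v\<in>carrier W. \<exists>w\<in>pow_smult R I (Suc n) W. u = w \<oplus>\<^bsub>W\<^esub> x \<odot>\<^bsub>W\<^esub> v)"
        unfolding u(2) p(3)[OF u(1)] by blast
      also have "\<dots> \<longleftrightarrow> (\<exists>v\<in>carrier W. X = ?\<chi> n (pow_smult R I n W +>\<^bsub>W\<^esub> v))"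
      proof (intro bex_cong refl)
        fix v assume v: "v \<in> carrier W"
        have xv: "x \<odot>\<^bsub>W\<^esub> v \<in> carrier W" using v xc by simp
        have "(\<exists>w\<in>pow_smult R I (Suc n) W. u = w \<oplus>\<^bsub>W\<^esub> x \<odot>\<^bsub>W\<^esub> v) \<longleftrightarrow> u \<ominus>\<^bsub>W\<^esub> x \<odot>\<^bsub>W\<^esub> v \<in> pow_smult R I (Suc n) W"
        proof
          assume "\<exists>w\<in>pow_smult R I (Suc n) W. u = w \<oplus>\<^bsub>W\<^esub> x \<odot>\<^bsub>W\<^esub> v"
          then obtain w where w: "w \<in> pow_smult R I (Suc n) W" "u = x \<odot>\<^bsub>W\<^esub> v \<oplus>\<^bsub>W\<^esub> w"
            using W.submodule_subset[OF P] xv W.M.a_comm by metis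
          then show "u \<ominus>\<^bsub>W\<^esub> x \<odot>\<^bsub>W\<^esub> v \<in> pow_smult R I (Suc n) W"
            using W.add_diff_cancel[OF W.submodule_subset[OF P w(1)] xv] by metis
        next
          assume w: "u \<ominus>\<^bsub>W\<^esub> x \<odot>\<^bsub>W\<^esub> v \<in> pow_smult R I (Suc n) W"
          have "u = (u \<ominus>\<^bsub>W\<^esub> x \<odot>\<^bsub>W\<^esub> v) \<oplus>\<^bsub>W\<^esub> x \<odot>\<^bsub>W\<^esub> v"
            using W.diff_add_cancel[OF u(1) xv] W.M.a_comm[OF W.M.minus_closed[OF u(1) xv] xv] by simp
          then show "\<exists>w\<in>pow_smult R I (Suc n) W. u = w \<oplus>\<^bsub>W\<^esub> x \<odot>\<^bsub>W\<^esub> v" using w by blast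
        qed
        then show "(\<exists>w\<in>pow_smult R I (Suc n) W. u = w \<oplus>\<^bsub>W\<^esub> x \<odot>\<^bsub>W\<^esub> v) \<longleftrightarrow> X = ?\<chi> n (pow_smult R I n W +>\<^bsub>W\<^esub> v)"
          unfolding u(2) \<chi>c[OF v] W.coset_eq_iff[OF P u(1) xv] .
      qed
      also have "\<dots> \<longleftrightarrow> X \<in> ?\<chi> n ` carrier (?L n)" unfolding carrier_fact_module[of W "pow_smult R I n W"] by blast
      finally show ?thesis by simp
    qed
    have "module_length R (Ext R i M (?L (Suc n))) = module_length R (Ext R i M (?L n)) + module_length R (Ext R i M (restr ?\<rho> (?Q (Suc n))))"
      by (rule C.module_length_Ext_exact[OF L L C.module_res[OF Q] \<chi> inj p(1) p2 ex ii])
    also have "module_length R (Ext R i M (restr ?\<rho> (?Q (Suc n)))) = module_length ?S (Ext ?S i (mod_elt M x) (?Q (Suc n)))"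
      using i C.module_length_Ext_0[OF Q] C.module_length_Ext_1[OF Q] by metis
    finally show ?thesis .
  qed
  then show ?thesis unfolding eventually_sequentially by blast
qed

end

theorem proposition3p3:
  fixes R :: "'a ring" and \<omega> :: "('a, 'c) module" and M :: "('a, 'b) module"
    and \<mm> I :: "'a set" and x :: 'a and d :: nat
  defines "S \<equiv> R Quot (PIdl\<^bsub>R\<^esub> x)"
    and "J \<equiv> (\<lambda>a. PIdl\<^bsub>R\<^esub> x +>\<^bsub>R\<^esub> a) ` I"
    and "N \<equiv> mod_elt M x"
    and "\<omega>\<^sub>S \<equiv> mod_elt \<omega> x"
  assumes "cohen_macaulay_local_ring R \<mm>"
    and "krull_dim R = enat d" and "d \<ge> 1"
    and "infinite (carrier (R Quot \<mm>))"
    and "canonical_module R \<mm> \<omega>"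
    and "primary_to R \<mm> I"
    and "maximal_cohen_macaulay R \<mm> M"
    and "x \<in> I - ideal_pow R I 2"
    and "superficial R I (direct_sum (self_module R) \<omega>) x"
    and "filter_regular (rees_algebra R I)
           (graded_direct_sum (D_module R \<omega> I 1 M) (D_module R \<omega> I 2 M))
           (monom (rees_algebra R I) x 1)"
  shows "(\<forall>\<^sub>F n in sequentially.
            poly (eps_poly R \<omega> I 0 M) (of_nat n) - poly (eps_poly R \<omega> I 0 M) (of_nat n - 1)
              = poly (eps_poly S \<omega>\<^sub>S J 0 N) (of_nat n)) \<and>
         (\<forall>\<^sub>F n in sequentially.
            poly (eps_poly R \<omega> I 1 M) (of_nat n) - poly (eps_poly R \<omega> I 1 M) (of_nat n - 1)
              = poly (eps_poly S \<omega>\<^sub>S J 1 N) (of_nat n))"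
proof -
  interpret noetherian_local_ring R \<mm> using assms(5) by (simp add: cohen_macaulay_local_ring_def)
  have \<omega>: "fin_gen_module R \<omega>" "depth R \<mm> \<omega> = enat d"
    using assms(6,9) by (simp_all add: canonical_module_def maximal_cohen_macaulay_def)
  have M: "fin_gen_module R M" using assms(11) by (simp add: maximal_cohen_macaulay_def)
  have dR: "depth R \<mm> (self_module R) = enat d" using assms(5,6) by (simp add: cohen_macaulay_local_ring_def)
  have x: "x \<in> I" using assms(12) by simp
  note I = primary_to_facts[OF assms(10)]
  have xc: "x \<in> carrier R" using ideal.Icarr[OF I(1) x] .
  note sup = superficial_direct_sum_regular[OF fin_gen_self_module \<omega>(1) assms(10,13,7) dR \<omega>(2)]
  have regR: "r = \<zero>\<^bsub>R\<^esub>" if "r \<in> carrier R" "x \<otimes>\<^bsub>R\<^esub> r = \<zero>\<^bsub>R\<^esub>" for r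
    using sup(1) that by (simp add: regular_on_def self_module_def)
  have regM: "regular_on M x"
    by (rule regular_on_maximal_cohen_macaulay[OF assms(6,7,11) xc regR])
  obtain n0 where n0: "\<And>n u. n \<ge> n0 \<Longrightarrow> u \<in> carrier \<omega> \<Longrightarrow> x \<odot>\<^bsub>\<omega>\<^esub> u \<in> pow_smult R I (Suc n) \<omega> \<Longrightarrow> u \<in> pow_smult R I n \<omega>"
    using sup(3) by blast
  obtain \<pi> where \<pi>: "free_resolution R M (fst (chosen_resolution R M)) (snd (chosen_resolution R M)) \<pi>"
    by (rule chosen_resolution_is_resolution[OF noetherian_ring_axioms M])
  have rM: "resolved R M \<pi>"
    using M by (intro resolved.intro resolved_axioms.intro \<pi>) (simp add: fin_gen_module_def)
  have P: "module R (pow_quot R I n \<omega>)" for n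
    using \<omega>(1) by (intro module.module_fact_module module.submodule_pow_smult I(1)) (simp_all add: fin_gen_module_def)
  have "\<zero>\<^bsub>Ext R i M (pow_quot R I n \<omega>)\<^esub> \<in> carrier (Ext R i M (pow_quot R I n \<omega>))" for i n
    using abelian_group.axioms(1)[OF module.axioms(2)[OF resolved.module_Ext[OF rM P]]]
    by (rule abelian_monoid.zero_closed)
  \<comment> \<open>The zero classes make the homogeneous parts nonempty, so filter regularity on
    the direct sum splits into its two summands.\<close>
  note fr = filter_regular_graded_direct_sum[OF assms(14) homogeneous_D_module_nonempty homogeneous_D_module_nonempty, OF this this]
  note rec = module_length_Ext_recurrence[OF M \<omega>(1) assms(10) x rM regM sup(2) n0 fr]
  note fin = module_length_Ext_pow_quot_finite[OF rM \<omega>(1) assms(10)]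
  \<comment> \<open>\<open>eps_poly_difference\<close> gives the identity at every n, so it holds
    eventually.\<close>
  show ?thesis unfolding S_def J_def N_def \<omega>\<^sub>S_def
    using eps_poly_difference[OF rec fin] by (intro conjI always_eventually allI) auto
qed

end
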